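(* Let $P$ be a finite $(3+1)$-free poset and $\lambda$ a hook shape $(\ell,1^k)$. Then $$\mathfrak{m}^P_\lambda(\mathbf{u})\equiv\sum_{T\in\mathrm{KT}_P(\lambda)}\mathbf{u}_{\mathrm{colword}(T)}\pmod{I^P_H}.$$
   Context: $(3+1)$-free: no induced 3-chain plus disjoint point. $a<_Pb$: strict order; $a\sim_Pb$: incomparable or equal. $\mathcal{U}_P=\mathbb{Z}\langle u_a:a\in P\rangle$, $\mathbf{u}_w=u_{w_1}\cdots u_{w_n}$. $e^P_k(\mathbf{u})=\sum u_{a_1}\cdots u_{a_k}$ over $a_1>_P\cdots>_Pa_k$ ($e^P_0=1$, $e^P_k=0$ for $k<0$). For a partition $\mu$ with $j=\mu_1$, $\mathfrak{J}^P_\mu(\mathbf{u})=\sum_{\pi\in S_j}\mathrm{sgn}(\pi)\prod_{i=1}^{j}e^P_{\mu'_i+\pi(i)-i}(\mathbf{u})$ (product in order $i=1,\dots,j$), and $\mathfrak{m}^P_\lambda(\mathbf{u})=\sum_\mu(K^{-1})_{\lambda\mu}\mathfrak{J}^P_\mu(\mathbf{u})$, where $K$ is the Kostka matrix and the sum is over partitions $\mu$ of $|\lambda|$. $I^P_H$ is the two-sided ideal generated by $u_cu_a-u_au_c$ for $a<_Pc$, and $u_cu_au_b-u_bu_cu_a$ for $a\sim_Pb$, $b\sim_Pc$, $a<_Pc$. A $P$-tableau of shape $\lambda$: filling of the Young diagram (English notation) with $T(1,c)<_PT(2,c)<_P\cdots$ down columns and $T(r,c+1)\not<_PT(r,c)$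 along rows; $\mathrm{colword}(T)$ reads columns bottom to top, left to right. A word $w_1\cdots w_n$ is $P$-weakly increasing if $w_{i+1}\not<_Pw_i$ for all $i$; it is a power word if it is $P$-weakly increasing and there is no $i<n$ with $w_i<_Pw_j$ for all $j>i$. A hook-shaped $P$-tableau with first row $w_1,\dots,w_\ell$ is a key $P$-tableau if $v\,w_2w_3\cdots w_\ell$ is a power word for some entry $v$ of its first column; $\mathrm{KT}_P(\lambda)$ denotes the set of key $P$-tableaux of shape $\lambda$. *)

theory Defs
  imports "HOL-Combinatorics.Permutations"
begin

text \<open>The poset P is a finite type with its order; the strict order is <.
  Elements of U_P are represented by their coefficient functions on words
  (finitely supported functions from 'a list to int).\<close>

definition nc_poly :: "('a list \<Rightarrow> int) \<Rightarrow> bool" where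
  "nc_poly f \<longleftrightarrow> finite {w. f w \<noteq> 0}"

definition nc_zero :: "'a list \<Rightarrow> int" where
  "nc_zero = (\<lambda>w. 0)"

definition nc_one :: "'a list \<Rightarrow> int" where
  "nc_one = (\<lambda>w. if w = [] then 1 else 0)"

definition nc_mono :: "'a list \<Rightarrow> 'a list \<Rightarrow> int" where
  "nc_mono v = (\<lambda>w. if w = v then 1 else 0)"

definition nc_add :: "('a list \<Rightarrow> int) \<Rightarrow> ('a list \<Rightarrow> int) \<Rightarrow> 'a list \<Rightarrow> int" where
  "nc_add f g = (\<lambda>w. f w + g w)"

definition nc_diff :: "('a list \<Rightarrow> int) \<Rightarrow> ('a list \<Rightarrow> int) \<Rightarrow> 'a list \<Rightarrow> int" where
  "nc_diff f g = (\<lambda>w. f w - g w)"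

definition nc_mult :: "('a list \<Rightarrow> int) \<Rightarrow> ('a list \<Rightarrow> int) \<Rightarrow> 'a list \<Rightarrow> int" where
  "nc_mult f g = (\<lambda>w. \<Sum>i\<le>length w. f (take i w) * g (drop i w))"

definition nc_prod_list :: "('a list \<Rightarrow> int) list \<Rightarrow> 'a list \<Rightarrow> int" where
  "nc_prod_list fs = foldr nc_mult fs nc_one"

definition incomp :: "'a::order \<Rightarrow> 'a \<Rightarrow> bool" where
  "incomp a b \<longleftrightarrow> \<not> a < b \<and> \<not> b < a"

definition IH_gens :: "('a::order list \<Rightarrow> int) set" where
  "IH_gens = {nc_diff (nc_mono [c, a]) (nc_mono [a, c]) | a c. a < c}
      \<union> {nc_diff (nc_mono [c, a, b]) (nc_mono [b, c, a]) | a b c.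
            incomp a b \<and> incomp b c \<and> a < c}"

inductive_set IH_ideal :: "('a::order list \<Rightarrow> int) set" where
  gen: "g \<in> IH_gens \<Longrightarrow> g \<in> IH_ideal"
| zero: "nc_zero \<in> IH_ideal"
| add: "x \<in> IH_ideal \<Longrightarrow> y \<in> IH_ideal \<Longrightarrow> nc_add x y \<in> IH_ideal"
| mult_left: "x \<in> IH_ideal \<Longrightarrow> nc_poly f \<Longrightarrow> nc_mult f x \<in> IH_ideal"
| mult_right: "x \<in> IH_ideal \<Longrightarrow> nc_poly f \<Longrightarrow> nc_mult x f \<in> IH_ideal"

definition nc_cong_IH :: "('a::order list \<Rightarrow> int) \<Rightarrow> ('a list \<Rightarrow> int) \<Rightarrow> bool" where
  "nc_cong_IH f g \<longleftrightarrow> nc_diff f g \<in> IH_ideal"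

definition three_plus_one_free :: "'a::order itself \<Rightarrow> bool" where
  "three_plus_one_free _ \<longleftrightarrow>
     \<not> (\<exists>a b c d :: 'a. a < b \<and> b < c \<and> incomp d a \<and> incomp d b \<and> incomp d c)"

text \<open>e^P_k = sum of u_{a_1}...u_{a_k} over chains a_1 > ... > a_k; its coefficient
  of a word w is 1 iff w is such a chain of length k; e^P_k = 0 for k < 0.\<close>
definition eP :: "int \<Rightarrow> 'a::order list \<Rightarrow> int" where
  "eP k = (\<lambda>w. if 0 \<le> k \<and> length w = nat k \<and> sorted_wrt (>) w then 1 else 0)"

definition partitions :: "nat \<Rightarrow> nat list set" where
  "partitions n = {\<mu>. sum_list \<mu> = n \<and> sorted_wrt (\<ge>) \<mu> \<and> 0 \<notin> set \<mu>}"

definition diagram :: "nat list \<Rightarrow> (nat \<times> nat) set" where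
  "diagram lam = {(r, c). r < length lam \<and> c < lam ! r}"

text \<open>conj mu i = mu'_i, the i-th part (1-indexed) of the conjugate partition.\<close>
definition conj_part :: "nat list \<Rightarrow> nat \<Rightarrow> nat" where
  "conj_part \<mu> i = card {r. r < length \<mu> \<and> i \<le> \<mu> ! r}"

definition is_ssyt :: "nat list \<Rightarrow> nat list \<Rightarrow> (nat \<times> nat \<Rightarrow> nat) \<Rightarrow> bool" where
  "is_ssyt lam \<nu> T \<longleftrightarrow>
     (\<forall>x. x \<notin> diagram lam \<longrightarrow> T x = 0) \<and>
     (\<forall>x \<in> diagram lam. 1 \<le> T x \<and> T x \<le> length \<nu>) \<and>
     (\<forall>r c. (r, c) \<in> diagram lam \<and> (r, Suc c) \<in> diagram lam \<longrightarrow> T (r, c) \<le> T (r, Suc c)) \<and>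
     (\<forall>r c. (r, c) \<in> diagram lam \<and> (Suc r, c) \<in> diagram lam \<longrightarrow> T (r, c) < T (Suc r, c)) \<and>
     (\<forall>i < length \<nu>. card {x \<in> diagram lam. T x = Suc i} = \<nu> ! i)"

definition kostka :: "nat list \<Rightarrow> nat list \<Rightarrow> int" where
  "kostka lam \<nu> = int (card {T. is_ssyt lam \<nu> T})"

text \<open>Inverse Kostka matrix on the partitions of n (K is unitriangular, hence invertible).\<close>
definition kostka_inv :: "nat \<Rightarrow> nat list \<Rightarrow> nat list \<Rightarrow> int" where
  "kostka_inv n = (THE M.
      (\<forall>lam \<mu>. M lam \<mu> \<noteq> 0 \<longrightarrow> lam \<in> partitions n \<and> \<mu> \<in> partitions n) \<and>
      (\<forall>lam \<in> partitions n. \<forall>\<nu> \<in> partitions n.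
          (\<Sum>\<mu> \<in> partitions n. M lam \<mu> * kostka \<mu> \<nu>) = (if lam = \<nu> then 1 else 0)))"

definition JP :: "nat list \<Rightarrow> 'a::order list \<Rightarrow> int" where
  "JP \<mu> = (let j = (if \<mu> = [] then 0 else hd \<mu>) in
     (\<lambda>w. \<Sum>\<pi> | \<pi> permutes {1..j}.
        sign \<pi> * nc_prod_list
          (map (\<lambda>i. eP (int (conj_part \<mu> i) + int (\<pi> i) - int i)) [1..<Suc j]) w))"

definition mP :: "nat list \<Rightarrow> 'a::order list \<Rightarrow> int" where
  "mP lam = (\<lambda>w. \<Sum>\<mu> \<in> partitions (sum_list lam). kostka_inv (sum_list lam) lam \<mu> * JP \<mu> w)"

text \<open>A filling is a function on cells; outside the diagram it is fixed to undefined,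
  so that fillings correspond exactly to functions on the diagram.\<close>
definition is_ptab :: "nat list \<Rightarrow> (nat \<times> nat \<Rightarrow> 'a::order) \<Rightarrow> bool" where
  "is_ptab lam T \<longleftrightarrow>
     (\<forall>x. x \<notin> diagram lam \<longrightarrow> T x = undefined) \<and>
     (\<forall>r c. (r, c) \<in> diagram lam \<and> (Suc r, c) \<in> diagram lam \<longrightarrow> T (r, c) < T (Suc r, c)) \<and>
     (\<forall>r c. (r, c) \<in> diagram lam \<and> (r, Suc c) \<in> diagram lam \<longrightarrow> \<not> T (r, Suc c) < T (r, c))"

definition col_height :: "nat list \<Rightarrow> nat \<Rightarrow> nat" where
  "col_height lam c = card {r. r < length lam \<and> c < lam ! r}"

definition colword :: "nat list \<Rightarrow> (nat \<times> nat \<Rightarrow> 'a) \<Rightarrow> 'a list" where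
  "colword lam T = concat (map (\<lambda>c. rev (map (\<lambda>r. T (r, c)) [0..<col_height lam c]))
                              [0..<(if lam = [] then 0 else hd lam)])"

definition P_weakly_increasing :: "'a::order list \<Rightarrow> bool" where
  "P_weakly_increasing w \<longleftrightarrow> (\<forall>i. Suc i < length w \<longrightarrow> \<not> w ! Suc i < w ! i)"

definition power_word :: "'a::order list \<Rightarrow> bool" where
  "power_word w \<longleftrightarrow> P_weakly_increasing w \<and>
     \<not> (\<exists>i. Suc i < length w \<and> (\<forall>j. i < j \<and> j < length w \<longrightarrow> w ! i < w ! j))"

definition hook :: "nat \<Rightarrow> nat \<Rightarrow> nat list" where
  "hook l k = l # replicate k 1"

definition key_ptabs :: "nat \<Rightarrow> nat \<Rightarrow> (nat \<times> nat \<Rightarrow> 'a::order) set" where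
  "key_ptabs l k = {T. is_ptab (hook l k) T \<and>
      (\<exists>r \<le> k. power_word (T (r, 0) # map (\<lambda>c. T (0, c)) [1..<l]))}"

end

theory Submission
  imports Defs
begin

text \<open>Modulo the ideal, which is spanned by differences of monomials, two elements agree iff their
  coefficients have the same sum over every congruence class of words. For a \<open>(3 + 1)\<close>-free poset the
  \<open>e\<^sub>k\<close> commute modulo the ideal, so that any identity expressing a symmetric function by
  elementary ones can be transported. The hook monomial functions satisfy a simple recursion in terms of
  elementary ones, and key tableaux satisfy the same recursion by an insertion bijection. Finally, the
  inverse Kostka matrix is identified by running the same argument for a totally ordered poset, where
  the determinants are Schur functions and the key tableaux of a given partition content are explicit.\<close>

section \<open>The congruence on words\<close>

text \<open>No ring of symmetric functions is built. An \<open>admissible\<close> functional lists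
  the values of a linear functional on products of elementary functions, and an identity is one that
  holds for all such functionals. The coefficients found by \<open>jacobi_trudi_spans\<close> are
  fixed before the functional, so the same integers serve every poset. Words of natural numbers with
  given content recognise them as a row of the inverse Kostka matrix; they are never computed.

  The obstacle is commutation, as two incomparable letters need not commute modulo the ideal. By
  (3+1)-freeness an element is incomparable to at most two elements of a chain, so the
  incomparability graph between two chains consists of paths and cycles. Rotation lets letters pass
  each other at the end of a path and so uses up every path with an odd number of vertices. On even
  paths and on cycles no letter changes its block; such components contribute equally to both
  blocks, so the two lengths are interchanged all the same.\<close>

inductive hcong :: "'a::order list \<Rightarrow> 'a list \<Rightarrow> bool" where
  refl: "hcong u u"
| sym: "hcong u v \<Longrightarrow> hcong v u"
| trans: "hcong u v \<Longrightarrow> hcong v w \<Longrightarrow> hcong u w"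
| comm: "a < c \<Longrightarrow> hcong (u @ [c, a] @ v) (u @ [a, c] @ v)"
| rotate: "incomp a b \<Longrightarrow> incomp b c \<Longrightarrow> a < c \<Longrightarrow> hcong (u @ [c, a, b] @ v) (u @ [b, c, a] @ v)"

lemmas [trans] = hcong.trans

lemma hcong_mset: "hcong u v \<Longrightarrow> mset u = mset v"
  by (induction rule: hcong.induct) auto

lemma hcong_context: "hcong u v \<Longrightarrow> hcong (p @ u @ s) (p @ v @ s)"
proof (induction rule: hcong.induct)
  case (comm a c u v)
  then show ?case using hcong.comm[of a c "p @ u" "v @ s"] by simp
next
  case (rotate a b c u v)
  then show ?case using hcong.rotate[of a b c "p @ u" "v @ s"] by simp
qed (auto intro: hcong.intros)

lemma hcong_append: "hcong u u' \<Longrightarrow> hcong v v' \<Longrightarrow> hcong (u @ v) (u' @ v')"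
  using hcong_context[of u u' "[]" v] hcong_context[of v v' u' "[]"] hcong.trans by auto

lemma hcong_Cons: "hcong u v \<Longrightarrow> hcong (x # u) (x # v)"
  using hcong_append[of "[x]" "[x]"] by (auto intro: hcong.refl)

definition comparable :: "'a::order \<Rightarrow> 'a \<Rightarrow> bool" where
  "comparable x y \<longleftrightarrow> x \<le> y \<or> y \<le> x"

lemma comparable_iff: "comparable x y \<longleftrightarrow> x = y \<or> \<not> incomp x y"
  by (auto simp: comparable_def incomp_def less_le)

lemma comparable_sym: "comparable x y \<longleftrightarrow> comparable y x"
  by (auto simp: comparable_def)

lemma comparable_refl [simp]: "comparable x x"
  by (simp add: comparable_def)

lemma incomp_sym: "incomp x y \<longleftrightarrow> incomp y x"
  by (auto simp: incomp_def)

lemma incomp_symD: "incomp x y \<Longrightarrow> incomp y x"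
  by (simp add: incomp_def)

lemma hcong_swap: "comparable x y \<Longrightarrow> hcong (x # y # v) (y # x # v)"
  using hcong.comm[of x y "[]" v] hcong.comm[of y x "[]" v] hcong.sym hcong.refl
  by (auto simp: comparable_def le_less)

lemma hcong_move: "(\<And>y. y \<in> set v \<Longrightarrow> comparable x y) \<Longrightarrow> hcong (x # v) (v @ [x])"
proof (induction v)
  case (Cons y v)
  have "hcong (x # y # v) (y # x # v)" using Cons.prems by (intro hcong_swap) auto
  also have "hcong (y # x # v) (y # (v @ [x]))" using Cons by (intro hcong_Cons) auto
  finally show ?case by simp
qed (auto intro: hcong.refl)

lemma hcong_commute:
  "(\<And>x y. x \<in> set u \<Longrightarrow> y \<in> set v \<Longrightarrow> comparable x y) \<Longrightarrow> hcong (u @ v) (v @ u)"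
proof (induction u)
  case (Cons x u)
  have "hcong (x # (u @ v)) (x # (v @ u))" using Cons by (intro hcong_Cons) auto
  also have "hcong ((x # v) @ u) ((v @ [x]) @ u)"
    by (intro hcong_append hcong_move hcong.refl) (use Cons.prems in auto)
  hence "hcong (x # (v @ u)) (v @ x # u)" by simp
  finally show ?case by simp
qed (auto intro: hcong.refl)

definition is_chain :: "'a::order set \<Rightarrow> bool" where
  "is_chain A \<longleftrightarrow> (\<forall>x\<in>A. \<forall>y\<in>A. comparable x y)"

lemma is_chain_subset: "is_chain A \<Longrightarrow> B \<subseteq> A \<Longrightarrow> is_chain B"
  by (auto simp: is_chain_def)

text \<open>Letters of a chain commute pairwise, so only their multiset matters. This is what allows
  blocks to be treated as sets later on.\<close>

lemma hcong_chain: "is_chain (set u) \<Longrightarrow> mset u = mset v \<Longrightarrow> hcong u v"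
proof (induction u arbitrary: v)
  case (Cons x u)
  then have "x \<in> set v" by (metis list.set_intros(1) mset_eq_setD)
  then obtain p s where v: "v = p @ x # s" by (metis split_list)
  have "hcong (x # u) (x # (p @ s))"
    using Cons.prems v by (intro hcong_Cons Cons.IH) (auto simp: is_chain_def)
  also have "hcong ((x # p) @ s) ((p @ [x]) @ s)"
  proof (intro hcong_append hcong_move hcong.refl)
    fix y assume "y \<in> set p"
    then have "y \<in> set (x # u)" using Cons.prems(2) v by (metis Un_iff mset_eq_setD set_append)
    then show "comparable x y" using Cons.prems(1) by (auto simp: is_chain_def)
  qed
  hence "hcong (x # (p @ s)) v" using v by simp
  finally show ?case .
qed (auto intro: hcong.refl)

section \<open>Commutation of the chain sums\<close>

definition closed_in :: "'a::order set \<Rightarrow> 'a set \<Rightarrow> bool" where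
  "closed_in D S \<longleftrightarrow> S \<subseteq> D \<and> S \<noteq> {} \<and> (\<forall>x\<in>S. \<forall>y\<in>D. incomp x y \<longrightarrow> y \<in> S)"

text \<open>The inclusion-minimal closed sets are the connected components of the incomparability
  graph on \<open>D\<close>; minimality avoids any mention of walks.\<close>

definition component :: "'a::order set \<Rightarrow> 'a set \<Rightarrow> bool" where
  "component D S \<longleftrightarrow> closed_in D S \<and> (\<forall>S'. closed_in D S' \<and> S' \<subseteq> S \<longrightarrow> S' = S)"

text \<open>For disjoint chains the graph is bipartite with sides \<open>A\<close> and
  \<open>B\<close>. Under the degree bound of \<open>incomp_chain_card\<close>, components of
  unequal sides are paths with an odd number of vertices.\<close>

definition unbalanced :: "'a::order set \<Rightarrow> 'a set \<Rightarrow> bool" where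
  "unbalanced A B \<longleftrightarrow> (\<forall>S. component (A \<union> B) S \<longrightarrow> card (S \<inter> A) \<noteq> card (S \<inter> B))"

lemma unbalanced_sym: "unbalanced A B \<longleftrightarrow> unbalanced B A"
  unfolding unbalanced_def by (simp add: Un_commute eq_commute)

lemma component_remove_isolated:
  assumes "component (D - {x}) S" "\<And>y. y \<in> D \<Longrightarrow> y \<noteq> x \<Longrightarrow> \<not> incomp x y"
  shows "component D S"
proof -
  have sym: "\<not> incomp y x" if "y \<in> D" "y \<noteq> x" for y
    using assms(2) that incomp_symD by blast
  have *: "closed_in D T \<longleftrightarrow> closed_in (D - {x}) T" (is "?l \<longleftrightarrow> ?r") if "T \<subseteq> S" for T
  proof -
    have S: "S \<subseteq> D - {x}" using assms(1) by (auto simp: component_def closed_in_def)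
    show ?thesis
    proof
      assume ?l then show ?r using S that unfolding closed_in_def by auto
    next
      assume r: ?r
      have "z \<in> T" if "y \<in> T" "z \<in> D" "incomp y z" for y z
        using that r sym[of y] unfolding closed_in_def by auto
      then show ?l using r unfolding closed_in_def by auto
    qed
  qed
  have "closed_in D S" using * assms(1) unfolding component_def by blast
  moreover have "S' = S" if "closed_in D S'" "S' \<subseteq> S" for S'
    using *[OF that(2)] that assms(1) unfolding component_def by blast
  ultimately show ?thesis unfolding component_def by blast
qed

lemma unbalanced_remove_isolated:
  assumes "unbalanced A B" "a \<in> A" "a \<notin> B" "\<And>y. y \<in> A \<union> B \<Longrightarrow> y \<noteq> a \<Longrightarrow> \<not> incomp a y"
  shows "unbalanced (A - {a}) B"
  unfolding unbalanced_def
proof (intro allI impI)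
  fix S assume S: "component (A - {a} \<union> B) S"
  have eq: "A - {a} \<union> B = A \<union> B - {a}" using assms(3) by auto
  have "component (A \<union> B) S" using component_remove_isolated[OF S[unfolded eq]] assms(4) by auto
  moreover have "a \<notin> S" using S assms(3) by (auto simp: component_def closed_in_def)
  then have "S \<inter> (A - {a}) = S \<inter> A" by auto
  ultimately show "card (S \<inter> (A - {a})) \<noteq> card (S \<inter> B)" using assms(1) by (auto simp: unbalanced_def)
qed

text \<open>Here \<open>a\<close> is an end of a path, \<open>b\<close> its neighbour and
  \<open>a2\<close> the next vertex. Cutting off \<open>a\<close> and \<open>b\<close> shortens that
  one path and touches no other component. As \<open>a\<close> and \<open>b\<close> come from
  different chains, the imbalance of every component survives.\<close>

lemma component_add_leaf:
  assumes "component (D - {a, b}) S" "a \<in> D" "b \<in> D" "a2 \<in> D - {a, b}" "a \<noteq> b"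
    and a: "\<And>y. y \<in> D \<Longrightarrow> y \<noteq> a \<Longrightarrow> incomp a y \<longleftrightarrow> y = b"
    and b: "\<And>y. y \<in> D \<Longrightarrow> y \<noteq> b \<Longrightarrow> incomp b y \<longleftrightarrow> y = a \<or> y = a2"
  shows "component D S \<or> component D (S \<union> {a, b})"
proof (cases "a2 \<in> S")
  case False
  have cl: "closed_in D S"
    unfolding closed_in_def
  proof (intro conjI ballI impI)
    show "S \<subseteq> D" "S \<noteq> {}" using assms(1) by (auto simp: component_def closed_in_def)
    fix x y assume xy: "x \<in> S" "y \<in> D" "incomp x y"
    have "x \<in> D" "x \<noteq> a" "x \<noteq> b" "x \<noteq> a2"
      using assms(1) xy(1) False by (auto simp: component_def closed_in_def)
    then have "y \<noteq> a" "y \<noteq> b" using a[of x] b[of x] xy(3) incomp_symD by blast+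
    then show "y \<in> S" using assms(1) xy by (auto simp: component_def closed_in_def)
  qed
  have "S' = S" if "closed_in D S'" "S' \<subseteq> S" for S'
    using assms(1) that unfolding component_def closed_in_def by (metis DiffD1 subset_trans)
  then show ?thesis using cl unfolding component_def by blast
next
  case True
  have SD: "S \<subseteq> D - {a, b}" using assms(1) by (auto simp: component_def closed_in_def)
  have "y \<in> S \<union> {a, b}" if "x \<in> S \<union> {a, b}" "y \<in> D" "incomp x y" for x y
  proof (cases "x \<in> S")
    case True
    then show ?thesis using assms(1) that unfolding component_def closed_in_def by auto
  next
    case False
    then have "x = a \<or> x = b" using that(1) by auto
    then show ?thesis using that a[of y] b[of y] True by blast
  qed
  then have cl: "closed_in D (S \<union> {a, b})"
    using assms(2,3) SD unfolding closed_in_def by auto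
  have "S' = S \<union> {a, b}" if S': "closed_in D S'" "S' \<subseteq> S \<union> {a, b}" for S'
  proof -
    have ab: "incomp a b" using a[of b] assms(3,5) by blast
    have ba2: "incomp b a2" using assms(4) b by auto
    have *: "x \<in> S' \<Longrightarrow> y \<in> D \<Longrightarrow> incomp x y \<Longrightarrow> y \<in> S'" for x y
      using S'(1) by (auto simp: closed_in_def)
    have ne: "S' - {a, b} \<noteq> {}"
    proof
      assume "S' - {a, b} = {}"
      then have "b \<in> S'" using S'(1) * ab assms(3) unfolding closed_in_def by blast
      then have "a2 \<in> S'" using * ba2 assms(4) by blast
      then show False using \<open>S' - {a, b} = {}\<close> assms(4) by blast
    qed
    have "closed_in (D - {a, b}) (S' - {a, b})"
      using ne S'(1) unfolding closed_in_def by auto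
    then have "S' - {a, b} = S" using assms(1) S'(2) unfolding component_def by blast
    then have "a2 \<in> S'" using True by auto
    then have "b \<in> S'" using * ba2 assms(3) incomp_symD by blast
    then have "a \<in> S'" using * ab assms(2) incomp_symD by blast
    then show ?thesis using \<open>b \<in> S'\<close> \<open>S' - {a, b} = S\<close> by auto
  qed
  then show ?thesis using cl unfolding component_def by blast
qed

lemma chain_has_max:
  fixes A :: "'a::order set"
  assumes "finite A" "A \<noteq> {}" "is_chain A"
  obtains a where "a \<in> A" "\<And>x. x \<in> A \<Longrightarrow> x \<le> a"
proof -
  obtain a where "a \<in> A" "\<forall>x\<in>A. a \<le> x \<longrightarrow> a = x" using finite_has_maximal[OF assms(1,2)] by blast
  then have "\<forall>x\<in>A. x \<le> a" using assms(3) unfolding is_chain_def comparable_def by blast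
  then show thesis using that \<open>a \<in> A\<close> by blast
qed

text \<open>Three distinct elements of a chain can be sorted, and together with an element
  incomparable to all of them they would form the forbidden \<open>3 + 1\<close>. This is the degree
  bound for the incomparability graph of two chains.\<close>

lemma incomp_chain_card:
  assumes "three_plus_one_free TYPE('a::order)" "is_chain (A :: 'a set)"
    "x \<in> A" "y \<in> A" "z \<in> A" "incomp d x" "incomp d y" "incomp d z" "x \<noteq> y"
  shows "z = x \<or> z = y"
proof (rule ccontr)
  assume "\<not> ?thesis"
  then have d: "x \<noteq> z" "y \<noteq> z" by auto
  have c: "x < y \<or> y < x" "x < z \<or> z < x" "y < z \<or> z < y"
    using assms d unfolding is_chain_def comparable_def less_le by metis+
  have no: "\<not> (p < q \<and> q < r \<and> incomp d p \<and> incomp d q \<and> incomp d r)" for p q r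
    using assms(1) unfolding three_plus_one_free_def by blast
  show False using c no assms(6-8) by meson
qed

text \<open>The isolated edge would be a component with one vertex from each chain.\<close>

lemma two_cycle_unbalanced:
  assumes "unbalanced A B" "a \<in> A" "b \<in> B" "A \<inter> B = {}" "incomp a b"
    "\<And>y. y \<in> A \<union> B \<Longrightarrow> y \<noteq> a \<Longrightarrow> y \<noteq> b \<Longrightarrow> \<not> incomp a y \<and> \<not> incomp b y"
  shows False
proof -
  have cl: "closed_in (A \<union> B) {a, b}" using assms unfolding closed_in_def by auto
  have "S' = {a, b}" if "closed_in (A \<union> B) S'" "S' \<subseteq> {a, b}" for S'
  proof -
    have "a \<in> S' \<longleftrightarrow> b \<in> S'"
      using that(1) assms(2,3,5) incomp_sym[of a b] unfolding closed_in_def by blast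
    moreover have "S' \<noteq> {}" using that(1) by (simp add: closed_in_def)
    ultimately show ?thesis using that(2) by blast
  qed
  then have "component (A \<union> B) {a, b}" using cl unfolding component_def by blast
  moreover have "{a, b} \<inter> A = {a}" "{a, b} \<inter> B = {b}" using assms(2-4) by auto
  ultimately show False using assms(1) unfolding unbalanced_def by fastforce
qed

text \<open>The cycle would be a component with two vertices from each chain.\<close>

lemma four_cycle_unbalanced:
  assumes "unbalanced A B" "a \<in> A" "b \<in> B" "a2 \<in> A" "b2 \<in> B" "A \<inter> B = {}" "a \<noteq> a2" "b \<noteq> b2"
    "incomp a b" "incomp a b2" "incomp a2 b" "incomp a2 b2"
    "\<And>x y. x \<in> {a, a2, b, b2} \<Longrightarrow> y \<in> A \<union> B \<Longrightarrow> incomp x y \<Longrightarrow> y \<in> {a, a2, b, b2}"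
  shows False
proof -
  have cl: "closed_in (A \<union> B) {a, a2, b, b2}" using assms(2-5,13) unfolding closed_in_def by blast
  have "S' = {a, a2, b, b2}" if S: "closed_in (A \<union> B) S'" "S' \<subseteq> {a, a2, b, b2}" for S'
  proof -
    have "x \<in> S' \<Longrightarrow> y \<in> A \<union> B \<Longrightarrow> incomp x y \<Longrightarrow> y \<in> S'" for x y
      using S(1) unfolding closed_in_def by blast
    then have *: "x \<in> S' \<Longrightarrow> y \<in> A \<union> B \<Longrightarrow> incomp x y \<or> incomp y x \<Longrightarrow> y \<in> S'" for x y
      using incomp_symD[of y x] by auto
    have adj: "a \<in> S' \<longleftrightarrow> b \<in> S'" "a \<in> S' \<longleftrightarrow> b2 \<in> S'" "a2 \<in> S' \<longleftrightarrow> b \<in> S'"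
      by (rule iffI; rule *; use assms(2-5,9-12) in blast)+
    have "S' \<noteq> {}" using S(1) by (simp add: closed_in_def)
    then show ?thesis using S(2) adj by blast
  qed
  then have "component (A \<union> B) {a, a2, b, b2}" using cl unfolding component_def by blast
  moreover have "{a, a2, b, b2} \<inter> A = {a, a2}" "{a, a2, b, b2} \<inter> B = {b, b2}"
    using assms(2-6) by auto
  ultimately show False using assms(1,7,8) unfolding unbalanced_def by fastforce
qed

lemma incomp_ne_chain: "is_chain A \<Longrightarrow> x \<in> A \<Longrightarrow> y \<in> A \<Longrightarrow> x \<noteq> y \<Longrightarrow> \<not> incomp x y"
  unfolding is_chain_def comparable_iff by blast

lemma hcong_remove1:
  assumes "is_chain (set u)" "x \<in> set u"
  shows "hcong u (x # remove1 x u)"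
  using assms by (intro hcong_chain) auto

lemma hcong_remove1':
  assumes "is_chain (set u)" "x \<in> set u"
  shows "hcong u (remove1 x u @ [x])"
  using assms by (intro hcong_chain) auto

text \<open>Induction that looks at the maxima \<open>a\<close> and \<open>b\<close> of the two
  chains. If they are comparable, the larger one is comparable to every letter and moves freely.
  Otherwise each has at most one further neighbour in the other chain; if neither has one, or both
  do, a balanced component appears. So exactly one of them is the end of a path, and rotation
  removes that end.\<close>

lemma hcong_unbalanced_commute:
  fixes u v :: "'a::order list"
  assumes free: "three_plus_one_free TYPE('a)"
  shows "is_chain (set u) \<Longrightarrow> is_chain (set v) \<Longrightarrow> distinct u \<Longrightarrow> distinct v \<Longrightarrow>
    set u \<inter> set v = {} \<Longrightarrow> unbalanced (set u) (set v) \<Longrightarrow> hcong (u @ v) (v @ u)"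
proof (induction "length u + length v" arbitrary: u v rule: less_induct)
  case less
  define N where "N = length u + length v"
  note IH = less.hyps[folded N_def]
  \<comment> \<open>This fact and \<open>leaf\<close> are stated for all words of the current total
    length, so that they can also be applied with the two chains interchanged.\<close>
  have isolated: "hcong (u @ v) (v @ u)"
    if N: "length u + length v = N"
      and H: "is_chain (set u)" "is_chain (set v)" "distinct u" "distinct v"
        "set u \<inter> set v = {}" "unbalanced (set u) (set v)"
      and a: "a \<in> set u" "\<And>y. y \<in> set v \<Longrightarrow> comparable a y" for a and u v :: "'a list"
  proof -
    define u' where "u' = remove1 a u"
    have su: "set u' = set u - {a}" using H(3) by (simp add: u'_def)
    have "hcong (u @ v) ((a # u') @ v)"
      unfolding u'_def by (intro hcong_append hcong_remove1 hcong.refl H a)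
    also have "hcong ((a # u') @ v) ((a # v) @ u')"
    proof -
      have nc: "\<not> incomp a y" if "y \<in> set u \<union> set v" "y \<noteq> a" for y
        using that incomp_ne_chain[OF H(1) a(1), of y] a(2)[of y] by (auto simp: comparable_iff)
      have "hcong (u' @ v) (v @ u')"
      proof (rule IH)
        show "length u' + length v < N" unfolding N[symmetric]
          using length_pos_if_in_set[OF a(1)] a(1) by (simp add: u'_def length_remove1)
        show "unbalanced (set u') (set v)"
          unfolding su using H a(1) nc by (intro unbalanced_remove_isolated) auto
      qed (use H su in \<open>auto simp: is_chain_def u'_def\<close>)
      then show ?thesis by (simp add: hcong_Cons)
    qed
    also have "hcong ((a # v) @ u') ((v @ [a]) @ u')"
      by (intro hcong_append hcong_move hcong.refl a)
    also have "hcong ((v @ [a]) @ u') (v @ (a # u'))" by (simp add: hcong.refl)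
    also have "hcong (v @ (a # u')) (v @ u)"
      unfolding u'_def by (intro hcong_append hcong.sym[OF hcong_remove1] hcong.refl H a)
    finally show ?thesis .
  qed
  have leaf: "hcong (u @ v) (v @ u)"
    if N: "length u + length v = N"
      and H: "is_chain (set u)" "is_chain (set v)" "distinct u" "distinct v"
        "set u \<inter> set v = {}" "unbalanced (set u) (set v)"
      and a: "a \<in> set u" "b \<in> set v" "a2 \<in> set u" "a2 < a" "incomp a b" "incomp a2 b"
        "\<And>y. y \<in> set v \<Longrightarrow> incomp a y \<Longrightarrow> y = b" "\<And>y. y \<in> set u \<Longrightarrow> incomp b y \<Longrightarrow> y = a \<or> y = a2"
      for a b a2 and u v :: "'a list"
  proof -
    define u' v' u'' where "u' = remove1 a u" and "v' = remove1 b v" and "u'' = remove1 a2 u'"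
    have su: "set u' = set u - {a}" "set u'' = set u - {a, a2}" "set v' = set v - {b}"
      using H(3,4) by (auto simp: u'_def v'_def u''_def)
    have a2: "a2 \<in> set u'" using a(3,4) su(1) by auto
    have ab: "a \<noteq> b" "b \<noteq> a2" "a \<noteq> a2" using H(5) a(1-4) by auto
    have uu: "hcong u (u'' @ [a, a2])"
    proof (rule hcong_chain[OF H(1)])
      have "mset u = add_mset a (mset u')" using a(1) by (simp add: u'_def)
      also have "mset u' = add_mset a2 (mset u'')" using a2 by (simp add: u''_def)
      finally show "mset u = mset (u'' @ [a, a2])" by simp
    qed
    have uu': "hcong (u'' @ [a2]) u'"
      using H(1) a2 su by (intro hcong.sym[OF hcong_chain] is_chain_subset[OF H(1)]) (auto simp: u''_def)
    have inc: "comparable b y" if "y \<in> set u''" for y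
      using that a(8)[of y] su by (auto simp: comparable_iff)
    have inc': "comparable a y" if "y \<in> set v'" for y
      using that a(7)[of y] su by (auto simp: comparable_iff)
    have unb: "unbalanced (set u') (set v')"
      unfolding unbalanced_def
    proof (intro allI impI)
      fix S assume S: "component (set u' \<union> set v') S"
      have D: "set u' \<union> set v' = set u \<union> set v - {a, b}" using H(5) su a(1,2) by auto
      have Ssub: "S \<subseteq> set u \<union> set v - {a, b}" using S D by (auto simp: component_def closed_in_def)
      have fin: "finite S" using Ssub finite_subset by blast
      have "component (set u \<union> set v) S \<or> component (set u \<union> set v) (S \<union> {a, b})"
      proof (rule component_add_leaf[OF S[unfolded D], where ?a2.0 = a2])
        show "incomp a y \<longleftrightarrow> y = b" if "y \<in> set u \<union> set v" "y \<noteq> a" for y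
          using that a(1,5,7) incomp_ne_chain[OF H(1)] by blast
        show "incomp b y \<longleftrightarrow> y = a \<or> y = a2" if "y \<in> set u \<union> set v" "y \<noteq> b" for y
          using that a(2,5,6,8) incomp_ne_chain[OF H(2)] incomp_symD by blast
      qed (use a(1-3) ab in auto)
      moreover have "S \<inter> set u' = S \<inter> set u" "S \<inter> set v' = S \<inter> set v" using Ssub su by auto
      moreover have "(S \<union> {a, b}) \<inter> set u = insert a (S \<inter> set u)"
        "(S \<union> {a, b}) \<inter> set v = insert b (S \<inter> set v)" using a(1,2) H(5) by auto
      moreover have "a \<notin> S" "b \<notin> S" using Ssub by auto
      ultimately show "card (S \<inter> set u') \<noteq> card (S \<inter> set v')"
        using H(6) fin unfolding unbalanced_def by fastforce
    qed
    have mid: "hcong (u' @ v') (v' @ u')"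
    proof (rule IH[OF _ _ _ _ _ _ unb])
      show "length u' + length v' < N"
      proof -
        have "length u' < length u"
          using length_pos_if_in_set[OF a(1)] a(1) by (simp add: u'_def length_remove1)
        moreover have "length v' \<le> length v" by (simp add: v'_def length_remove1)
        ultimately show ?thesis using N by simp
      qed
    qed (use H su in \<open>auto simp: is_chain_def u'_def v'_def\<close>)
    have "hcong (u @ v) ((u'' @ [a, a2]) @ (b # v'))"
      unfolding v'_def by (intro hcong_append uu hcong_remove1 H a)
    \<comment> \<open>The rotation relation acts here: \<open>b\<close> jumps over \<open>a\<close>
      and \<open>a2\<close>, the only letters of \<open>u\<close> incomparable to it.\<close>
    also have "hcong ((u'' @ [a, a2]) @ (b # v')) (u'' @ [b, a, a2] @ v')"
      using hcong.rotate[of a2 b a u'' v'] a(4-6) incomp_symD by fastforce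
    also have "hcong ((u'' @ [b]) @ [a, a2] @ v') ((b # u'') @ [a, a2] @ v')"
      by (intro hcong_append hcong.refl hcong.sym[OF hcong_move] inc)
    hence "hcong (u'' @ [b, a, a2] @ v') ((b # u'') @ [a, a2] @ v')" by simp
    \<comment> \<open>The only letter of \<open>v\<close> incomparable to \<open>a\<close> is
      \<open>b\<close>, which has already passed; so \<open>a\<close> moves to the far end and
      leaves the shorter pair \<open>u'\<close>, \<open>v'\<close> to the induction
      hypothesis.\<close>
    also have "hcong (((b # u'') @ [a]) @ [a2] @ v') (((b # u'')) @ ([a2] @ v') @ [a])"
    proof -
      have "hcong (a # ([a2] @ v')) (([a2] @ v') @ [a])"
        using inc' a(4) by (intro hcong_move) (auto simp: comparable_def)
      from hcong_append[OF hcong.refl[of "b # u''"] this] show ?thesis by simp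
    qed
    hence "hcong ((b # u'') @ [a, a2] @ v') ([b] @ ((u'' @ [a2]) @ v') @ [a])" by simp
    also have "hcong ([b] @ ((u'' @ [a2]) @ v') @ [a]) ([b] @ (u' @ v') @ [a])"
      by (intro hcong_append hcong.refl uu')
    also have "hcong ([b] @ (u' @ v') @ [a]) (([b] @ v') @ (u' @ [a]))"
      using hcong_context[OF mid, of "[b]" "[a]"] by simp
    also have "hcong (([b] @ v') @ (u' @ [a])) (v @ u)"
      unfolding v'_def u'_def
      using hcong.sym[OF hcong_remove1[OF H(2) a(2)]] hcong.sym[OF hcong_remove1'[OF H(1) a(1)]]
      by (intro hcong_append) auto
    finally show ?thesis by simp
  qed
  have N: "length u + length v = N" "length v + length u = N" by (simp_all add: N_def)
  have H: "is_chain (set u)" "is_chain (set v)" "distinct u" "distinct v"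
    "set u \<inter> set v = {}" "unbalanced (set u) (set v)" using less.prems by auto
  have H': "set v \<inter> set u = {}" "unbalanced (set v) (set u)" using H(5,6) unbalanced_sym by auto
  show ?case
  proof (cases "u = [] \<or> v = []")
    case True
    then show ?thesis by (auto intro: hcong.refl)
  next
    case False
    obtain a where a: "a \<in> set u" "\<And>x. x \<in> set u \<Longrightarrow> x \<le> a"
      using chain_has_max[of "set u"] H(1) False by auto
    obtain b where b: "b \<in> set v" "\<And>x. x \<in> set v \<Longrightarrow> x \<le> b"
      using chain_has_max[of "set v"] H(2) False by auto
    have ne: "a \<noteq> b" using a b H(5) by auto
    consider "b < a" | "a < b" | "incomp a b" unfolding incomp_def by blast
    then show ?thesis
    proof cases
      case 1
      then show ?thesis
        using b by (intro isolated[OF N(1) H a(1)]) (meson comparable_def less_imp_le order.trans)+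
    next
      case 2
      then show ?thesis
        using a by (intro hcong.sym[OF isolated[OF N(2) H(2,1,4,3) H' b(1)]])
          (meson comparable_def less_imp_le order.trans)+
    next
      case 3
      then have 3: "incomp a b" "incomp b a" using incomp_symD by auto
      have nu: "\<not> incomp a y" if "y \<in> set u" "y \<noteq> a" for y using incomp_ne_chain[OF H(1)] a(1) that by blast
      have nv: "\<not> incomp b y" if "y \<in> set v" "y \<noteq> b" for y using incomp_ne_chain[OF H(2)] b(1) that by blast
      consider "\<forall>y\<in>set v. incomp a y \<longrightarrow> y = b" "\<forall>y\<in>set u. incomp b y \<longrightarrow> y = a"
        | a2 where "a2 \<in> set u" "a2 \<noteq> a" "incomp b a2" "\<forall>y\<in>set v. incomp a y \<longrightarrow> y = b"
        | b2 where "b2 \<in> set v" "b2 \<noteq> b" "incomp a b2" "\<forall>y\<in>set u. incomp b y \<longrightarrow> y = a"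
        | a2 b2 where "a2 \<in> set u" "a2 \<noteq> a" "incomp b a2" "b2 \<in> set v" "b2 \<noteq> b" "incomp a b2"
        by blast
      then show ?thesis
      proof cases
        case 1
        have "False"
        proof (rule two_cycle_unbalanced[OF H(6) a(1) b(1) H(5) 3(1)])
          fix y assume "y \<in> set u \<union> set v" "y \<noteq> a" "y \<noteq> b"
          then show "\<not> incomp a y \<and> \<not> incomp b y" using 1 nu nv by blast
        qed
        then show ?thesis ..
      next
        case 2
        have "a2 < a" using a(2)[OF 2(1)] 2(2) by simp
        moreover have "y = a \<or> y = a2" if "y \<in> set u" "incomp b y" for y
          using incomp_chain_card[OF free H(1) a(1) 2(1) that(1) 3(2) 2(3) that(2)] 2(2) by blast
        ultimately show ?thesis
          using 2 3 incomp_sym[of b a2] by (intro leaf[OF N(1) H a(1) b(1), of a2]) auto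
      next
        case c3: 3
        have "b2 < b" using b(2)[OF c3(1)] c3(2) by simp
        moreover have "y = b \<or> y = b2" if "y \<in> set v" "incomp a y" for y
          using incomp_chain_card[OF free H(2) b(1) c3(1) that(1) 3(1) c3(3) that(2)] c3(2) by blast
        ultimately show ?thesis
          using c3 3 incomp_sym[of a b2]
          by (intro hcong.sym[OF leaf[OF N(2) H(2,1,4,3) H' b(1) a(1), of b2]]) auto
      next
        case 4
        have lt: "a2 < a" "b2 < b" using 4 a(2)[of a2] b(2)[of b2] by auto
        \<comment> \<open>If \<open>a2 < b2\<close>, then \<open>a2 < b\<close>; if
          \<open>b2 < a2\<close>, then \<open>b2 < a\<close>. Both are excluded, so the four letters
          form a cycle.\<close>
        have i22: "incomp a2 b2"
          using lt 3 4(3,6) unfolding incomp_def by (meson order.strict_trans)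
        have sv: "y = b \<or> y = b2" if "y \<in> set v" "incomp a y" for y
          using incomp_chain_card[OF free H(2) b(1) 4(4) that(1) 3(1) 4(6) that(2)] 4(5) by blast
        have su: "y = a \<or> y = a2" if "y \<in> set u" "incomp b y" for y
          using incomp_chain_card[OF free H(1) a(1) 4(1) that(1) 3(2) 4(3) that(2)] 4(2) by blast
        have sv2: "y = b \<or> y = b2" if "y \<in> set v" "incomp a2 y" for y
          using incomp_chain_card[OF free H(2) b(1) 4(4) that(1) _ i22 that(2)] 4(3,5) incomp_symD by blast
        have su2: "y = a \<or> y = a2" if "y \<in> set u" "incomp b2 y" for y
          using incomp_chain_card[OF free H(1) a(1) 4(1) that(1) _ _ that(2)] 4(2,6) i22 incomp_symD by blast
        have "False"
        proof (rule four_cycle_unbalanced[OF H(6) a(1) b(1) 4(1) 4(4) H(5)])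
          fix x y assume xy: "x \<in> {a, a2, b, b2}" "y \<in> set u \<union> set v" "incomp x y"
          have "y \<in> set u \<Longrightarrow> x \<in> {a, a2} \<Longrightarrow> y = x"
            using incomp_ne_chain[OF H(1)] a(1) 4(1) xy(3) by blast
          moreover have "y \<in> set v \<Longrightarrow> x \<in> {b, b2} \<Longrightarrow> y = x"
            using incomp_ne_chain[OF H(2)] b(1) 4(4) xy(3) by blast
          ultimately show "y \<in> {a, a2, b, b2}" using xy sv su sv2 su2 by blast
        qed (use 4 3 i22 incomp_sym[of b a2] in auto)
        then show ?thesis ..
      qed
    qed
  qed
qed

text \<open>Two chains are exchanged along the balanced components of their incomparability graph. This swaps
  the two lengths: the unbalanced components are paths, and there the two subwords commute.\<close>

definition balanced_part :: "'a::order set \<Rightarrow> 'a set \<Rightarrow> 'a set" where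
  "balanced_part A B = \<Union>{S. component ((A - B) \<union> (B - A)) S \<and> card (S \<inter> A) = card (S \<inter> B)}"

definition exchange :: "'a::order set \<Rightarrow> 'a set \<Rightarrow> 'a set" where
  "exchange A B = (A - balanced_part A B) \<union> (B \<inter> balanced_part A B)"

lemma balanced_part_sym: "balanced_part A B = balanced_part B A"
  unfolding balanced_part_def by (simp add: Un_commute eq_commute)

lemma component_eq: "component D S \<Longrightarrow> component D T \<Longrightarrow> S \<inter> T \<noteq> {} \<Longrightarrow> S = T"
proof -
  assume S: "component D S" and T: "component D T" and ne: "S \<inter> T \<noteq> {}"
  have "closed_in D (S \<inter> T)" using S T ne unfolding component_def closed_in_def by blast
  then have "S \<inter> T = S" "S \<inter> T = T" using S T unfolding component_def by (meson inf_le1 inf_le2)+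
  then show ?thesis by blast
qed

lemma balanced_part_subset: "balanced_part A B \<subseteq> (A - B) \<union> (B - A)"
  unfolding balanced_part_def component_def closed_in_def by blast

lemma balanced_part_closed:
  "x \<in> balanced_part A B \<Longrightarrow> y \<in> (A - B) \<union> (B - A) \<Longrightarrow> incomp x y \<Longrightarrow> y \<in> balanced_part A B"
  unfolding balanced_part_def component_def closed_in_def by blast

text \<open>Distinct components are disjoint, so the equality of the two counts can be summed over
  the balanced components.\<close>

lemma card_balanced_part:
  assumes "finite A" "finite B"
  shows "card (A \<inter> balanced_part A B) = card (B \<inter> balanced_part A B)"
proof -
  define C where "C = {S. component ((A - B) \<union> (B - A)) S \<and> card (S \<inter> A) = card (S \<inter> B)}"
  have fin: "finite C"
    by (rule finite_subset[of _ "Pow (A \<union> B)"]) (use assms in \<open>auto simp: C_def component_def closed_in_def\<close>)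
  have *: "card (X \<inter> \<Union>C) = (\<Sum>S\<in>C. card (S \<inter> X))" if "finite X" for X
  proof -
    have "X \<inter> \<Union>C = (\<Union>S\<in>C. S \<inter> X)" by auto
    also have "card \<dots> = (\<Sum>S\<in>C. card (S \<inter> X))"
    proof (intro card_UN_disjoint fin ballI impI)
      fix S T assume "S \<in> C" "T \<in> C" "S \<noteq> T"
      then have "S \<inter> T = {}" using component_eq[of "(A - B) \<union> (B - A)" S T] unfolding C_def by blast
      then show "S \<inter> X \<inter> (T \<inter> X) = {}" by blast
    qed (use that in auto)
    finally show ?thesis .
  qed
  have "(\<Sum>S\<in>C. card (S \<inter> A)) = (\<Sum>S\<in>C. card (S \<inter> B))" by (intro sum.cong) (auto simp: C_def)
  then show ?thesis using * assms unfolding balanced_part_def C_def by simp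
qed

lemma card_exchange:
  assumes "finite A" "finite B"
  shows "card (exchange A B) = card A"
proof -
  have "card (exchange A B) = card (A - balanced_part A B) + card (B \<inter> balanced_part A B)"
    unfolding exchange_def by (intro card_Un_disjoint) (use assms in auto)
  also have "\<dots> = card (A - balanced_part A B) + card (A \<inter> balanced_part A B)"
    using card_balanced_part[OF assms] by simp
  also have "\<dots> = card A" using card_Diff_subset_Int[of A "balanced_part A B"] assms(1)
    by (simp add: card_mono)
  finally show ?thesis .
qed

text \<open>Letters inside and outside the balanced part lie in different components and so cannot
  be incomparable. A letter common to both chains is outside the graph, but then one chain contains
  both letters.\<close>

lemma exchange_comparable:
  assumes "is_chain A" "is_chain B" "x \<in> A - balanced_part A B" "y \<in> B \<inter> balanced_part A B"
  shows "comparable x y"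
proof (cases "x \<in> B \<or> y \<in> A")
  case True
  then show ?thesis using assms unfolding is_chain_def by blast
next
  case False
  then have "\<not> incomp y x" using balanced_part_closed[of y A B x] assms by blast
  then show ?thesis using incomp_symD unfolding comparable_iff by blast
qed

lemma exchange_chain: "is_chain A \<Longrightarrow> is_chain B \<Longrightarrow> is_chain (exchange A B)"
proof -
  assume A: "is_chain A" and B: "is_chain B"
  have "comparable x y" if "x \<in> A - balanced_part A B \<or> x \<in> B \<inter> balanced_part A B"
    "y \<in> A - balanced_part A B \<or> y \<in> B \<inter> balanced_part A B" for x y
    using that exchange_comparable[OF A B, of x y] exchange_comparable[OF A B, of y x] comparable_sym[of x y] A B
    unfolding is_chain_def by blast
  then show ?thesis unfolding is_chain_def exchange_def by blast
qed

lemma finite_exchange: "finite A \<Longrightarrow> finite B \<Longrightarrow> finite (exchange A B)"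
  unfolding exchange_def by auto

text \<open>Exchanging preserves the symmetric difference, hence its components; on each of them the
  two counts are either kept or interchanged. The exchange is therefore its own inverse, as
  \<open>exchange_exchange\<close> records.\<close>

lemma balanced_part_exchange:
  "balanced_part (exchange A B) (exchange B A) = balanced_part A B"
proof -
  let ?E = "balanced_part A B" and ?D = "(A - B) \<union> (B - A)"
  have D: "(exchange A B - exchange B A) \<union> (exchange B A - exchange A B) = ?D"
    using balanced_part_subset[of A B] balanced_part_sym[of A B] unfolding exchange_def by auto
  have "card (S \<inter> exchange A B) = card (S \<inter> exchange B A) \<longleftrightarrow> card (S \<inter> A) = card (S \<inter> B)"
    if S: "component ?D S" for S
  proof (cases "S \<inter> ?E = {}")
    case True
    then have "S \<inter> exchange A B = S \<inter> A" "S \<inter> exchange B A = S \<inter> B"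
      using balanced_part_sym[of A B] unfolding exchange_def by auto
    then show ?thesis by simp
  next
    case False
    then obtain T where "component ?D T" "card (T \<inter> A) = card (T \<inter> B)" "S \<inter> T \<noteq> {}"
      unfolding balanced_part_def by auto
    then have "S \<subseteq> ?E" using component_eq[OF S, of T] unfolding balanced_part_def by blast
    then have "S \<inter> exchange A B = S \<inter> B" "S \<inter> exchange B A = S \<inter> A"
      using balanced_part_sym[of A B] unfolding exchange_def by auto
    then show ?thesis by auto
  qed
  then show ?thesis unfolding balanced_part_def[of "exchange A B"] D unfolding balanced_part_def by blast
qed

lemma exchange_exchange: "exchange (exchange A B) (exchange B A) = A"
  unfolding exchange_def[of "exchange A B"] balanced_part_exchange
  using balanced_part_subset[of A B] balanced_part_sym[of A B] unfolding exchange_def by auto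

text \<open>The balanced part is a union of components, so a component of what remains is a
  component of the whole symmetric difference; were it balanced, it would lie in
  \<open>E\<close>.\<close>

lemma unbalanced_remainder:
  fixes A B :: "'a::order set"
  defines "E \<equiv> balanced_part A B"
  shows "unbalanced (A - E - B) (B - E - A)"
  unfolding unbalanced_def
proof (intro allI impI notI)
  let ?D = "(A - B) \<union> (B - A)"
  have eq: "(A - E - B) \<union> (B - E - A) = ?D - E" by auto
  fix S assume S: "component ((A - E - B) \<union> (B - E - A)) S" 
    and bal: "card (S \<inter> (A - E - B)) = card (S \<inter> (B - E - A))"
  have "y \<notin> E" if "x \<in> ?D - E" "y \<in> ?D" "incomp x y" for x y
    using that balanced_part_closed[of y A B x] incomp_symD[of x y] unfolding E_def by blast
  then have *: "closed_in ?D T \<longleftrightarrow> closed_in (?D - E) T" if "T \<subseteq> ?D - E" for T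
    using that unfolding closed_in_def by blast
  have SD: "S \<subseteq> ?D - E" "S \<noteq> {}" using S unfolding eq component_def closed_in_def by auto
  have "component ?D S" using S * SD unfolding eq component_def by (meson subset_trans)
  moreover have "S \<inter> (A - E - B) = S \<inter> A" "S \<inter> (B - E - A) = S \<inter> B" using SD by auto
  ultimately have "S \<subseteq> E" using bal unfolding E_def balanced_part_def by auto
  then show False using SD by auto
qed

section \<open>Chains as strictly decreasing words\<close>

abbreviation is_desc :: "'a::order list \<Rightarrow> bool" where
  "is_desc \<equiv> sorted_wrt (>)"

lemma is_desc_distinct: "is_desc u \<Longrightarrow> distinct (u :: 'a::order list)"
  by (induction u) auto

lemma is_desc_chain: "is_desc u \<Longrightarrow> is_chain (set (u :: 'a::order list))"
  by (induction u) (auto simp: is_chain_def comparable_def less_imp_le)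

lemma is_desc_unique:
  "is_desc u \<Longrightarrow> is_desc v \<Longrightarrow> set u = set v \<Longrightarrow> u = (v :: 'a::order list)"
proof (induction u arbitrary: v)
  case (Cons x u)
  then obtain y v' where v: "v = y # v'" by (cases v) auto
  have "x = y"
  proof (rule ccontr)
    assume "x \<noteq> y"
    then have "x \<in> set v'" "y \<in> set u" using Cons.prems(3) v by auto
    then show False using Cons.prems(1,2) v by (auto dest: order.strict_trans)
  qed
  moreover have "x \<notin> set u" "y \<notin> set v'" using Cons.prems(1,2) v by auto
  moreover have "set u = set v'"
    using Cons.prems(3) v \<open>x = y\<close> calculation(2,3) by (simp add: insert_ident)
  ultimately show ?case using Cons v by simp
qed auto

lemma chain_desc_exists:
  "finite A \<Longrightarrow> is_chain (A :: 'a::order set) \<Longrightarrow> \<exists>u. is_desc u \<and> set u = A"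
proof (induction "card A" arbitrary: A)
  case (Suc n)
  then have "A \<noteq> {}" by auto
  then obtain a where a: "a \<in> A" "\<And>x. x \<in> A \<Longrightarrow> x \<le> a" using chain_has_max Suc.prems by metis
  have "\<exists>u. is_desc u \<and> set u = A - {a}"
    by (intro Suc.hyps) (use Suc a is_chain_subset[of A "A - {a}"] in auto)
  then obtain u where "is_desc u" "set u = A - {a}" by blast
  then show ?case using a by (intro exI[of _ "a # u"]) (auto simp: less_le)
qed auto

definition desc_list :: "'a::order set \<Rightarrow> 'a list" where
  "desc_list A = (THE u. is_desc u \<and> set u = A)"

lemma desc_list:
  assumes "finite A" "is_chain A"
  shows "is_desc (desc_list A)" "set (desc_list A) = A" "length (desc_list A) = card A"
    "distinct (desc_list A)"
proof -
  have "\<exists>!u. is_desc u \<and> set u = A" using chain_desc_exists[OF assms] is_desc_unique by metis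
  then have "is_desc (desc_list A) \<and> set (desc_list A) = A" unfolding desc_list_def by (rule theI')
  then show *: "is_desc (desc_list A)" "set (desc_list A) = A" by auto
  show "distinct (desc_list A)" using * is_desc_distinct by blast
  then show "length (desc_list A) = card A" using * distinct_card by metis
qed

lemma desc_list_set: "is_desc u \<Longrightarrow> desc_list (set u) = u"
  by (metis desc_list(1,2) finite_set is_desc_chain is_desc_unique)

lemma hcong_desc_split:
  assumes "finite A" "is_chain A" "X \<union> Y = A" "X \<inter> Y = {}"
  shows "hcong (desc_list A) (desc_list X @ desc_list Y)"
proof -
  have X: "finite X" "is_chain X" and Y: "finite Y" "is_chain Y"
    using assms is_chain_subset[OF assms(2)] by auto
  show ?thesis
  proof (rule hcong_chain)
    show "mset (desc_list A) = mset (desc_list X @ desc_list Y)"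
      using desc_list[OF X] desc_list[OF Y] desc_list[OF assms(1,2)] assms(3,4)
      by (intro set_eq_iff_mset_eq_distinct[THEN iffD1]) auto
  qed (use desc_list[OF assms(1,2)] assms(2) in auto)
qed

text \<open>With balanced letters \<open>A1\<close>, \<open>B1\<close>, common letters
  \<open>I\<close> and unbalanced letters \<open>A2\<close>, \<open>B2\<close>, the word
  \<open>A1 I A2 B1 I B2\<close> is turned into \<open>A1 I B2 B1 I A2\<close>. Interchanging
  \<open>A2\<close> and \<open>B2\<close> needs \<open>hcong_unbalanced_commute\<close>; every other
  move is between comparable letters.\<close>

lemma hcong_exchange:
  fixes A B :: "'a::order set"
  assumes free: "three_plus_one_free TYPE('a)"
    and A: "finite A" "is_chain A" and B: "finite B" "is_chain B"
  shows "hcong (desc_list A @ desc_list B) (desc_list (exchange B A) @ desc_list (exchange A B))"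
proof -
  define E where "E = balanced_part A B"
  define I where "I = A \<inter> B"
  have E': "balanced_part B A = E" using balanced_part_sym E_def by metis
  have EI: "E \<inter> I = {}" using balanced_part_subset[of A B] unfolding E_def I_def by auto
  let ?d = desc_list
  let ?A1 = "?d (A \<inter> E)" and ?B1 = "?d (B \<inter> E)" and ?A2 = "?d (A - E - B)" and ?B2 = "?d (B - E - A)"
    and ?I = "?d I"
  have fc: "finite X \<and> is_chain X" if "X \<subseteq> A \<or> X \<subseteq> B" for X
    using that A B finite_subset is_chain_subset by blast
  have set_d: "set (?d X) = X" if "X \<subseteq> A \<or> X \<subseteq> B" for X
    using fc[OF that] desc_list by blast
  have sets: "set ?A1 = A \<inter> E" "set ?B1 = B \<inter> E" "set ?A2 = A - E - B" "set ?B2 = B - E - A" "set ?I = I"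
    by (rule set_d; auto simp: I_def)+
  have cAB: "comparable x y" if "x \<in> A - E" "y \<in> B \<inter> E" for x y
    using exchange_comparable[OF A(2) B(2)] that unfolding E_def by blast
  have cBA: "comparable x y" if "x \<in> B - E" "y \<in> A \<inter> E" for x y
    using exchange_comparable[OF B(2) A(2)] that E' by blast
  have cA: "comparable x y" if "x \<in> A" "y \<in> A" for x y using A(2) that unfolding is_chain_def by blast
  have cB: "comparable x y" if "x \<in> B" "y \<in> B" for x y using B(2) that unfolding is_chain_def by blast
  have split3: "hcong (?d X) (?d X1 @ ?d X2 @ ?d X3)"
    if "finite X" "is_chain X" "X1 \<union> X2 \<union> X3 = X" "X1 \<inter> X2 = {}" "X1 \<inter> X3 = {}" "X2 \<inter> X3 = {}" for X X1 X2 X3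
  proof -
    have "hcong (?d X) (?d X1 @ ?d (X2 \<union> X3))" using that by (intro hcong_desc_split) auto
    moreover have "hcong (?d (X2 \<union> X3)) (?d X2 @ ?d X3)"
      using that is_chain_subset[of X "X2 \<union> X3"] finite_subset[of "X2 \<union> X3" X] by (intro hcong_desc_split) auto
    ultimately show ?thesis using hcong_append[OF hcong.refl] hcong.trans by blast
  qed
  have xBA: "finite (exchange B A)" "is_chain (exchange B A)" and xAB: "finite (exchange A B)" "is_chain (exchange A B)"
    using A B finite_exchange exchange_chain by blast+
  have x: "exchange A B = (A - E) \<union> (B \<inter> E)" "exchange B A = (B - E) \<union> (A \<inter> E)"
    unfolding exchange_def E' E_def by simp_all
  have odd: "hcong (?A2 @ ?B2) (?B2 @ ?A2)"
  proof (intro hcong_unbalanced_commute[OF free])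
    have "finite (A - E - B) \<and> is_chain (A - E - B)" "finite (B - E - A) \<and> is_chain (B - E - A)"
      by (rule fc; blast)+
    then show "distinct ?A2" "distinct ?B2" "is_chain (set ?A2)" "is_chain (set ?B2)"
      using sets desc_list(4) by auto
    show "unbalanced (set ?A2) (set ?B2)" using unbalanced_remainder[of A B] sets E_def by simp
  qed (use sets in auto)
  have "hcong (?d A @ ?d B) ((?A1 @ ?I @ ?A2) @ (?B1 @ ?I @ ?B2))"
  proof (intro hcong_append split3 A B)
    show "A \<inter> E \<union> I \<union> (A - E - B) = A" "B \<inter> E \<union> I \<union> (B - E - A) = B"
      using EI by (auto simp: I_def)
    show "A \<inter> E \<inter> (A - E - B) = {}" "I \<inter> (A - E - B) = {}" "A \<inter> E \<inter> I = {}"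
      "B \<inter> E \<inter> (B - E - A) = {}" "I \<inter> (B - E - A) = {}" "B \<inter> E \<inter> I = {}"
      using EI by (auto simp: I_def)
  qed
  also have "hcong ((?A1 @ ?I) @ (?A2 @ (?B1 @ ?I)) @ ?B2) ((?A1 @ ?I) @ ((?B1 @ ?I) @ ?A2) @ ?B2)"
    by (rule hcong_context, rule hcong_commute) (use sets cAB cA in \<open>auto simp: I_def\<close>)
  hence "hcong ((?A1 @ ?I @ ?A2) @ (?B1 @ ?I @ ?B2)) (?A1 @ (?I @ ?B1) @ ?I @ (?A2 @ ?B2))" by simp
  also have "hcong (?A1 @ (?I @ ?B1) @ ?I @ (?A2 @ ?B2)) (?A1 @ (?I @ ?B1) @ ?I @ (?B2 @ ?A2))"
    by (intro hcong_append hcong.refl odd)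
  also have "hcong ((?A1 @ ?I) @ ((?B1 @ ?I) @ ?B2) @ ?A2) ((?A1 @ ?I) @ (?B2 @ (?B1 @ ?I)) @ ?A2)"
  proof (rule hcong_context, rule hcong_commute)
    fix x y assume "x \<in> set (?B1 @ ?I)" "y \<in> set ?B2"
    then have "x \<in> B \<inter> E \<union> I" "y \<in> B - E - A" by (simp_all only: set_append sets)
    then have "x \<in> B" "y \<in> B" by (auto simp: I_def)
    then show "comparable x y" by (rule cB)
  qed
  hence "hcong (?A1 @ (?I @ ?B1) @ ?I @ (?B2 @ ?A2)) ((?A1 @ ?I @ ?B2) @ (?B1 @ ?I @ ?A2))" by simp
  also have "hcong ((?A1 @ ?I @ ?B2) @ (?B1 @ ?I @ ?A2)) (?d (exchange B A) @ ?d (exchange A B))"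
  proof (intro hcong_append hcong.sym[OF split3] xBA xAB)
    show "A \<inter> E \<union> I \<union> (B - E - A) = exchange B A" "B \<inter> E \<union> I \<union> (A - E - B) = exchange A B"
      unfolding x using EI by (auto simp: I_def)
    show "A \<inter> E \<inter> (B - E - A) = {}" "I \<inter> (B - E - A) = {}" "A \<inter> E \<inter> I = {}"
      "B \<inter> E \<inter> (A - E - B) = {}" "I \<inter> (A - E - B) = {}" "B \<inter> E \<inter> I = {}"
      using EI by (auto simp: I_def)
  qed
  finally show ?thesis .
qed

section \<open>Counting factorizations into decreasing blocks\<close>

fun desc_blocks :: "int list \<Rightarrow> 'a::order list \<Rightarrow> bool" where
  "desc_blocks [] w \<longleftrightarrow> w = []"
| "desc_blocks (b # \<beta>) w \<longleftrightarrow> 0 \<le> b \<and> nat b \<le> length w \<and> is_desc (take (nat b) w) \<and>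
     desc_blocks \<beta> (drop (nat b) w)"

text \<open>For finite \<open>X\<close> this is the sum, over the words of \<open>X\<close>, of
  their coefficients in the product of the \<open>eP b\<close> with \<open>b\<close> in
  \<beta>.\<close>

definition block_count :: "'a::order list set \<Rightarrow> int list \<Rightarrow> int" where
  "block_count X \<beta> = int (card {w \<in> X. desc_blocks \<beta> w})"

text \<open>Unions of congruence classes: a form that survives the removal of a prefix
  (\<open>hclosed_after\<close>), on which the inductions over blocks rely.\<close>

definition hclosed :: "'a::order list set \<Rightarrow> bool" where
  "hclosed X \<longleftrightarrow> (\<forall>u v. hcong u v \<and> u \<in> X \<longrightarrow> v \<in> X)"

definition after :: "'a list \<Rightarrow> 'a list set \<Rightarrow> 'a list set" where
  "after p X = {s. p @ s \<in> X}"

lemma finite_after: "finite X \<Longrightarrow> finite (after p X)"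
  unfolding after_def using finite_vimageI[of X "(@) p"] by (simp add: vimage_def inj_def)

lemma hclosed_after: "hclosed X \<Longrightarrow> hclosed (after p X)"
  unfolding hclosed_def after_def using hcong_append[OF hcong.refl] by blast

lemma desc_blocks_neg: "desc_blocks \<beta> w \<Longrightarrow> b \<in> set \<beta> \<Longrightarrow> 0 \<le> b"
  by (induction \<beta> w rule: desc_blocks.induct) auto

lemma desc_blocks_length: "desc_blocks \<beta> w \<Longrightarrow> int (length w) = sum_list \<beta>"
proof (induction \<beta> w rule: desc_blocks.induct)
  case (2 b \<beta> w)
  then have "int (length (drop (nat b) w)) = sum_list \<beta>" by simp
  then show ?case using 2 by (simp add: of_nat_diff)
qed auto

lemma block_count_zero: "block_count X (0 # \<beta>) = block_count X \<beta>"
  by (simp add: block_count_def)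

lemma block_count_neg: "b \<in> set \<beta> \<Longrightarrow> b < 0 \<Longrightarrow> block_count X \<beta> = 0"
proof -
  assume "b \<in> set \<beta>" "b < 0"
  then have "{w \<in> X. desc_blocks \<beta> w} = {}" using desc_blocks_neg by fastforce
  then show ?thesis by (simp only: block_count_def) simp
qed

lemma card_prefix:
  assumes "finite X"
  shows "card {w \<in> X. n \<le> length w \<and> P (take n w) \<and> R (drop n w)} =
    (\<Sum>p\<in>{p \<in> take n ` X. length p = n \<and> P p}. card {s \<in> after p X. R s})"
proof -
  let ?I = "{p \<in> take n ` X. length p = n \<and> P p}"
  have "{w \<in> X. n \<le> length w \<and> P (take n w) \<and> R (drop n w)} =
    (\<Union>p\<in>?I. (@) p ` {s \<in> after p X. R s})" (is "?L = ?U")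
  proof (intro set_eqI iffI)
    fix w assume w: "w \<in> ?L"
    then have "w \<in> (@) (take n w) ` {s \<in> after (take n w) X. R s}"
      by (intro image_eqI[of _ _ "drop n w"]) (auto simp: after_def)
    moreover have "take n w \<in> ?I" using w by auto
    ultimately show "w \<in> ?U" by blast
  qed (auto simp: after_def)
  also have "card \<dots> = (\<Sum>p\<in>?I. card ((@) p ` {s \<in> after p X. R s}))"
    using assms by (intro card_UN_disjoint) (auto simp: finite_after)
  also have "\<dots> = (\<Sum>p\<in>?I. card {s \<in> after p X. R s})"
    by (intro sum.cong card_image) (auto simp: inj_on_def)
  finally show ?thesis .
qed

lemma block_count_Cons:
  assumes "finite X" "0 \<le> b"
  shows "block_count X (b # \<beta>) =
    (\<Sum>p\<in>{p \<in> take (nat b) ` X. length p = nat b \<and> is_desc p}. block_count (after p X) \<beta>)"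
  using card_prefix[OF assms(1), of "nat b" is_desc "desc_blocks \<beta>"] assms(2)
  by (simp add: block_count_def)

lemma block_count_cong_Cons:
  fixes X :: "'a::order list set"
  assumes "finite X" "hclosed X"
    and "\<And>X :: 'a::order list set. finite X \<Longrightarrow> hclosed X \<Longrightarrow> block_count X \<beta> = block_count X \<beta>'"
  shows "block_count X (b # \<beta>) = block_count X (b # \<beta>')"
proof (cases "0 \<le> b")
  case True
  then show ?thesis
    unfolding block_count_Cons[OF assms(1) True]
    by (intro sum.cong HOL.refl assms(3) finite_after hclosed_after assms(1,2))
next
  case False
  then show ?thesis using block_count_neg[of b "b # \<beta>" X] block_count_neg[of b "b # \<beta>'" X] by simp
qed

lemma hcong_exchange_blocks:
  fixes u v :: "'a::order list"
  assumes "three_plus_one_free TYPE('a)" "is_desc u" "is_desc v"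
  defines "u' \<equiv> desc_list (exchange (set u) (set v))"
    and "v' \<equiv> desc_list (exchange (set v) (set u))"
  shows "hcong (u @ v) (v' @ u')" "is_desc u'" "is_desc v'" "length u' = length u" "length v' = length v"
    "set u' = exchange (set u) (set v)" "set v' = exchange (set v) (set u)"
proof -
  have c: "is_chain (set u)" "is_chain (set v)" using is_desc_chain assms by auto
  show "hcong (u @ v) (v' @ u')"
    using hcong_exchange[OF assms(1) _ c(1) _ c(2)]
    unfolding u'_def v'_def desc_list_set[OF assms(2)] desc_list_set[OF assms(3)] by simp
  have e: "finite (exchange (set u) (set v))" "is_chain (exchange (set u) (set v))"
    "finite (exchange (set v) (set u))" "is_chain (exchange (set v) (set u))"
    using c finite_exchange[of "set u" "set v"] finite_exchange[of "set v" "set u"] exchange_chain by auto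
  show "is_desc u'" "is_desc v'" "set u' = exchange (set u) (set v)" "set v' = exchange (set v) (set u)"
    using desc_list e unfolding u'_def v'_def by auto
  show "length u' = length u" "length v' = length v"
    using desc_list(3)[OF e(1,2)] desc_list(3)[OF e(3,4)] card_exchange[of "set u" "set v"] card_exchange[of "set v" "set u"]
      distinct_card[OF is_desc_distinct[OF assms(2)]] distinct_card[OF is_desc_distinct[OF assms(3)]]
    unfolding u'_def v'_def by simp_all
qed

text \<open>The exchange acts on the first two blocks, stays within the class and is injective
  because it can be undone. Using the bound with \<open>a\<close> and \<open>b\<close> interchanged
  as well gives equality in \<open>block_count_swap\<close>.\<close>

lemma card_swap_le:
  fixes X :: "'a::order list set"
  assumes free: "three_plus_one_free TYPE('a)" and X: "finite X" "hclosed X"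
  shows "card {w \<in> X. desc_blocks (int a # int b # \<beta>) w} \<le> card {w \<in> X. desc_blocks (int b # int a # \<beta>) w}"
    (is "card ?L \<le> card ?R")
proof (rule card_inj_on_le)
  define f :: "'a list \<Rightarrow> 'a list" where "f w = desc_list (exchange (set (take b (drop a w))) (set (take a w))) @
    desc_list (exchange (set (take a w)) (set (take b (drop a w)))) @ drop (a + b) w" for w
  have split: "\<exists>u v s. w = u @ v @ s \<and> length u = a \<and> length v = b \<and> is_desc u \<and> is_desc v \<and> desc_blocks \<beta> s"
    if "w \<in> ?L" for w
  proof -
    have "w = take a w @ take b (drop a w) @ drop b (drop a w)" by (metis append_take_drop_id)
    moreover have "length (take a w) = a" "length (take b (drop a w)) = b" "is_desc (take a w)"
      "is_desc (take b (drop a w))" "desc_blocks \<beta> (drop b (drop a w))" using that by auto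
    ultimately show ?thesis by blast
  qed
  have f: "f (u @ v @ s) = desc_list (exchange (set v) (set u)) @ desc_list (exchange (set u) (set v)) @ s"
    if "length u = a" "length v = b" for u v s
    using that by (simp add: f_def)
  show "f ` ?L \<subseteq> ?R"
  proof (intro image_subsetI)
    fix w assume w: "w \<in> ?L"
    then obtain u v s where uvs: "w = u @ v @ s" "length u = a" "length v = b" "is_desc u" "is_desc v"
      "desc_blocks \<beta> s" using split by blast
    note e = hcong_exchange_blocks[OF free uvs(4,5)]
    have "hcong w (f w)" using hcong_append[OF e(1) hcong.refl[of s]] f uvs by simp
    then have "f w \<in> X" using w X(2) unfolding hclosed_def by auto
    then show "f w \<in> ?R" using e uvs f by simp
  qed
  show "inj_on f ?L"
  proof (rule inj_onI)
    fix w1 w2 assume "w1 \<in> ?L" "w2 \<in> ?L" and eq: "f w1 = f w2"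
    then obtain u1 v1 s1 u2 v2 s2 where 1: "w1 = u1 @ v1 @ s1" "length u1 = a" "length v1 = b" "is_desc u1" "is_desc v1"
      and 2: "w2 = u2 @ v2 @ s2" "length u2 = a" "length v2 = b" "is_desc u2" "is_desc v2"
      using split by meson
    note e1 = hcong_exchange_blocks[OF free 1(4,5)] and e2 = hcong_exchange_blocks[OF free 2(4,5)]
    have s: "s1 = s2" and
      "desc_list (exchange (set u1) (set v1)) = desc_list (exchange (set u2) (set v2))"
      "desc_list (exchange (set v1) (set u1)) = desc_list (exchange (set v2) (set u2))"
      using eq f[OF 1(2,3), of s1] f[OF 2(2,3), of s2] 1(1-3) 2(1-3) e1(4,5) e2(4,5) by auto
    then have "exchange (set u1) (set v1) = exchange (set u2) (set v2)"
      "exchange (set v1) (set u1) = exchange (set v2) (set u2)"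
      using e1(6,7) e2(6,7) by metis+
    then have "set u1 = set u2" "set v1 = set v2"
      using exchange_exchange[of "set u1" "set v1"] exchange_exchange[of "set u2" "set v2"]
        exchange_exchange[of "set v1" "set u1"] exchange_exchange[of "set v2" "set u2"] by simp_all
    then have "u1 = u2" "v1 = v2" using is_desc_unique 1(4,5) 2(4,5) by blast+
    then show "w1 = w2" using 1(1) 2(1) s by simp
  qed
  show "finite ?R" using X by simp
qed

lemma block_count_swap:
  fixes X :: "'a::order list set"
  assumes "three_plus_one_free TYPE('a)" "finite X" "hclosed X"
  shows "block_count X (a # b # \<beta>) = block_count X (b # a # \<beta>)"
proof (cases "0 \<le> a \<and> 0 \<le> b")
  case True
  then show ?thesis
    using card_swap_le[OF assms, of "nat a" "nat b" \<beta>] card_swap_le[OF assms, of "nat b" "nat a" \<beta>]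
    unfolding block_count_def by simp
next
  case False
  then obtain c where "c \<in> {a, b}" "c < 0" by force
  then have "c \<in> set (a # b # \<beta>)" "c \<in> set (b # a # \<beta>)" by auto
  then show ?thesis using block_count_neg[OF _ \<open>c < 0\<close>] by metis
qed

lemma block_count_to_front:
  fixes X :: "'a::order list set"
  assumes free: "three_plus_one_free TYPE('a)"
  shows "finite X \<Longrightarrow> hclosed X \<Longrightarrow> block_count X (p @ b # s) = block_count X (b # p @ s)"
proof (induction p arbitrary: X)
  case (Cons a p)
  have "block_count X (a # (p @ b # s)) = block_count X (a # (b # p @ s))"
    using Cons by (intro block_count_cong_Cons) auto
  then show ?case using block_count_swap[OF free Cons.prems] by simp
qed auto

lemma block_count_perm:
  fixes X :: "'a::order list set"
  assumes free: "three_plus_one_free TYPE('a)"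
  shows "finite X \<Longrightarrow> hclosed X \<Longrightarrow> mset \<beta> = mset \<beta>' \<Longrightarrow> block_count X \<beta> = block_count X \<beta>'"
proof (induction \<beta> arbitrary: \<beta>' X)
  case (Cons b \<beta>)
  then have "b \<in> set \<beta>'" by (metis list.set_intros(1) mset_eq_setD)
  then obtain p s where \<beta>': "\<beta>' = p @ b # s" by (metis split_list)
  have "block_count X (b # \<beta>) = block_count X (b # (p @ s))"
    using Cons.prems \<beta>' by (intro block_count_cong_Cons Cons.IH) auto
  then show ?case using block_count_to_front[OF free Cons.prems(1,2)] \<beta>' by simp
qed auto

text \<open>The properties of the values of a linear functional at products of elementary symmetric
  functions: the order of the factors is irrelevant, the function of degree \<open>0\<close> is
  \<open>1\<close>, and those of negative degree vanish.\<close>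

definition admissible :: "(int list \<Rightarrow> int) \<Rightarrow> bool" where
  "admissible \<phi> \<longleftrightarrow> (\<forall>\<beta> \<beta>'. mset \<beta> = mset \<beta>' \<longrightarrow> \<phi> \<beta> = \<phi> \<beta>') \<and> (\<forall>\<beta>. \<phi> (0 # \<beta>) = \<phi> \<beta>) \<and>
     (\<forall>\<beta>. (\<exists>b\<in>set \<beta>. b < 0) \<longrightarrow> \<phi> \<beta> = 0)"

lemma admissible_block_count:
  "three_plus_one_free TYPE('a) \<Longrightarrow> finite X \<Longrightarrow> hclosed (X :: 'a::order list set) \<Longrightarrow> admissible (block_count X)"
  unfolding admissible_def by (auto intro: block_count_perm block_count_neg simp: block_count_zero)

section \<open>Hook monomial functions in terms of elementary ones\<close>

text \<open>\<open>Q\<close> is a formal integer combination of products of elementary functions,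
  kept formal so that the same \<open>Q\<close> can be evaluated for the given poset and for the
  natural numbers.\<close>

definition comb_eval :: "(int \<times> int list) list \<Rightarrow> (int list \<Rightarrow> int) \<Rightarrow> int" where
  "comb_eval Q \<phi> = (\<Sum>(q, \<beta>)\<leftarrow>Q. q * \<phi> \<beta>)"

text \<open>With \<open>M\<^sub>l\<^sub>,\<^sub>k\<close> the monomial symmetric function of the hook \<open>(l, 1\<^sup>k)\<close>, expanding products gives
  \<open>e\<^sub>k\<^sub>+\<^sub>1 M\<^sub>l\<^sub>,\<^sub>0 = M\<^sub>l\<^sub>+\<^sub>1\<^sub>,\<^sub>k + M\<^sub>l\<^sub>,\<^sub>k\<^sub>+\<^sub>1\<close> for \<open>l \<ge> 2\<close>, and the last term has coefficient
  \<open>k + 2\<close> for \<open>l = 1\<close>. The first argument of \<open>hook_comb\<close> is \<open>l - 1\<close>.\<close>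

fun hook_comb :: "nat \<Rightarrow> nat \<Rightarrow> (int \<times> int list) list" where
  "hook_comb 0 k = [(1, [int (k + 1)])]"
| "hook_comb (Suc m) k = map (\<lambda>(q, \<beta>). (q, int (k + 1) # \<beta>)) (hook_comb m 0)
     @ map (\<lambda>(q, \<beta>). (- q, \<beta>)) (hook_comb m (Suc k))
     @ (if m = 0 then [(- int (k + 1), [int (k + 2)])] else [])"

lemma hook_comb_sum: "(q, \<beta>) \<in> set (hook_comb m k) \<Longrightarrow> sum_list \<beta> = int (m + 1 + k)"
  by (induction m k arbitrary: q \<beta> rule: hook_comb.induct) (fastforce split: if_splits)+

text \<open>For \<open>m = 0\<close> the second term is itself the value at
  \<open>[int (k + 2)]\<close>; with the last term its coefficient becomes
  \<open>k + 2\<close>.\<close>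

lemma comb_eval_hook_Suc:
  "comb_eval (hook_comb (Suc m) k) \<phi> = comb_eval (hook_comb m 0) (\<lambda>\<beta>. \<phi> (int (k + 1) # \<beta>))
     - comb_eval (hook_comb m (Suc k)) \<phi> - (if m = 0 then int (k + 1) * \<phi> [int (k + 2)] else 0)"
proof -
  have "(\<Sum>(q, \<beta>)\<leftarrow>map (\<lambda>(q, \<beta>). (- q, \<beta>)) Q. q * \<phi> \<beta>) = - (\<Sum>(q, \<beta>)\<leftarrow>Q. q * \<phi> \<beta>)" for Q
    by (induction Q) auto
  moreover have "(\<Sum>(q, \<beta>)\<leftarrow>map (\<lambda>(q, \<beta>). (q, b # \<beta>)) Q. q * \<phi> \<beta>) = (\<Sum>(q, \<beta>)\<leftarrow>Q. q * \<phi> (b # \<beta>))" for Q b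
    by (induction Q) auto
  ultimately show ?thesis by (simp add: comb_eval_def algebra_simps)
qed

text \<open>Column words of key tableaux of the hook \<open>(m + 1, 1\<^sup>k)\<close>.\<close>

definition key_word :: "nat \<Rightarrow> nat \<Rightarrow> 'a::order list \<Rightarrow> bool" where
  "key_word m k w \<longleftrightarrow> length w = m + 1 + k \<and> is_desc (take (k + 1) w) \<and>
     (\<exists>v\<in>set (take (k + 1) w). power_word (v # drop (k + 1) w))"

definition key_count :: "'a::order list set \<Rightarrow> nat \<Rightarrow> nat \<Rightarrow> int" where
  "key_count X m k = int (card {w \<in> X. key_word m k w})"

lemma power_word_single: "power_word [v]"
  by (simp add: power_word_def P_weakly_increasing_def)

lemma power_word_Cons:
  assumes "w \<noteq> []"
  shows "power_word (v # w) \<longleftrightarrow> power_word w \<and> \<not> hd w < v \<and> (\<exists>x\<in>set w. \<not> v < x)"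
proof -
  have inc: "P_weakly_increasing (v # w) \<longleftrightarrow> P_weakly_increasing w \<and> \<not> hd w < v"
    unfolding P_weakly_increasing_def using assms
    by (auto simp: hd_conv_nth nth_Cons split: nat.splits)
  have "(\<exists>i. Suc i < length (v # w) \<and> (\<forall>j. i < j \<and> j < length (v # w) \<longrightarrow> (v # w) ! i < (v # w) ! j)) \<longleftrightarrow>
     (\<forall>x\<in>set w. v < x) \<or> (\<exists>i. Suc i < length w \<and> (\<forall>j. i < j \<and> j < length w \<longrightarrow> w ! i < w ! j))"
    (is "(\<exists>i. ?P i) \<longleftrightarrow> ?A \<or> (\<exists>i. ?Q i)")
  proof -
    have all: "(\<forall>j. Q j) \<longleftrightarrow> Q 0 \<and> (\<forall>j. Q (Suc j))" for Q :: "nat \<Rightarrow> bool"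
      by (metis not0_implies_Suc)
    have ex: "(\<exists>i. Q i) \<longleftrightarrow> Q 0 \<or> (\<exists>i. Q (Suc i))" for Q :: "nat \<Rightarrow> bool"
      by (metis not0_implies_Suc)
    have "(\<exists>i. ?P i) \<longleftrightarrow> ?P 0 \<or> (\<exists>i. ?P (Suc i))" by (rule ex)
    moreover have "?P 0 \<longleftrightarrow> ?A" using assms by (subst all) (simp add: all_set_conv_all_nth)
    moreover have "?P (Suc i) \<longleftrightarrow> ?Q i" for i by (subst all) simp
    ultimately show ?thesis by simp
  qed
  then show ?thesis using inc unfolding power_word_def by blast
qed

section \<open>Inserting the head of a power word into a chain\<close>

definition dominated :: "'a::order list \<Rightarrow> 'a list \<Rightarrow> bool" where
  "dominated B w \<longleftrightarrow> (\<forall>v\<in>set B. hd w < v \<or> (\<forall>x\<in>set w. v < x))"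

text \<open>The two alternatives in \<open>dominated\<close> are the two ways in which
  \<open>power_word_Cons\<close> can fail when \<open>w\<close> is already a power word.\<close>

lemma dominated_iff:
  assumes "power_word w" "w \<noteq> []"
  shows "dominated B w \<longleftrightarrow> (\<forall>v\<in>set B. \<not> power_word (v # w))"
  unfolding dominated_def power_word_Cons[OF assms(2)] using assms(1) by blast

definition insert_desc :: "'a::order \<Rightarrow> 'a list \<Rightarrow> 'a list" where
  "insert_desc x B = desc_list (insert x (set B))"

lemma insert_desc:
  assumes "is_desc B" "dominated B (b # s)"
  shows "is_desc (insert_desc b B)" "set (insert_desc b B) = insert b (set B)" "b \<notin> set B"
    "length (insert_desc b B) = Suc (length B)" "hcong (B @ [b]) (insert_desc b B)"
proof -
  have cmp: "b < v \<or> v < b" if "v \<in> set B" for v using assms(2) that unfolding dominated_def by auto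
  then show nb: "b \<notin> set B" by blast
  have c: "is_chain (insert b (set B))"
    using cmp is_desc_chain[OF assms(1)] unfolding is_chain_def comparable_def by (auto dest: less_imp_le)
  note d = desc_list[OF _ c, simplified]
  show "is_desc (insert_desc b B)" "set (insert_desc b B) = insert b (set B)" "length (insert_desc b B) = Suc (length B)"
    using d nb distinct_card[OF is_desc_distinct[OF assms(1)]] unfolding insert_desc_def by auto
  show "hcong (B @ [b]) (insert_desc b B)"
  proof (rule hcong_chain)
    have "mset (b # B) = mset (insert_desc b B)"
      using d nb is_desc_distinct[OF assms(1)] unfolding insert_desc_def
      by (intro set_eq_iff_mset_eq_distinct[THEN iffD1]) auto
    then show "mset (B @ [b]) = mset (insert_desc b B)" by simp
  qed (use c in simp)
qed

lemma key_word_split: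
  "key_word m k w \<longleftrightarrow> (\<exists>C s. w = C @ s \<and> length C = k + 1 \<and> length s = m \<and> is_desc C \<and> (\<exists>v\<in>set C. power_word (v # s)))"
proof
  assume "key_word m k w"
  then show "\<exists>C s. w = C @ s \<and> length C = k + 1 \<and> length s = m \<and> is_desc C \<and> (\<exists>v\<in>set C. power_word (v # s))"
    unfolding key_word_def by (intro exI[of _ "take (k + 1) w"] exI[of _ "drop (k + 1) w"]) auto
qed (auto simp: key_word_def)

lemma key_word_nil: "key_word 0 k w \<longleftrightarrow> length w = k + 1 \<and> is_desc w"
proof -
  have "\<exists>v. v \<in> set w" if "length w = k + 1" using that by (metis length_0_conv list.set_sel(1) add_is_0 one_neq_zero)
  then show ?thesis unfolding key_word_def by (auto simp: power_word_single)
qed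

text \<open>A letter of \<open>B\<close> that is not above \<open>b\<close> lies below all of
  \<open>s\<close>, so it cannot precede \<open>s\<close> in a power word. For empty
  \<open>s\<close> this breaks down: any single letter is a power word, and \<open>b\<close> is no
  longer recognisable.\<close>

lemma insert_desc_marked:
  assumes B: "is_desc B" "dominated B (b # s)" "power_word (b # s)" "s \<noteq> []"
  shows "b \<in> set (insert_desc b B)" "power_word (b # s)"
    "\<And>v. v \<in> set (insert_desc b B) \<Longrightarrow> power_word (v # s) \<Longrightarrow> b \<le> v"
proof -
  show "b \<in> set (insert_desc b B)" "power_word (b # s)" using insert_desc(2)[OF B(1,2)] B by auto
  fix v assume v: "v \<in> set (insert_desc b B)" "power_word (v # s)"
  show "b \<le> v"
  proof (cases "v = b")
    case False
    then have "v \<in> set B" using v insert_desc(2)[OF B(1,2)] by auto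
    then have "b < v \<or> (\<forall>x\<in>set s. v < x)" using B(2) unfolding dominated_def by auto
    then show ?thesis using v(2) power_word_Cons[OF B(4)] by auto
  qed simp
qed

text \<open>The inverse of the insertion. If \<open>u < v\<close> in the chain, then
  \<open>u\<close> cannot precede \<open>s\<close> by minimality; \<open>hd s < u\<close> would give
  \<open>hd s < v\<close>, so the reason must be that \<open>u\<close> lies below all of
  \<open>s\<close>.\<close>

lemma marked_insert_desc:
  assumes C: "is_desc C" "v \<in> set C" "power_word (v # s)" "s \<noteq> []"
    and min: "\<And>v'. v' \<in> set C \<Longrightarrow> power_word (v' # s) \<Longrightarrow> v \<le> v'"
  shows "dominated (remove1 v C) (v # s)" "insert_desc v (remove1 v C) = C" "is_desc (remove1 v C)"
proof -
  have sC: "set (remove1 v C) = set C - {v}" using is_desc_distinct[OF C(1)] by simp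
  have "v < u \<or> (\<forall>x\<in>set (v # s). u < x)" if u: "u \<in> set C - {v}" for u
  proof (cases "v < u")
    case False
    then have uv: "u < v" using is_desc_chain[OF C(1)] C(2) u unfolding is_chain_def comparable_def by (auto simp: less_le)
    then have "\<not> power_word (u # s)" using min[of u] u by auto
    moreover have "\<not> hd s < u" using C(3) uv unfolding power_word_Cons[OF C(4)] by (auto dest: order.strict_trans)
    ultimately have "\<forall>x\<in>set s. u < x" using C(3) unfolding power_word_Cons[OF C(4)] by blast
    then show ?thesis using uv by simp
  qed simp
  then show "dominated (remove1 v C) (v # s)" unfolding dominated_def sC by simp
  show "insert_desc v (remove1 v C) = C"
    unfolding insert_desc_def sC using C(2) desc_list_set[OF C(1)] by (simp add: insert_absorb)
  show "is_desc (remove1 v C)" using C(1) by (induction C) auto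
qed

lemma least_marked_exists:
  assumes "is_desc C" "\<exists>v\<in>set C. R v"
  obtains v where "v \<in> set C" "R v" "\<And>v'. v' \<in> set C \<Longrightarrow> R v' \<Longrightarrow> v \<le> v'"
proof -
  have "finite {v \<in> set C. R v}" "{v \<in> set C. R v} \<noteq> {}" using assms by auto
  then obtain v where v: "v \<in> set C" "R v" "\<forall>y\<in>{v \<in> set C. R v}. y \<le> v \<longrightarrow> v = y"
    using finite_has_minimal[of "{v \<in> set C. R v}"] by auto
  then have "v \<le> v'" if "v' \<in> set C" "R v'" for v'
    using that is_desc_chain[OF assms(1)] unfolding is_chain_def comparable_def by auto
  then show thesis using that v by blast
qed

text \<open>The product of a chain \<open>B\<close> of length \<open>k + 1\<close> and a power word \<open>w\<close> is a key word for the
  hook with the longer row unless every \<open>v \<in> B\<close> satisfies \<open>hd w < v\<close> or lies below all of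
  \<open>w\<close>. In the latter case \<open>hd w\<close> is comparable to all of \<open>B\<close>; moving it into the chain gives
  a key word for the hook with the longer column, in which, if \<open>w\<close> has at least two letters, it is recovered
  as the least \<open>v\<close> in the chain such that \<open>v\<close> followed by the row is a power word.\<close>

definition dominated_pairs :: "'a::order list set \<Rightarrow> nat \<Rightarrow> nat \<Rightarrow> 'a list set" where
  "dominated_pairs X m k = {w \<in> X. \<exists>B b s. w = B @ b # s \<and> length B = k + 1 \<and> length s = m \<and> is_desc B \<and>
     power_word (b # s) \<and> dominated B (b # s)}"

lemma card_dominated_pairs:
  fixes X :: "'a::order list set"
  assumes X: "finite X" "hclosed X" and m: "0 < m"
  shows "card (dominated_pairs X m k) = card {w \<in> X. key_word m (Suc k) w}"
proof (rule bij_betw_same_card)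
  define f where "f w = insert_desc (w ! (k + 1)) (take (k + 1) w) @ drop (k + 2) w" for w :: "'a list"
  have f: "f (B @ b # s) = insert_desc b B @ s" if "length B = k + 1" for B b s
    using that by (simp add: f_def nth_append)
  show "bij_betw f (dominated_pairs X m k) {w \<in> X. key_word m (Suc k) w}"
  proof (rule bij_betw_imageI)
    show "inj_on f (dominated_pairs X m k)"
    proof (rule inj_onI)
      fix w1 w2 assume "w1 \<in> dominated_pairs X m k" "w2 \<in> dominated_pairs X m k" and eq: "f w1 = f w2"
      then obtain B1 b1 s1 B2 b2 s2 where
        1: "w1 = B1 @ b1 # s1" "length B1 = k + 1" "length s1 = m" "is_desc B1" "power_word (b1 # s1)" "dominated B1 (b1 # s1)" and
        2: "w2 = B2 @ b2 # s2" "length B2 = k + 1" "length s2 = m" "is_desc B2" "power_word (b2 # s2)" "dominated B2 (b2 # s2)"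
        unfolding dominated_pairs_def by blast
      note i1 = insert_desc[OF 1(4,6)] and i2 = insert_desc[OF 2(4,6)]
      have "insert_desc b1 B1 = insert_desc b2 B2" "s1 = s2"
        using eq f 1 2 i1(4) i2(4) by auto
      moreover have s: "s1 \<noteq> []" "s2 \<noteq> []" using 1 2 m by auto
      ultimately have b: "b1 = b2"
        using insert_desc_marked[OF 1(4,6,5) s(1)] insert_desc_marked[OF 2(4,6,5) s(2)] by (metis order.antisym)
      have "set B1 = insert b1 (set B1) - {b1}" using i1(3) by auto
      also have "\<dots> = insert b2 (set B2) - {b2}"
        using i1(2) i2(2) b \<open>insert_desc b1 B1 = insert_desc b2 B2\<close> by metis
      also have "\<dots> = set B2" using i2(3) by auto
      finally have "B1 = B2" using is_desc_unique 1 2 by blast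
      then show "w1 = w2" using 1 2 b \<open>s1 = s2\<close> by simp
    qed
    show "f ` dominated_pairs X m k = {w \<in> X. key_word m (Suc k) w}"
    proof (intro set_eqI iffI)
      fix w assume "w \<in> f ` dominated_pairs X m k"
      then obtain B b s where w: "w = f (B @ b # s)" "B @ b # s \<in> X" "length B = k + 1" "length s = m" "is_desc B"
        "power_word (b # s)" "dominated B (b # s)"
        unfolding dominated_pairs_def by blast
      note i = insert_desc[OF w(5,7)]
      have "hcong (B @ b # s) w" using hcong_append[OF i(5) hcong.refl[of s]] f w by simp
      then have "w \<in> X" using X(2) w(2) unfolding hclosed_def by blast
      moreover have "key_word m (Suc k) w" unfolding key_word_split using i w f
        by (intro exI[of _ "insert_desc b B"] exI[of _ s]) auto
      ultimately show "w \<in> {w \<in> X. key_word m (Suc k) w}" by simp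
    next
      fix w assume "w \<in> {w \<in> X. key_word m (Suc k) w}"
      then obtain C s where w: "w \<in> X" "w = C @ s" "length C = Suc k + 1" "length s = m" "is_desc C" "\<exists>v\<in>set C. power_word (v # s)"
        unfolding key_word_split by blast
      have s: "s \<noteq> []" using w m by auto
      obtain v where v: "v \<in> set C" "power_word (v # s)" "\<And>v'. v' \<in> set C \<Longrightarrow> power_word (v' # s) \<Longrightarrow> v \<le> v'"
        using least_marked_exists[OF w(5,6)] by blast
      note M = marked_insert_desc[OF w(5) v(1,2) s v(3)]
      have l: "length (remove1 v C) = k + 1" using v(1) w(3) by (simp add: length_remove1)
      have "hcong (remove1 v C @ v # s) (C @ s)"
        using hcong_append[OF insert_desc(5)[OF M(3,1)] hcong.refl[of s]] M(2) by simp
      then have "remove1 v C @ v # s \<in> X" using X(2) w hcong.sym unfolding hclosed_def by blast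
      then have "remove1 v C @ v # s \<in> dominated_pairs X m k"
        using l w v M unfolding dominated_pairs_def by blast
      moreover have "f (remove1 v C @ v # s) = w" using f[OF l] M w by simp
      ultimately show "w \<in> f ` dominated_pairs X m k" by (metis image_eqI)
    qed
  qed
qed

lemma is_desc_delete:
  assumes "is_desc C" "i < length C"
  shows "is_desc (take i C @ drop (Suc i) C)"
proof -
  have "is_desc (take i C @ C ! i # drop (Suc i) C)" using id_take_nth_drop[OF assms(2)] assms(1) by simp
  then show ?thesis by (auto simp: sorted_wrt_append)
qed

text \<open>With an empty row nothing marks the inserted letter, so each of the \<open>k + 2\<close>
  letters of a decreasing word can be taken out. A pair \<open>(C, i)\<close> names the word and the
  position of that letter.\<close>

lemma card_dominated_pairs_0:
  fixes X :: "'a::order list set"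
  assumes X: "finite X" "hclosed X"
  shows "card (dominated_pairs X 0 k) = (k + 2) * card {w \<in> X. key_word 0 (Suc k) w}"
proof -
  define g :: "'a list \<times> nat \<Rightarrow> 'a list" where "g = (\<lambda>(C, i). (take i C @ drop (Suc i) C) @ [C ! i])"
  let ?D = "{w \<in> X. key_word 0 (Suc k) w}"
  have "bij_betw g (?D \<times> {..<k + 2}) (dominated_pairs X 0 k)"
  proof (rule bij_betw_imageI)
    have dec: "set (take i C @ drop (Suc i) C) = set C - {C ! i}" "hcong (g (C, i)) C"
      if "is_desc C" "i < length C" for C i
    proof -
      have C: "C = take i C @ C ! i # drop (Suc i) C" by (rule id_take_nth_drop[OF that(2)])
      have "distinct (take i C @ C ! i # drop (Suc i) C)" using C is_desc_distinct[OF that(1)] by simp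
      moreover have "set C = set (take i C @ C ! i # drop (Suc i) C)" using C by simp
      ultimately show "set (take i C @ drop (Suc i) C) = set C - {C ! i}" by auto
      have "mset C = mset (take i C @ C ! i # drop (Suc i) C)" using C by simp
      then have "hcong C (g (C, i))"
        by (intro hcong_chain is_desc_chain that) (simp add: g_def)
      then show "hcong (g (C, i)) C" by (rule hcong.sym)
    qed
    show "inj_on g (?D \<times> {..<k + 2})"
    proof (rule inj_onI)
      fix x y assume x: "x \<in> ?D \<times> {..<k + 2}" and y: "y \<in> ?D \<times> {..<k + 2}" and eq: "g x = g y"
      obtain C i C' j where xy: "x = (C, i)" "y = (C', j)" by (cases x, cases y) auto
      have d: "is_desc C" "is_desc C'" "i < length C" "j < length C'" using x y xy by (auto simp: key_word_nil)
      have "mset C = mset C'" using hcong_mset[OF dec(2)[OF d(1,3)]] hcong_mset[OF dec(2)[OF d(2,4)]] eq xy by simp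
      then have "C = C'" using is_desc_unique d mset_eq_setD by blast
      moreover have "C ! i = C' ! j" using eq xy by (simp add: g_def)
      ultimately show "x = y" using xy d nth_eq_iff_index_eq[OF is_desc_distinct[OF d(1)]] by auto
    qed
    show "g ` (?D \<times> {..<k + 2}) = dominated_pairs X 0 k"
    proof (intro set_eqI iffI)
      fix w assume "w \<in> g ` (?D \<times> {..<k + 2})"
      then obtain C i where C: "C \<in> X" "is_desc C" "length C = k + 2" "i < length C" "w = g (C, i)"
        by (auto simp: key_word_nil)
      have "w \<in> X" using dec(2)[OF C(2,4)] C X(2) hcong.sym unfolding hclosed_def by blast
      moreover have "is_desc (take i C @ drop (Suc i) C)"
        by (rule is_desc_delete[OF C(2,4)])
      moreover have "dominated (take i C @ drop (Suc i) C) [C ! i]"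
        using is_desc_chain[OF C(2)] C(4) unfolding dominated_def dec(1)[OF C(2,4)] is_chain_def comparable_def
        by (auto simp: less_le)
      ultimately show "w \<in> dominated_pairs X 0 k" unfolding dominated_pairs_def
        using C by (auto simp: g_def power_word_single intro!: exI[of _ "take i C @ drop (Suc i) C"])
    next
      fix w assume "w \<in> dominated_pairs X 0 k"
      then obtain B b where w: "w \<in> X" "w = B @ [b]" "length B = k + 1" "is_desc B" "dominated B [b]"
        unfolding dominated_pairs_def by auto
      note i = insert_desc[OF w(4,5)]
      define C where "C = insert_desc b B"
      obtain j where j: "j < length C" "C ! j = b" using i(2) unfolding C_def by (metis in_set_conv_nth insertI1)
      have "take j C @ drop (Suc j) C = B"
      proof (rule is_desc_unique)
        show "is_desc (take j C @ drop (Suc j) C)"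
          using is_desc_delete[of C j] i(1) j(1) unfolding C_def by simp
        show "set (take j C @ drop (Suc j) C) = set B"
          using dec(1)[of C j] i j unfolding C_def by auto
      qed (rule w(4))
      then have "w = g (C, j)" using w j by (simp add: g_def)
      moreover have "C \<in> X" using i(5) w X(2) unfolding hclosed_def C_def by blast
      ultimately show "w \<in> g ` (?D \<times> {..<k + 2})"
        using i(1,4) w(3) j(1) unfolding C_def by (intro image_eqI[of _ _ "(insert_desc b B, j)"]) (auto simp: key_word_nil)
    qed
  qed
  then have "card (dominated_pairs X 0 k) = card (?D \<times> {..<k + 2})" by (simp add: bij_betw_same_card)
  then show ?thesis by (simp add: card_cartesian_product)
qed

lemma card_chain_power_pairs:
  fixes X :: "'a::order list set"
  assumes X: "finite X" "hclosed X"
  shows "card {w \<in> X. k + 1 \<le> length w \<and> is_desc (take (k + 1) w) \<and> key_word m 0 (drop (k + 1) w)} =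
    card {w \<in> X. key_word (Suc m) k w} + card (dominated_pairs X m k)" (is "card ?L = card ?A + _")
proof -
  have "?L = ?A \<union> dominated_pairs X m k \<and> ?A \<inter> dominated_pairs X m k = {}"
  proof (intro conjI set_eqI iffI)
    fix w assume "w \<in> ?L"
    then have w: "w \<in> X" "length (take (k + 1) w) = k + 1" "is_desc (take (k + 1) w)"
       "key_word m 0 (drop (k + 1) w)" by auto
    obtain C s where s: "drop (k + 1) w = C @ s" "length C = 1" "length s = m" "\<exists>v\<in>set C. power_word (v # s)"
      using w(4) unfolding key_word_split by auto
    obtain b where b: "C = [b]" using s(2) by (auto simp: length_Suc_conv)
    then have pw: "power_word (b # s)" "drop (k + 1) w = b # s" using s by auto
    have eq: "w = take (k + 1) w @ b # s" using pw by (metis append_take_drop_id)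
    show "w \<in> ?A \<union> dominated_pairs X m k"
    proof (cases "dominated (take (k + 1) w) (b # s)")
      case True
      then show ?thesis using w s pw eq unfolding dominated_pairs_def by blast
    next
      case False
      then have "\<exists>v\<in>set (take (k + 1) w). power_word (v # b # s)" using dominated_iff[OF pw(1)] by blast
      then have "key_word (Suc m) k w" unfolding key_word_split using w s eq
        by (intro exI[of _ "take (k + 1) w"] exI[of _ "b # s"]) auto
      then show ?thesis using w by simp
    qed
  next
    fix w assume w: "w \<in> ?A \<union> dominated_pairs X m k"
    have "\<exists>B b s. w \<in> X \<and> w = B @ b # s \<and> length B = k + 1 \<and> length s = m \<and> is_desc B \<and> power_word (b # s)"
    proof (cases "w \<in> ?A")
      case True
      then obtain C s where s: "w \<in> X" "w = C @ s" "length C = k + 1" "length s = Suc m" "is_desc C" "\<exists>v\<in>set C. power_word (v # s)"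
        unfolding key_word_split by auto
      obtain b s' where "s = b # s'" using s(4) by (cases s) auto
      then show ?thesis using s power_word_Cons[of s] by (intro exI[of _ C] exI[of _ b] exI[of _ s']) auto
    next
      case False
      then show ?thesis using w unfolding dominated_pairs_def by blast
    qed
    then obtain B b s where "w \<in> X" "w = B @ b # s" "length B = k + 1" "length s = m" "is_desc B" "power_word (b # s)"
      by blast
    moreover from this have "key_word m 0 (b # s)" unfolding key_word_split
      by (intro exI[of _ "[b]"] exI[of _ s]) auto
    ultimately show "w \<in> ?L" by simp
  next
    fix w assume "w \<in> ?A \<inter> dominated_pairs X m k"
    then obtain C t B b s where "w = C @ t" "length C = k + 1" "\<exists>v\<in>set C. power_word (v # t)"
      "w = B @ b # s" "length B = k + 1" "power_word (b # s)" "dominated B (b # s)"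
      unfolding key_word_split dominated_pairs_def by blast
    then show "w \<in> {}" using dominated_iff[of "b # s" B] by auto
  qed simp
  moreover have "finite ?A" "finite (dominated_pairs X m k)" using X unfolding dominated_pairs_def by auto
  ultimately show ?thesis using card_Un_disjoint by metis
qed

lemma comb_eval_sum: "comb_eval Q (\<lambda>\<beta>. \<Sum>p\<in>I. \<phi> p \<beta>) = (\<Sum>p\<in>I. comb_eval Q (\<phi> p))"
  unfolding comb_eval_def by (induction Q) (auto simp: sum.distrib sum_distrib_left)

text \<open>Induction along the recursion of \<open>hook_comb\<close>. Its leading factor
  \<open>k + 1\<close> splits off a decreasing prefix \<open>p\<close> and leaves a count in
  \<open>after p X\<close>, which is why the claim is made for all finite closed sets and not for
  classes.\<close>

lemma comb_eval_hook_block_count: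
  fixes X :: "'a::order list set"
  shows "finite X \<Longrightarrow> hclosed X \<Longrightarrow> comb_eval (hook_comb m k) (block_count X) = key_count X m k"
proof (induction m arbitrary: k X)
  case 0
  have "desc_blocks [1 + int k] w \<longleftrightarrow> key_word 0 k w" for w :: "'a list"
    unfolding key_word_nil by (auto simp: nat_add_distrib)
  then show ?case by (simp add: comb_eval_def block_count_def key_count_def add.commute)
next
  case (Suc m)
  let ?I = "{p \<in> take (k + 1) ` X. length p = k + 1 \<and> is_desc p}"
  have "comb_eval (hook_comb m 0) (\<lambda>\<beta>. block_count X (int (k + 1) # \<beta>)) =
      comb_eval (hook_comb m 0) (\<lambda>\<beta>. \<Sum>p\<in>?I. block_count (after p X) \<beta>)"
    using block_count_Cons[OF Suc.prems(1), of "int (k + 1)"] by (simp only: nat_int of_nat_0_le_iff)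
  also have "\<dots> = (\<Sum>p\<in>?I. key_count (after p X) m 0)"
    unfolding comb_eval_sum using Suc by (intro sum.cong Suc.IH finite_after hclosed_after) auto
  also have "\<dots> = int (card {w \<in> X. k + 1 \<le> length w \<and> is_desc (take (k + 1) w) \<and> key_word m 0 (drop (k + 1) w)})"
    using card_prefix[OF Suc.prems(1), of "k + 1" is_desc "key_word m 0"] by (simp add: key_count_def)
  also have "\<dots> = key_count X (Suc m) k + int (card (dominated_pairs X m k))"
    unfolding card_chain_power_pairs[OF Suc.prems] by (simp add: key_count_def)
  finally have main: "comb_eval (hook_comb m 0) (\<lambda>\<beta>. block_count X (int (k + 1) # \<beta>)) =
      key_count X (Suc m) k + int (card (dominated_pairs X m k))" .
  show ?case
  proof (cases "m = 0")
    case True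
    have "block_count X [int (k + 2)] = key_count X 0 (Suc k)"
      using Suc.IH[OF Suc.prems, of "Suc k"] True by (simp add: comb_eval_def)
    then show ?thesis
      using main True Suc.IH[OF Suc.prems, of "Suc k"] card_dominated_pairs_0[OF Suc.prems, of k]
      unfolding comb_eval_hook_Suc by (simp add: key_count_def algebra_simps)
  next
    case False
    then show ?thesis
      using main Suc.IH[OF Suc.prems, of "Suc k"] card_dominated_pairs[OF Suc.prems, of m k]
      unfolding comb_eval_hook_Suc by (simp add: key_count_def)
  qed
qed

section \<open>Jacobi--Trudi determinants span the elementary products\<close>

definition first_part :: "nat list \<Rightarrow> nat" where
  "first_part \<mu> = (if \<mu> = [] then 0 else hd \<mu>)"

definition jacobi_trudi :: "(int list \<Rightarrow> int) \<Rightarrow> nat list \<Rightarrow> int" where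
  "jacobi_trudi \<phi> \<mu> = (\<Sum>\<pi> | \<pi> permutes {1..first_part \<mu>}.
     sign \<pi> * \<phi> (map (\<lambda>i. int (conj_part \<mu> i) + int (\<pi> i) - int i) [1..<Suc (first_part \<mu>)]))"

section \<open>Terms of a determinant and sums of squares\<close>

lemma sum_card_le: "finite S \<Longrightarrow> 0 \<notin> S \<Longrightarrow> \<Sum>{1..card S} \<le> \<Sum>(S :: nat set)"
proof (induction rule: finite_linorder_max_induct)
  case (insert b A)
  have "A \<subseteq> {1..<b}" using insert by (auto simp: Suc_le_eq intro: gr0I)
  then have "card A \<le> b - 1" using card_mono[of "{1..<b}" A] by simp
  moreover have "0 < b" using insert.prems by (auto intro: gr0I)
  moreover have "b \<notin> A" using insert by auto
  ultimately show ?case using insert by auto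
qed simp

text \<open>Summation by parts. The partial sums \<open>D m\<close> of \<open>\<pi> i - i\<close>
  are nonnegative, because \<pi> maps \<open>{1..m}\<close> to \<open>m\<close> distinct positive
  numbers; they vanish at \<open>j\<close>, and \<open>g\<close> decreases.\<close>

lemma rearrangement_permutes:
  fixes g :: "nat \<Rightarrow> int"
  assumes p: "\<pi> permutes {1..j}" and g: "\<And>i. 1 \<le> i \<Longrightarrow> i < j \<Longrightarrow> g (Suc i) \<le> g i"
  shows "0 \<le> (\<Sum>i=1..j. g i * (int (\<pi> i) - int i))"
proof -
  define D where "D m = (\<Sum>i=1..m. int (\<pi> i) - int i)" for m
  have D: "0 \<le> D m" if "m \<le> j" for m
  proof -
    have "\<Sum>{1..card (\<pi> ` {1..m})} \<le> \<Sum>(\<pi> ` {1..m})"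
    proof (rule sum_card_le)
      show "0 \<notin> \<pi> ` {1..m}"
      proof
        assume "0 \<in> \<pi> ` {1..m}"
        then obtain i where "1 \<le> i" "i \<le> m" "\<pi> i = 0" by auto
        then have "\<pi> i \<in> {1..j}" using permutes_in_image[OF p, of i] that by simp
        then show False using \<open>\<pi> i = 0\<close> by simp
      qed
    qed simp
    moreover have "inj_on \<pi> {1..m}" using permutes_inj[OF p] by (auto simp: inj_on_def)
    ultimately have "\<Sum>{1..m} \<le> (\<Sum>i=1..m. \<pi> i)" by (simp add: card_image sum.reindex)
    then have "int (\<Sum>{1..m}) \<le> int (\<Sum>i=1..m. \<pi> i)" by (rule of_nat_mono)
    then show ?thesis unfolding D_def sum_subtractf of_nat_sum by simp
  qed
  have "D j = 0"
  proof -
    have "(\<Sum>i=1..j. int (\<pi> i)) = (\<Sum>i=1..j. int i)" by (rule sum.permute[OF p, symmetric, unfolded comp_def])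
    then show ?thesis unfolding D_def sum_subtractf by simp
  qed
  \<comment> \<open>The left side is the boundary term of the summation by parts;
    \<open>D j = 0\<close> removes it in the end.\<close>
  moreover have "g (Suc m) * D (Suc m) \<le> (\<Sum>i=1..Suc m. g i * (int (\<pi> i) - int i))" if "Suc m \<le> j" for m
    using that
  proof (induction m)
    case 0
    show ?case by (simp add: D_def)
  next
    case (Suc m)
    have "g (Suc (Suc m)) * D (Suc m) \<le> g (Suc m) * D (Suc m)"
      using g[of "Suc m"] Suc.prems D by (intro mult_right_mono) auto
    also have "\<dots> \<le> (\<Sum>i=1..Suc m. g i * (int (\<pi> i) - int i))" using Suc by simp
    finally show ?case by (simp add: D_def algebra_simps)
  qed
  ultimately show ?thesis by (cases j) fastforce+
qed

text \<open>The indices in the term of \<pi> of the determinant with diagonal \<gamma>. Rows are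
  numbered from 1 and list positions from 0, whence \<open>i - 1\<close>.\<close>

definition shifted :: "int list \<Rightarrow> (nat \<Rightarrow> nat) \<Rightarrow> int list" where
  "shifted \<gamma> \<pi> = map (\<lambda>i. \<gamma> ! (i - 1) + int (\<pi> i) - int i) [1..<Suc (length \<gamma>)]"

lemma sum_list_map_upt_Suc:
  "sum_list (map f [1..<Suc j]) = (\<Sum>i=1..j. f i)" for f :: "nat \<Rightarrow> int"
  by (simp only: sum_set_upt_conv_sum_list_nat[symmetric] set_upt atLeastLessThanSuc_atLeastAtMost)

lemma sum_list_nth_shift:
  "(\<Sum>i=1..length \<gamma>. f (\<gamma> ! (i - 1))) = sum_list (map f \<gamma>)" for f :: "int \<Rightarrow> int"
proof -
  have "(\<Sum>i=1..length \<gamma>. f (\<gamma> ! (i - 1))) = (\<Sum>i<length \<gamma>. f (\<gamma> ! i))"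
    by (rule sum.reindex_bij_witness[of _ Suc "\<lambda>i. i - 1"]) auto
  then show ?thesis by (simp add: sum_list_sum_nth atLeast0LessThan)
qed

lemma sum_list_shifted:
  assumes "\<pi> permutes {1..length \<gamma>}"
  shows "sum_list (shifted \<gamma> \<pi>) = sum_list \<gamma>"
proof -
  have p: "(\<Sum>i=1..length \<gamma>. int (\<pi> i)) = (\<Sum>i=1..length \<gamma>. int i)"
    by (rule sum.permute[OF assms, symmetric, unfolded comp_def])
  have "sum_list (shifted \<gamma> \<pi>) = (\<Sum>i=1..length \<gamma>. \<gamma> ! (i - 1) + int (\<pi> i) - int i)"
    unfolding shifted_def by (rule sum_list_map_upt_Suc)
  also have "\<dots> = (\<Sum>i=1..length \<gamma>. \<gamma> ! (i - 1))"
    unfolding sum_subtractf sum.distrib p by simp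
  finally show ?thesis using sum_list_nth_shift[of "\<lambda>x. x" \<gamma>] by simp
qed

text \<open>With \<open>d i = \<pi> i - i\<close> the increase is twice the nonnegative sum of
  \<open>rearrangement_permutes\<close> plus the sum of the squares of \<open>d i\<close>, which is
  positive since \<pi> moves some index.\<close>

lemma sum_squares_shifted:
  assumes p: "\<pi> permutes {1..length \<gamma>}" "\<pi> \<noteq> id" and \<gamma>: "sorted_wrt (\<ge>) \<gamma>"
  shows "sum_list (map (\<lambda>b. b\<^sup>2) \<gamma>) < sum_list (map (\<lambda>b. b\<^sup>2) (shifted \<gamma> \<pi>))"
proof -
  define d where "d i = int (\<pi> i) - int i" for i
  let ?I = "{1..length \<gamma>}"
  have "sum_list (map (\<lambda>b. b\<^sup>2) (shifted \<gamma> \<pi>)) = (\<Sum>i\<in>?I. (\<gamma> ! (i - 1) + d i)\<^sup>2)"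
    unfolding shifted_def map_map o_def d_def by (subst sum_list_map_upt_Suc) (simp add: algebra_simps)
  also have "\<dots> = (\<Sum>i\<in>?I. (\<gamma> ! (i - 1))\<^sup>2) + 2 * (\<Sum>i\<in>?I. \<gamma> ! (i - 1) * d i) + (\<Sum>i\<in>?I. (d i)\<^sup>2)"
    by (simp add: power2_sum sum.distrib sum_distrib_left mult.assoc algebra_simps)
  also have "(\<Sum>i\<in>?I. (\<gamma> ! (i - 1))\<^sup>2) = sum_list (map (\<lambda>b. b\<^sup>2) \<gamma>)" by (rule sum_list_nth_shift)
  finally have eq: "sum_list (map (\<lambda>b. b\<^sup>2) (shifted \<gamma> \<pi>)) = sum_list (map (\<lambda>b. b\<^sup>2) \<gamma>)
     + 2 * (\<Sum>i\<in>?I. \<gamma> ! (i - 1) * d i) + (\<Sum>i\<in>?I. (d i)\<^sup>2)" .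
  have "0 \<le> (\<Sum>i\<in>?I. \<gamma> ! (i - 1) * d i)"
    unfolding d_def using \<gamma> by (intro rearrangement_permutes p) (auto simp: sorted_wrt_iff_nth_less)
  moreover have "0 < (\<Sum>i\<in>?I. (d i)\<^sup>2)"
  proof -
    obtain i where i: "\<pi> i \<noteq> i" using p(2) by (metis eq_id_iff)
    then have "i \<in> ?I" using p(1) by (meson permutes_not_in)
    then show ?thesis using i by (intro sum_pos2[of _ i]) (auto simp: d_def)
  qed
  ultimately show ?thesis using eq by simp
qed

text \<open>The conjugate partition, so that the determinant for \<open>conj_list g\<close> has
  diagonal \<open>g\<close>.\<close>

definition conj_list :: "nat list \<Rightarrow> nat list" where
  "conj_list g = map (\<lambda>r. card {i. i < length g \<and> r < g ! i}) [0..<first_part g]"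

text \<open>As \<mu> decreases weakly, the counted indices form an initial segment.\<close>

lemma less_card_iff:
  fixes \<mu> :: "nat list"
  assumes "sorted_wrt (\<ge>) \<mu>"
  shows "r < card {i. i < length \<mu> \<and> t < \<mu> ! i} \<longleftrightarrow> r < length \<mu> \<and> t < \<mu> ! r"
proof
  have anti: "\<mu> ! i' \<le> \<mu> ! i" if "i \<le> i'" "i' < length \<mu>" for i i'
    using assms that by (cases "i = i'") (auto simp: sorted_wrt_iff_nth_less)
  let ?X = "{i. i < length \<mu> \<and> t < \<mu> ! i}"
  show "r < length \<mu> \<and> t < \<mu> ! r" if r: "r < card ?X"
  proof (rule ccontr)
    assume neg: "\<not> ?thesis"
    have "i < r" if "i \<in> ?X" for i
    proof (rule ccontr)
      assume "\<not> i < r"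
      then have "\<mu> ! i \<le> \<mu> ! r" "r < length \<mu>" using that anti[of r i] by auto
      then show False using that neg by auto
    qed
    then have "?X \<subseteq> {..<r}" by auto
    from card_mono[OF _ this] show False using r by simp
  qed
  assume r: "r < length \<mu> \<and> t < \<mu> ! r"
  have "{..r} \<subseteq> ?X"
  proof
    fix i assume "i \<in> {..r}"
    then show "i \<in> ?X" using r anti[of i r] by auto
  qed
  from card_mono[OF _ this] show "r < card ?X" by simp
qed

lemma conj_list:
  assumes g: "g \<in> partitions n"
  shows "conj_list g \<in> partitions n" "first_part (conj_list g) = length g"
    "\<And>i. 1 \<le> i \<Longrightarrow> i \<le> length g \<Longrightarrow> conj_part (conj_list g) i = g ! (i - 1)"
proof -
  have pos: "0 < g ! i" if "i < length g" for i 
  proof -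
    have "g ! i \<noteq> 0" using g nth_mem[OF that] unfolding partitions_def by (metis (mono_tags) mem_Collect_eq)
    then show ?thesis by simp
  qed
  have anti: "g ! i' \<le> g ! i" if "i \<le> i'" "i' < length g" for i i'
    using g that unfolding partitions_def by (cases "i = i'") (auto simp: sorted_wrt_iff_nth_less)
  have le0: "g ! i \<le> first_part g" if "i < length g" for i
    using anti[of 0 i] that by (cases g) (auto simp: first_part_def)
  have hd0: "first_part g = g ! 0" if "g \<noteq> []" using that by (simp add: first_part_def hd_conv_nth)
  show "first_part (conj_list g) = length g"
  proof (cases "g = []")
    case False
    then have h: "0 < first_part g" using hd0 pos by simp
    then have "first_part (conj_list g) = card {i. i < length g \<and> 0 < g ! i}"
      unfolding first_part_def[of "conj_list g"] unfolding conj_list_def by (simp add: hd_map)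
    also have "{i. i < length g \<and> 0 < g ! i} = {..<length g}" using pos by auto
    finally show ?thesis by simp
  qed (simp add: conj_list_def first_part_def)
  show "conj_part (conj_list g) i = g ! (i - 1)" if i: "1 \<le> i" "i \<le> length g" for i
  proof -
    have "i \<le> card {i'. i' < length g \<and> r < g ! i'} \<longleftrightarrow> r < g ! (i - 1)" for r
      using less_card_iff[of g "i - 1" r] g i unfolding partitions_def by auto
    then have "conj_part (conj_list g) i = card {r. r < first_part g \<and> r < g ! (i - 1)}"
      unfolding conj_part_def conj_list_def by (simp cong: conj_cong)
    also have "{r. r < first_part g \<and> r < g ! (i - 1)} = {..<g ! (i - 1)}"
    proof -
      have "g ! (i - 1) \<le> first_part g" using i by (intro le0) simp
      then show ?thesis by auto
    qed
    finally show ?thesis by simp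
  qed
  show "conj_list g \<in> partitions n"
    unfolding partitions_def mem_Collect_eq
  proof (intro conjI)
    have "sum_list (conj_list g) = (\<Sum>r<first_part g. card {i. i < length g \<and> r < g ! i})"
      unfolding conj_list_def by (simp add: interv_sum_list_conv_sum_set_nat atLeast0LessThan)
    also have "\<dots> = (\<Sum>r<first_part g. \<Sum>i<length g. if r < g ! i then 1 else 0)"
    proof (intro sum.cong HOL.refl)
      fix r
      have "{i. i < length g \<and> r < g ! i} = {i \<in> {..<length g}. r < g ! i}" by auto
      then show "card {i. i < length g \<and> r < g ! i} = (\<Sum>i<length g. if r < g ! i then 1 else 0)"
        by (simp add: sum.If_cases Int_def)
    qed
    also have "\<dots> = (\<Sum>i<length g. \<Sum>r<first_part g. if r < g ! i then 1 else 0)" by (rule sum.swap)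
    also have "\<dots> = (\<Sum>i<length g. g ! i)"
    proof (intro sum.cong HOL.refl)
      fix i assume "i \<in> {..<length g}"
      then have "{..<first_part g} \<inter> {r. r < g ! i} = {..<g ! i}" using le0[of i] by auto
      then show "(\<Sum>r<first_part g. if r < g ! i then 1 else 0) = g ! i" by (simp add: sum.If_cases)
    qed
    also have "\<dots> = n" using g by (simp add: partitions_def sum_list_sum_nth atLeast0LessThan)
    finally show "sum_list (conj_list g) = n" .
    show "sorted_wrt (\<ge>) (conj_list g)"
      unfolding conj_list_def sorted_wrt_iff_nth_less by (auto intro!: card_mono)
    show "0 \<notin> set (conj_list g)"
    proof
      assume "0 \<in> set (conj_list g)"
      then obtain r where r: "r < first_part g" "card {i. i < length g \<and> r < g ! i} = 0"
        unfolding conj_list_def by auto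
      then have "g \<noteq> []" by (auto simp: first_part_def)
      then have "0 \<in> {i. i < length g \<and> r < g ! i}" using r(1) hd0 by simp
      then show False using r(2) by auto
    qed
  qed
qed

lemma finite_partitions [simp]: "finite (partitions n)"
proof (rule finite_subset)
  have "length \<mu> \<le> sum_list \<mu>" if "0 \<notin> set \<mu>" for \<mu> :: "nat list" using that by (induction \<mu>) auto
  then show "partitions n \<subseteq> {\<mu>. set \<mu> \<subseteq> {..n} \<and> length \<mu> \<le> n}"
    unfolding partitions_def by (auto intro: member_le_sum_list)
  show "finite {\<mu>. set \<mu> \<subseteq> {..n} \<and> length \<mu> \<le> n}" by (rule finite_lists_length_le) simp
qed

lemma admissible_perm: "admissible \<phi> \<Longrightarrow> mset \<beta> = mset \<beta>' \<Longrightarrow> \<phi> \<beta> = \<phi> \<beta>'"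
  unfolding admissible_def by blast

lemma admissible_zero: "admissible \<phi> \<Longrightarrow> \<phi> (0 # \<beta>) = \<phi> \<beta>"
  unfolding admissible_def by blast

lemma admissible_neg: "admissible \<phi> \<Longrightarrow> \<exists>b\<in>set \<beta>. b < 0 \<Longrightarrow> \<phi> \<beta> = 0"
  unfolding admissible_def by blast

lemma admissible_nonzero:
  assumes "admissible \<phi>"
  shows "\<phi> (filter (\<lambda>b. b \<noteq> 0) \<beta>) = \<phi> \<beta>"
proof -
  have "\<phi> (replicate c 0 @ \<gamma>) = \<phi> \<gamma>" for c \<gamma>
    using assms by (induction c) (simp_all add: admissible_zero)
  moreover have "mset \<beta> = mset (filter (\<lambda>b. b = 0) \<beta> @ filter (\<lambda>b. b \<noteq> 0) \<beta>)" by simp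
  moreover have "filter (\<lambda>b. b = 0) \<beta> = replicate (length (filter (\<lambda>b. b = 0) \<beta>)) 0"
    by (induction \<beta>) auto
  ultimately show ?thesis using admissible_perm[OF assms] by metis
qed

lemma jacobi_trudi_conj_list:
  assumes "g \<in> partitions n" "\<gamma> = map int g"
  shows "jacobi_trudi \<phi> (conj_list g) = (\<Sum>\<pi> | \<pi> permutes {1..length \<gamma>}. sign \<pi> * \<phi> (shifted \<gamma> \<pi>))"
proof -
  have "map (\<lambda>i. int (conj_part (conj_list g) i) + int (\<pi> i) - int i) [1..<Suc (length g)] = shifted \<gamma> \<pi>" for \<pi>
    unfolding shifted_def using conj_list(3)[OF assms(1)] assms(2) by (auto simp: nth_map)
  then show ?thesis unfolding jacobi_trudi_def conj_list(2)[OF assms(1)] using assms(2) by simp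
qed

text \<open>The ceiling for the growing sum of squares, which makes the expansion in
  \<open>jacobi_trudi_spans\<close> terminate.\<close>

lemma sum_list_squares_le:
  "\<forall>b\<in>set \<beta>. 0 \<le> b \<Longrightarrow> sum_list (map (\<lambda>b. b\<^sup>2) \<beta>) \<le> (sum_list \<beta>)\<^sup>2" for \<beta> :: "int list"
proof (induction \<beta>)
  case (Cons b \<beta>)
  have "0 \<le> b * sum_list \<beta>" using Cons.prems by (intro mult_nonneg_nonneg sum_list_nonneg) auto
  then show ?case using Cons by (simp add: power2_sum)
qed simp

text \<open>When the determinant is expanded, every non-identity
  permutation contributes a product whose index vector has a larger sum of squares.\<close>

lemma jacobi_trudi_spans:
  assumes "sum_list \<beta> = int n"
  shows "\<exists>a. \<forall>\<phi>. admissible \<phi> \<longrightarrow> \<phi> \<beta> = (\<Sum>\<mu>\<in>partitions n. a \<mu> * jacobi_trudi \<phi> \<mu>)"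
  using assms
proof (induction "nat ((int n)\<^sup>2 - sum_list (map (\<lambda>b. b\<^sup>2) \<beta>))" arbitrary: \<beta> rule: less_induct)
  case less
  show ?case
  proof (cases "\<exists>b\<in>set \<beta>. b < 0")
    case True
    then show ?thesis by (intro exI[of _ "\<lambda>_. 0"]) (simp add: admissible_neg)
  next
    case False
    \<comment> \<open>An admissible functional sees only the nonzero entries of \<beta> and not
      their order; sorted decreasingly they become the diagonal of a determinant.\<close>
    define g where "g = rev (sort (map nat (filter (\<lambda>b. b \<noteq> 0) \<beta>)))"
    define \<gamma> where "\<gamma> = map int g"
    have eq: "map int (map nat (filter (\<lambda>b. b \<noteq> 0) \<beta>)) = filter (\<lambda>b. b \<noteq> 0) \<beta>"
      using False by (induction \<beta>) auto
    have ms: "mset \<gamma> = mset (filter (\<lambda>b. b \<noteq> 0) \<beta>)"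
      using arg_cong[OF eq, of mset] unfolding \<gamma>_def g_def mset_map mset_rev mset_sort .
    have \<phi>\<beta>: "\<phi> \<gamma> = \<phi> \<beta>" if "admissible \<phi>" for \<phi>
      using admissible_nonzero[OF that, of \<beta>] admissible_perm[OF that ms] by (rule HOL.trans[rotated])
    have "sum_list (map f \<gamma>) = sum_list (map f \<beta>)" if "f 0 = 0" for f :: "int \<Rightarrow> int"
    proof -
      have "sum_list (map f \<gamma>) = sum_list (map f (filter (\<lambda>b. b \<noteq> 0) \<beta>))"
        by (simp only: sum_mset_sum_list[symmetric] mset_map ms)
      also have "\<dots> = sum_list (map f \<beta>)" using that by (induction \<beta>) auto
      finally show ?thesis .
    qed
    from this[of "\<lambda>b. b"] this[of "\<lambda>b. b\<^sup>2"] have s: "sum_list \<gamma> = sum_list \<beta>" 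
      "sum_list (map (\<lambda>b. b\<^sup>2) \<gamma>) = sum_list (map (\<lambda>b. b\<^sup>2) \<beta>)" by simp_all
    have "sum_list \<gamma> = int (sum_list g)" unfolding \<gamma>_def by (induction g) auto
    then have g: "g \<in> partitions n"
      using s less.prems False unfolding partitions_def g_def by (auto simp: sorted_wrt_rev)
    have sorted: "sorted_wrt (\<ge>) \<gamma>" using g unfolding \<gamma>_def partitions_def by (simp add: sorted_wrt_map)
    let ?P = "{\<pi>. \<pi> permutes {1..length \<gamma>}}"
    have fin: "finite ?P" by (rule finite_permutations) simp
    have "\<exists>a. \<forall>\<phi>. admissible \<phi> \<longrightarrow> \<phi> (shifted \<gamma> \<pi>) = (\<Sum>\<mu>\<in>partitions n. a \<mu> * jacobi_trudi \<phi> \<mu>)"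
      if \<pi>: "\<pi> \<in> ?P - {id}" for \<pi>
    proof (cases "\<exists>b\<in>set (shifted \<gamma> \<pi>). b < 0")
      case True
      then show ?thesis by (intro exI[of _ "\<lambda>_. 0"]) (simp add: admissible_neg)
    next
      case False
      have sm: "sum_list (shifted \<gamma> \<pi>) = int n" using sum_list_shifted[of \<pi> \<gamma>] \<pi> s less.prems by simp
      have "sum_list (map (\<lambda>b. b\<^sup>2) (shifted \<gamma> \<pi>)) \<le> (int n)\<^sup>2"
        using sum_list_squares_le[of "shifted \<gamma> \<pi>"] False sm by (auto simp: not_less)
      moreover have "sum_list (map (\<lambda>b. b\<^sup>2) \<beta>) < sum_list (map (\<lambda>b. b\<^sup>2) (shifted \<gamma> \<pi>))"
        using sum_squares_shifted[of \<pi> \<gamma>] \<pi> sorted s by auto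
      ultimately show ?thesis by (intro less.hyps sm) auto
    qed
    then obtain a where a: "admissible \<phi> \<Longrightarrow> \<pi> \<in> ?P - {id} \<Longrightarrow>
        \<phi> (shifted \<gamma> \<pi>) = (\<Sum>\<mu>\<in>partitions n. a \<pi> \<mu> * jacobi_trudi \<phi> \<mu>)" for \<phi> \<pi> by metis
    \<comment> \<open>The expansion of the determinant is solved for its identity term, which is the
      value at \<beta>.\<close>
    define c where "c \<mu> = (if \<mu> = conj_list g then 1 else 0) - (\<Sum>\<pi>\<in>?P - {id}. sign \<pi> * a \<pi> \<mu>)" for \<mu>
    have "\<phi> \<beta> = (\<Sum>\<mu>\<in>partitions n. c \<mu> * jacobi_trudi \<phi> \<mu>)" if \<phi>: "admissible \<phi>" for \<phi>
    proof -
      have sid: "shifted \<gamma> id = \<gamma>"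
        unfolding shifted_def by (rule nth_equalityI) (simp_all add: nth_append del: upt_Suc)
      have "jacobi_trudi \<phi> (conj_list g) = sign (id :: nat \<Rightarrow> nat) * \<phi> (shifted \<gamma> id) + (\<Sum>\<pi>\<in>?P - {id}. sign \<pi> * \<phi> (shifted \<gamma> \<pi>))"
        unfolding jacobi_trudi_conj_list[OF g \<gamma>_def] 
        by (subst sum.remove[OF fin, of id]) (simp_all add: permutes_id)
      also have "\<dots> = \<phi> \<beta> + (\<Sum>\<pi>\<in>?P - {id}. sign \<pi> * (\<Sum>\<mu>\<in>partitions n. a \<pi> \<mu> * jacobi_trudi \<phi> \<mu>))"
        using a[OF \<phi>] \<phi>\<beta>[OF \<phi>] sid by (simp add: sign_id)
      also have "(\<Sum>\<pi>\<in>?P - {id}. sign \<pi> * (\<Sum>\<mu>\<in>partitions n. a \<pi> \<mu> * jacobi_trudi \<phi> \<mu>)) =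
          (\<Sum>\<mu>\<in>partitions n. (\<Sum>\<pi>\<in>?P - {id}. sign \<pi> * a \<pi> \<mu>) * jacobi_trudi \<phi> \<mu>)"
        unfolding sum_distrib_left sum_distrib_right by (subst sum.swap) (simp add: mult.assoc)
      finally have "\<phi> \<beta> = jacobi_trudi \<phi> (conj_list g) -
          (\<Sum>\<mu>\<in>partitions n. (\<Sum>\<pi>\<in>?P - {id}. sign \<pi> * a \<pi> \<mu>) * jacobi_trudi \<phi> \<mu>)" by simp
      also have "jacobi_trudi \<phi> (conj_list g) =
          (\<Sum>\<mu>\<in>partitions n. (if \<mu> = conj_list g then 1 else 0) * jacobi_trudi \<phi> \<mu>)"
        using conj_list(1)[OF g] by (simp add: if_distrib[of "\<lambda>x. x * _"] cong: if_cong)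
      finally show ?thesis unfolding c_def by (simp only: left_diff_distrib sum_subtractf)
    qed
    then show ?thesis by (intro exI[of _ c] allI impI)
  qed
qed

text \<open>What matters is that \<open>a\<close> is chosen before \<phi>: the coefficients do not
  depend on the poset and can be identified over a total order.\<close>

lemma comb_eval_jacobi_trudi:
  assumes "\<And>q \<beta>. (q, \<beta>) \<in> set Q \<Longrightarrow> sum_list \<beta> = int n"
  shows "\<exists>a. \<forall>\<phi>. admissible \<phi> \<longrightarrow> comb_eval Q \<phi> = (\<Sum>\<mu>\<in>partitions n. a \<mu> * jacobi_trudi \<phi> \<mu>)"
  using assms
proof (induction Q)
  case Nil
  then show ?case by (intro exI[of _ "\<lambda>_. 0"]) (simp add: comb_eval_def)
next
  case (Cons x Q)
  obtain q \<beta> where x: "x = (q, \<beta>)" by (cases x)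
  obtain a where a: "\<forall>\<phi>. admissible \<phi> \<longrightarrow> comb_eval Q \<phi> = (\<Sum>\<mu>\<in>partitions n. a \<mu> * jacobi_trudi \<phi> \<mu>)"
    using Cons.IH Cons.prems by auto
  obtain b where b: "\<forall>\<phi>. admissible \<phi> \<longrightarrow> \<phi> \<beta> = (\<Sum>\<mu>\<in>partitions n. b \<mu> * jacobi_trudi \<phi> \<mu>)"
    using jacobi_trudi_spans[of \<beta> n] Cons.prems x by auto
  have "comb_eval (x # Q) \<phi> = (\<Sum>\<mu>\<in>partitions n. (q * b \<mu> + a \<mu>) * jacobi_trudi \<phi> \<mu>)" if "admissible \<phi>" for \<phi>
  proof -
    have "comb_eval (x # Q) \<phi> = q * \<phi> \<beta> + comb_eval Q \<phi>" by (simp add: comb_eval_def x)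
    also have "\<dots> = q * (\<Sum>\<mu>\<in>partitions n. b \<mu> * jacobi_trudi \<phi> \<mu>) + (\<Sum>\<mu>\<in>partitions n. a \<mu> * jacobi_trudi \<phi> \<mu>)"
      using a[rule_format, OF that] b[rule_format, OF that] by metis
    finally show ?thesis by (simp add: sum_distrib_left distrib_right sum.distrib mult.assoc)
  qed
  then show ?case by (intro exI[of _ "\<lambda>\<mu>. q * b \<mu> + a \<mu>"] allI impI)
qed

section \<open>The dual Jacobi--Trudi identity\<close>

text \<open>Ordinary symmetric functions are the case of the totally ordered poset of natural numbers: there
  a block count is the coefficient of a monomial in a product of elementary symmetric functions.\<close>

definition content_words :: "nat list \<Rightarrow> nat list set" where
  "content_words \<nu> = {w. \<forall>i. count (mset w) i = (if i < length \<nu> then \<nu> ! i else 0)}"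

lemma finite_content_words: "finite (content_words \<nu>)"
proof (cases "content_words \<nu> = {}")
  case False
  then obtain w where w: "w \<in> content_words \<nu>" by blast
  have "content_words \<nu> \<subseteq> {u. mset u = mset w}"
    using w unfolding content_words_def by (auto intro: multiset_eqI)
  then show ?thesis using mset_eq_finite finite_subset by blast
qed simp

lemma content_words_less: "w \<in> content_words \<nu> \<Longrightarrow> x \<in> set w \<Longrightarrow> x < length \<nu>"
  unfolding content_words_def mem_Collect_eq by (metis count_mset_0_iff)

lemma hclosed_content_words: "hclosed (content_words \<nu>)"
  unfolding hclosed_def content_words_def mem_Collect_eq using hcong_mset by metis

lemma three_plus_one_free_nat: "three_plus_one_free TYPE(nat)"
  unfolding three_plus_one_free_def incomp_def by auto

lemma admissible_content: "admissible (block_count (content_words \<nu>))"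
  by (intro admissible_block_count three_plus_one_free_nat finite_content_words hclosed_content_words)

definition block_lists :: "int list \<Rightarrow> 'a::order list list set" where
  "block_lists \<beta> = {cs. list_all2 (\<lambda>b c. is_desc c \<and> int (length c) = b) \<beta> cs}"

lemma desc_blocks_iff: "desc_blocks \<beta> w \<longleftrightarrow> (\<exists>cs\<in>block_lists \<beta>. concat cs = w)"
proof (induction \<beta> w rule: desc_blocks.induct)
  case (1 w)
  then show ?case by (auto simp: block_lists_def)
next
  case (2 b \<beta> w)
  show ?case
  proof
    assume L: "desc_blocks (b # \<beta>) w"
    then obtain cs where "cs \<in> block_lists \<beta>" "concat cs = drop (nat b) w" using 2 by auto
    then show "\<exists>cs\<in>block_lists (b # \<beta>). concat cs = w" using L
      by (intro bexI[of _ "take (nat b) w # cs"]) (auto simp: block_lists_def)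
  next
    assume "\<exists>cs\<in>block_lists (b # \<beta>). concat cs = w"
    then obtain c cs where "is_desc c" "int (length c) = b" "cs \<in> block_lists \<beta>" "w = c @ concat cs"
      by (auto simp: block_lists_def list_all2_Cons1)
    then show "desc_blocks (b # \<beta>) w" using 2 by auto
  qed
qed

text \<open>The block lengths are prescribed, so a word determines its blocks. With separate blocks
  a letter can be removed from each of them independently.\<close>

lemma block_count_lists: "block_count X \<beta> = int (card {cs \<in> block_lists \<beta>. concat cs \<in> X})"
proof -
  have "inj_on concat {cs \<in> block_lists \<beta>. concat cs \<in> X}"
  proof (rule inj_onI)
    fix cs ds assume cs: "cs \<in> {cs \<in> block_lists \<beta>. concat cs \<in> X}" and ds: "ds \<in> {cs \<in> block_lists \<beta>. concat cs \<in> X}"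
      and eq: "concat cs = concat ds"
    have l: "length cs = length ds" using cs ds by (simp add: block_lists_def list_all2_conv_all_nth)
    have "length x = length y" if xy: "(x, y) \<in> set (zip cs ds)" for x y
    proof -
      obtain i where "i < length cs" "x = cs ! i" "y = ds ! i" using xy by (auto simp: set_zip)
      moreover have "int (length (cs ! i)) = \<beta> ! i" "int (length (ds ! i)) = \<beta> ! i"
        using cs ds l calculation(1) unfolding block_lists_def mem_Collect_eq list_all2_conv_all_nth by auto
      ultimately show ?thesis by simp
    qed
    then show "cs = ds" using concat_injective[OF eq l] by blast
  qed
  moreover have "{w \<in> X. desc_blocks \<beta> w} = concat ` {cs \<in> block_lists \<beta>. concat cs \<in> X}"
    unfolding desc_blocks_iff by auto
  ultimately show ?thesis unfolding block_count_def by (simp add: card_image)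
qed

lemma finite_block_lists: "finite X \<Longrightarrow> finite {cs \<in> block_lists \<beta>. concat cs \<in> X}"
proof (induction \<beta> arbitrary: X)
  case Nil
  have "{cs \<in> block_lists []. concat cs \<in> X} \<subseteq> {[]}" by (auto simp: block_lists_def)
  then show ?case by (rule finite_subset) simp
next
  case (Cons b \<beta>)
  let ?I = "take (nat b) ` X"
  have "cs \<in> (\<Union>p\<in>?I. (#) p ` {cs \<in> block_lists \<beta>. concat cs \<in> after p X})"
    if cs: "cs \<in> block_lists (b # \<beta>)" "concat cs \<in> X" for cs
  proof -
    obtain c ds where c: "cs = c # ds" "int (length c) = b" "ds \<in> block_lists \<beta>"
      using cs(1) unfolding block_lists_def mem_Collect_eq list_all2_Cons1 by blast
    then have "c = take (nat b) (concat cs)" by auto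
    then have "c \<in> ?I" using cs(2) by blast
    moreover have "cs \<in> (#) c ` {cs \<in> block_lists \<beta>. concat cs \<in> after c X}"
      using c cs(2) by (auto simp: after_def)
    ultimately show ?thesis by blast
  qed
  then have "{cs \<in> block_lists (b # \<beta>). concat cs \<in> X} \<subseteq> (\<Union>p\<in>?I. (#) p ` {cs \<in> block_lists \<beta>. concat cs \<in> after p X})"
    by blast
  moreover have "finite (\<Union>p\<in>?I. (#) p ` {cs \<in> block_lists \<beta>. concat cs \<in> after p X})"
    by (intro finite_UN_I finite_imageI Cons finite_after)
  ultimately show ?case by (rule finite_subset)
qed

lemma count_concat: "count (mset (concat cs)) x = (\<Sum>i<length cs. count (mset (cs ! i)) x)"
proof -
  have "count (mset (concat cs)) x = sum_list (map (\<lambda>c. count (mset c) x) cs)" by (induction cs) auto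
  then show ?thesis by (simp add: sum_list_sum_nth atLeast0LessThan)
qed

lemma desc_max_head:
  assumes "is_desc (c :: nat list)" "\<And>x. x \<in> set c \<Longrightarrow> x \<le> N" "N \<in> set c"
  shows "c = N # filter (\<lambda>x. x \<noteq> N) c"
proof (cases c)
  case (Cons x u)
  then have "x = N" using assms by force
  moreover have "N \<notin> set u" using assms(1) Cons \<open>x = N\<close> by auto
  then have "filter (\<lambda>x. x \<noteq> N) u = u" by (intro filter_True) auto
  ultimately show ?thesis using Cons by simp
qed (use assms in auto)

lemma is_desc_filter: "is_desc c \<Longrightarrow> is_desc (filter P c)"
  by (rule sorted_wrt_filter)

text \<open>Removing the largest letter from all blocks containing it is the expansion
  \<open>e\<^sub>k(x\<^sub>1, \<dots>, x\<^sub>N) = e\<^sub>k(x\<^sub>1, \<dots>, x\<^sub>N\<^sub>-\<^sub>1) + x\<^sub>N e\<^sub>k\<^sub>-\<^sub>1(x\<^sub>1, \<dots>, x\<^sub>N\<^sub>-\<^sub>1)\<close>.\<close>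

lemma block_count_content_snoc:
  "block_count (content_words (\<nu> @ [v])) (map b [1..<Suc j]) =
    (\<Sum>S | S \<subseteq> {1..j} \<and> card S = v. block_count (content_words \<nu>) (map (\<lambda>i. b i - of_bool (i \<in> S)) [1..<Suc j]))"
proof -
  define N where "N = length \<nu>"
  let ?P = "{S. S \<subseteq> {1..j} \<and> card S = v}"
  let ?B = "\<lambda>S. {cs \<in> block_lists (map (\<lambda>i. b i - of_bool (i \<in> S)) [1..<Suc j]). concat cs \<in> content_words \<nu>}"
  let ?A = "{cs \<in> block_lists (map b [1..<Suc j]). concat cs \<in> content_words (\<nu> @ [v])}"
  \<comment> \<open>\<open>S\<close> records which blocks contain the largest letter
    \<open>N\<close>; blocks decrease, so \<open>N\<close> can only be their head.\<close>
  define f where "f = (\<lambda>(S, cs). map (\<lambda>i. if Suc i \<in> S then N # cs ! i else cs ! i) [0..<j])"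
  define g where "g cs = ({i \<in> {1..j}. N \<in> set (cs ! (i - 1))}, map (filter (\<lambda>x. x \<noteq> N)) cs)" for cs :: "nat list list"
  have bl: "cs \<in> block_lists (map \<beta> [1..<Suc j]) \<longleftrightarrow>
      length cs = j \<and> (\<forall>i<j. is_desc (cs ! i) \<and> int (length (cs ! i)) = \<beta> (Suc i))" for cs :: "nat list list" and \<beta>
  proof -
    have "length (map \<beta> [1..<Suc j]) = j" "\<And>i. i < j \<Longrightarrow> map \<beta> [1..<Suc j] ! i = \<beta> (Suc i)"
      by (simp_all del: upt_Suc)
    then show ?thesis unfolding block_lists_def mem_Collect_eq list_all2_conv_all_nth by metis
  qed
  have bound: "x < length \<nu>'" if "cs \<in> block_lists (map \<beta> [1..<Suc j])" "concat cs \<in> content_words \<nu>'"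
      "i < j" "x \<in> set (cs ! i)" for cs \<beta> \<nu>' i x
  proof -
    have "cs ! i \<in> set cs" using that(1,3) unfolding bl by auto
    then have "x \<in> set (concat cs)" using that(4) unfolding set_concat by blast
    then show ?thesis by (rule content_words_less[OF that(2)])
  qed
  have Bless: "x < N" if "cs \<in> ?B S" "i < j" "x \<in> set (cs ! i)" for cs S i x
    using bound[OF _ _ that(2,3)] that(1) unfolding N_def by blast
  have Ale: "x \<le> N" if "cs \<in> ?A" "i < j" "x \<in> set (cs ! i)" for cs i x
  proof -
    have "x < length (\<nu> @ [v])" using bound[OF _ _ that(2,3)] that(1) by blast
    then show ?thesis by (simp add: N_def)
  qed
  have "bij_betw f (SIGMA S:?P. ?B S) ?A"
  proof (rule bij_betw_byWitness[where f' = g])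
    show "\<forall>x\<in>SIGMA S:?P. ?B S. g (f x) = x"
    proof
      fix x assume "x \<in> (SIGMA S:?P. ?B S)"
      then obtain S cs where x: "x = (S, cs)" "S \<subseteq> {1..j}" "cs \<in> ?B S" by auto
      have l: "length cs = j" using x(3) unfolding bl by simp
      have N: "N \<notin> set (cs ! i)" if "i < j" for i using Bless[OF x(3) that] by blast
      have "map (filter (\<lambda>x. x \<noteq> N)) (f x) = cs"
      proof (rule nth_equalityI)
        fix i assume "i < length (map (filter (\<lambda>x. x \<noteq> N)) (f x))"
        then have i: "i < j" by (simp add: f_def x(1))
        then have "filter (\<lambda>x. x \<noteq> N) (cs ! i) = cs ! i" using N by (intro filter_True) auto
        then show "map (filter (\<lambda>x. x \<noteq> N)) (f x) ! i = cs ! i" using i by (simp add: f_def x(1))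
      qed (simp add: f_def x(1) l)
      moreover have "{i \<in> {1..j}. N \<in> set (f x ! (i - 1))} = S"
      proof -
        have "N \<in> set (f x ! (i - 1)) \<longleftrightarrow> i \<in> S" if "i \<in> {1..j}" for i
          using that N[of "i - 1"] by (cases i) (auto simp: f_def x(1) split: if_splits)
        then show ?thesis using x(2) by auto
      qed
      ultimately show "g (f x) = x" unfolding g_def x(1) by simp
    qed
    show "\<forall>cs\<in>?A. f (g cs) = cs"
    proof
      fix cs assume A: "cs \<in> ?A"
      have l: "length cs = j" using A unfolding bl by simp
      show "f (g cs) = cs"
      proof (rule nth_equalityI)
        fix i assume "i < length (f (g cs))"
        then have i: "i < j" by (simp add: f_def g_def)
        have d: "is_desc (cs ! i)" using A i unfolding bl by simp
        show "f (g cs) ! i = cs ! i"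
        proof (cases "N \<in> set (cs ! i)")
          case True
          then show ?thesis using i l desc_max_head[OF d Ale[OF A i] True] by (simp add: f_def g_def)
        next
          case False
          then show ?thesis using i l by (auto simp: f_def g_def intro!: filter_True)
        qed
      qed (simp add: f_def g_def l)
    qed
    show "f ` (SIGMA S:?P. ?B S) \<subseteq> ?A"
    proof
      fix ds assume "ds \<in> f ` (SIGMA S:?P. ?B S)"
      then obtain S cs where x: "ds = f (S, cs)" "S \<subseteq> {1..j}" "card S = v" "cs \<in> ?B S" by auto
      have l: "length cs = j" "length ds = j" using x(1,4) unfolding bl f_def by auto
      have ds: "ds ! i = (if Suc i \<in> S then N # cs ! i else cs ! i)" if "i < j" for i
        using that x(1) by (simp add: f_def)
      have 1: "ds \<in> block_lists (map b [1..<Suc j])"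
        unfolding bl using x(4)[unfolded mem_Collect_eq bl] l ds Bless[OF x(4)] by auto
      have "count (mset (concat ds)) x = (if x = N then v else 0) + count (mset (concat cs)) x" for x
      proof -
        have "count (mset (concat ds)) x = (\<Sum>i<j. (if Suc i \<in> S \<and> x = N then 1 else 0) + count (mset (cs ! i)) x)"
          unfolding count_concat l by (intro sum.cong) (auto simp: ds)
        also have "\<dots> = (\<Sum>i<j. if Suc i \<in> S \<and> x = N then 1 else 0) + count (mset (concat cs)) x"
          unfolding count_concat l by (simp add: sum.distrib)
        also have "(\<Sum>i<j. if Suc i \<in> S \<and> x = N then 1 else 0 :: nat) = (if x = N then v else 0)"
        proof (cases "x = N")
          case True
          have "(\<Sum>i<j. if Suc i \<in> S then 1 else 0 :: nat) = card ({..<j} \<inter> {i. Suc i \<in> S})"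
            by (simp add: sum.If_cases)
          also have "\<dots> = card S"
          proof (rule bij_betw_same_card[of Suc], rule bij_betw_byWitness[of _ "\<lambda>i. i - 1"])
            have S: "1 \<le> i \<and> i \<le> j" if "i \<in> S" for i using x(2) that by auto
            show "\<forall>i\<in>S. Suc (i - 1) = i" using S by fastforce
            show "(\<lambda>i. i - 1) ` S \<subseteq> {..<j} \<inter> {i. Suc i \<in> S}" using S by fastforce
          qed auto
          finally show ?thesis using True x(3) by simp
        qed simp
        finally show ?thesis .
      qed
      then have "concat ds \<in> content_words (\<nu> @ [v])"
        using x(4) unfolding content_words_def N_def by (auto simp: nth_append)
      then show "ds \<in> ?A" using 1 by simp
    qed
    show "g ` ?A \<subseteq> (SIGMA S:?P. ?B S)"
    proof
      fix x assume "x \<in> g ` ?A"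
      then obtain cs where x: "x = g cs" and A: "cs \<in> ?A" by auto
      have l: "length cs = j" using A unfolding bl by simp
      define S where "S = {i \<in> {1..j}. N \<in> set (cs ! (i - 1))}"
      let ?ds = "map (filter (\<lambda>x. x \<noteq> N)) cs"
      have cs: "is_desc (cs ! i)" "int (length (cs ! i)) = b (Suc i)" if "i < j" for i using A that unfolding bl by auto
      have cnt: "count (mset (cs ! i)) N = (if N \<in> set (cs ! i) then 1 else 0)" if "i < j" for i
        using is_desc_distinct[OF cs(1)[OF that]] by (simp add: distinct_count_atmost_1)
      have len: "int (length (filter (\<lambda>x. x \<noteq> N) (cs ! i))) = b (Suc i) - of_bool (Suc i \<in> S)" if "i < j" for i
      proof (cases "N \<in> set (cs ! i)")
        case True
        then have "length (cs ! i) = Suc (length (filter (\<lambda>x. x \<noteq> N) (cs ! i)))"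
          using desc_max_head[OF cs(1)[OF that] Ale[OF A that]] by (metis length_Cons)
        then show ?thesis using cs(2)[OF that] True that by (simp add: S_def)
      next
        case False
        then have "filter (\<lambda>x. x \<noteq> N) (cs ! i) = cs ! i" by (auto intro!: filter_True)
        then show ?thesis using cs(2)[OF that] False by (simp add: S_def)
      qed
      have "?ds \<in> block_lists (map (\<lambda>i. b i - of_bool (i \<in> S)) [1..<Suc j])"
        unfolding bl using l len cs(1) by (auto intro: is_desc_filter)
      moreover have "concat ?ds \<in> content_words \<nu>"
      proof -
        have "concat ?ds = filter (\<lambda>x. x \<noteq> N) (concat cs)" by (simp add: filter_concat)
        then show ?thesis using A unfolding content_words_def N_def by (auto simp: nth_append)
      qed
      moreover have "card S = v"
      proof -
        have "v = count (mset (concat cs)) N" using A unfolding content_words_def N_def by simp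
        also have "\<dots> = (\<Sum>i<j. if N \<in> set (cs ! i) then 1 else 0)"
          unfolding count_concat l by (intro sum.cong) (auto simp: cnt)
        also have "\<dots> = card ({..<j} \<inter> {i. N \<in> set (cs ! i)})" by (simp add: sum.If_cases)
        also have "\<dots> = card S"
          unfolding S_def by (rule bij_betw_same_card[of Suc], rule bij_betw_byWitness[of _ "\<lambda>i. i - 1"]) auto
        finally show ?thesis by simp
      qed
      ultimately show "x \<in> (SIGMA S:?P. ?B S)" unfolding x g_def S_def by auto
    qed
  qed
  then have "card (SIGMA S:?P. ?B S) = card ?A" by (rule bij_betw_same_card)
  moreover have "card (SIGMA S:?P. ?B S) = (\<Sum>S\<in>?P. card (?B S))"
    by (intro card_SigmaI) (auto simp: finite_block_lists finite_content_words)
  ultimately show ?thesis unfolding block_count_lists by simp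
qed

text \<open>The determinant for arbitrary integers \<gamma> in place of column heights, since
  removing the largest letter leads outside the partitions.\<close>

definition jt_det :: "(int list \<Rightarrow> int) \<Rightarrow> nat \<Rightarrow> (nat \<Rightarrow> int) \<Rightarrow> int" where
  "jt_det \<phi> j \<gamma> = (\<Sum>\<pi> | \<pi> permutes {1..j}. sign \<pi> * \<phi> (map (\<lambda>i. \<gamma> i + int (\<pi> i) - int i) [1..<Suc j]))"

text \<open>The subtracted indicator depends on the row \<open>i\<close> but not on the column
  \<open>\<pi> i\<close>, so the sum over \<open>S\<close> passes through the determinant.\<close>

lemma jt_det_content_snoc:
  "jt_det (block_count (content_words (\<nu> @ [v]))) j \<gamma> =
    (\<Sum>S | S \<subseteq> {1..j} \<and> card S = v. jt_det (block_count (content_words \<nu>)) j (\<lambda>i. \<gamma> i - of_bool (i \<in> S)))"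
proof -
  have eq: "map (\<lambda>i. \<gamma> i + int (\<pi> i) - int i - of_bool (i \<in> S)) xs =
    map (\<lambda>i. \<gamma> i - of_bool (i \<in> S) + int (\<pi> i) - int i) xs" for \<pi> S xs by simp
  show ?thesis
    unfolding jt_det_def block_count_content_snoc eq sum_distrib_left by (rule sum.swap)
qed

text \<open>The index in row \<open>i\<close> and column \<open>p\<close> is
  \<open>\<gamma> i + p - i\<close>, so the hypothesis makes rows \<open>c\<close> and
  \<open>c + 1\<close> equal. Composition with their transposition changes the sign of a term but
  not its value under \<phi>.\<close>

lemma jt_det_repeated:
  assumes \<phi>: "admissible \<phi>" and c: "1 \<le> c" "c < j" and eq: "\<gamma> (Suc c) = \<gamma> c + 1"
  shows "jt_det \<phi> j \<gamma> = 0"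
proof -
  let ?t = "transpose c (Suc c)"
  let ?F = "\<lambda>\<pi> i. \<gamma> i + int (\<pi> i) - int i"
  have t: "?t permutes {1..j}" using c by (intro permutes_swap_id) auto
  have "jt_det \<phi> j \<gamma> = (\<Sum>\<pi> | \<pi> permutes {1..j}. sign (\<pi> \<circ> ?t) * \<phi> (map (?F (\<pi> \<circ> ?t)) [1..<Suc j]))"
    unfolding jt_det_def by (rule sum_permutations_compose_right[OF t])
  also have "\<dots> = (\<Sum>\<pi> | \<pi> permutes {1..j}. - (sign \<pi> * \<phi> (map (?F \<pi>) [1..<Suc j])))"
  proof (rule sum.cong)
    fix \<pi> assume "\<pi> \<in> {\<pi>. \<pi> permutes {1..j}}"
    then have p: "permutation \<pi>" "permutation ?t" using permutes_imp_permutation[of "{1..j}"] t by auto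
    have "?F (\<pi> \<circ> ?t) = ?F \<pi> \<circ> ?t" using eq by (auto simp: transpose_def)
    then have "mset (map (?F (\<pi> \<circ> ?t)) [1..<Suc j]) = image_mset (?F \<pi>) (image_mset ?t (mset_set {1..j}))"
      by (simp only: multiset.map_comp mset_map mset_upt atLeastLessThanSuc_atLeastAtMost)
    also have "\<dots> = mset (map (?F \<pi>) [1..<Suc j])"
      by (simp only: permutes_image_mset[OF t] mset_map mset_upt atLeastLessThanSuc_atLeastAtMost)
    finally have "\<phi> (map (?F (\<pi> \<circ> ?t)) [1..<Suc j]) = \<phi> (map (?F \<pi>) [1..<Suc j])" by (rule admissible_perm[OF \<phi>])
    then show "sign (\<pi> \<circ> ?t) * \<phi> (map (?F (\<pi> \<circ> ?t)) [1..<Suc j]) = - (sign \<pi> * \<phi> (map (?F \<pi>) [1..<Suc j]))"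
      by (simp only: sign_compose[OF p] sign_swap_id) simp
  qed simp
  also have "\<dots> = - jt_det \<phi> j \<gamma>" unfolding jt_det_def by (rule sum_negf)
  finally show ?thesis by simp
qed

text \<open>The last row has the indices \<open>\<gamma> j + p - j\<close> with
  \<open>p \<le> j\<close>, all negative.\<close>

lemma jt_det_negative:
  assumes \<phi>: "admissible \<phi>" and j: "1 \<le> j" "\<gamma> j < 0"
  shows "jt_det \<phi> j \<gamma> = 0"
  unfolding jt_det_def
proof (intro sum.neutral ballI)
  fix \<pi> assume "\<pi> \<in> {\<pi>. \<pi> permutes {1..j}}"
  then have "\<pi> j \<le> j" using j permutes_in_image[of \<pi> "{1..j}" j] by auto
  then have "\<exists>b\<in>set (map (\<lambda>i. \<gamma> i + int (\<pi> i) - int i) [1..<Suc j]). b < 0"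
    using j by (intro bexI[of _ "\<gamma> j + int (\<pi> j) - int j"]) auto
  then show "sign \<pi> * \<phi> (map (\<lambda>i. \<gamma> i + int (\<pi> i) - int i) [1..<Suc j]) = 0"
    by (simp only: admissible_neg[OF \<phi>] mult_zero_right)
qed

section \<open>Semistandard tableaux on shapes given by column heights\<close>

definition ssyt_on :: "(nat \<times> nat) set \<Rightarrow> nat list \<Rightarrow> (nat \<times> nat \<Rightarrow> nat) \<Rightarrow> bool" where
  "ssyt_on D \<nu> T \<longleftrightarrow>
     (\<forall>x. x \<notin> D \<longrightarrow> T x = 0) \<and>
     (\<forall>x \<in> D. 1 \<le> T x \<and> T x \<le> length \<nu>) \<and>
     (\<forall>r c. (r, c) \<in> D \<and> (r, Suc c) \<in> D \<longrightarrow> T (r, c) \<le> T (r, Suc c)) \<and>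
     (\<forall>r c. (r, c) \<in> D \<and> (Suc r, c) \<in> D \<longrightarrow> T (r, c) < T (Suc r, c)) \<and>
     (\<forall>i < length \<nu>. card {x \<in> D. T x = Suc i} = \<nu> ! i)"

definition columns :: "nat \<Rightarrow> (nat \<Rightarrow> nat) \<Rightarrow> (nat \<times> nat) set" where
  "columns j h = {(r, c). c < j \<and> r < h (Suc c)}"

lemma is_ssyt_iff: "is_ssyt lam \<nu> T \<longleftrightarrow> ssyt_on (diagram lam) \<nu> T"
  unfolding is_ssyt_def ssyt_on_def ..

lemma finite_columns: "finite (columns j h)"
proof -
  have "columns j h = (\<Union>c\<in>{..<j}. (\<lambda>r. (r, c)) ` {..<h (Suc c)})" by (auto simp: columns_def)
  then show ?thesis by simp
qed

lemma finite_ssyt_on: "finite D \<Longrightarrow> finite {T. ssyt_on D \<nu> T}"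
  by (rule finite_subset[OF _ finite_set_of_finite_funs[of D "{..length \<nu>}" 0]]) (auto simp: ssyt_on_def)

lemma ssyt_on_less: "ssyt_on D \<nu> T \<Longrightarrow> T x < Suc (length \<nu>)"
  unfolding ssyt_on_def by (metis le_imp_less_Suc zero_less_Suc)

lemma ssyt_on_outside: "ssyt_on D \<nu> T \<Longrightarrow> x \<notin> D \<Longrightarrow> T x = 0"
  unfolding ssyt_on_def by blast

lemma ssyt_on_ge_1: "ssyt_on D \<nu> T \<Longrightarrow> x \<in> D \<Longrightarrow> 1 \<le> T x"
  unfolding ssyt_on_def by blast

text \<open>\<open>S\<close> is a set of columns that lose their bottom cell. The conditions say
  that each has a cell to lose, so that the subtraction is not truncated, and that the remaining
  heights decrease weakly: the lost cells form a horizontal strip.\<close>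

definition strip_ok :: "nat \<Rightarrow> (nat \<Rightarrow> nat) \<Rightarrow> nat set \<Rightarrow> bool" where
  "strip_ok j h S \<longleftrightarrow> (\<forall>i\<in>{1..j}. i \<in> S \<longrightarrow> 0 < h i) \<and>
     (\<forall>i. 1 \<le> i \<and> i < j \<longrightarrow> h (Suc i) - of_bool (Suc i \<in> S) \<le> h i - of_bool (i \<in> S))"

text \<open>The largest entry occurs at most once in a column, at its bottom, and its cells form a
  horizontal strip. This is the recursion of \<open>jt_det_content_snoc\<close>, restricted to those
  \<open>S\<close> that leave a diagram.\<close>

lemma card_ssyt_snoc:
  assumes h: "\<And>i. 1 \<le> i \<Longrightarrow> i < j \<Longrightarrow> h (Suc i) \<le> h i"
  shows "card {T. ssyt_on (columns j h) (\<nu> @ [v]) T} =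
    (\<Sum>S | (S \<subseteq> {1..j} \<and> card S = v) \<and> strip_ok j h S.
       card {T. ssyt_on (columns j (\<lambda>i. h i - of_bool (i \<in> S))) \<nu> T})"
proof -
  define N where "N = Suc (length \<nu>)"
  let ?D = "columns j h"
  let ?D' = "\<lambda>S. columns j (\<lambda>i. h i - of_bool (i \<in> S))"
  let ?P = "{S. (S \<subseteq> {1..j} \<and> card S = v) \<and> strip_ok j h S}"
  let ?B = "\<lambda>S. {T. ssyt_on (?D' S) \<nu> T}"
  let ?A = "{T. ssyt_on ?D (\<nu> @ [v]) T}"
  define bot where "bot S = (\<lambda>i. (h i - 1, i - 1)) ` S" for S
  define f where "f = (\<lambda>(S, T) x. if x \<in> bot S then N else T x)"
  define g where "g T = ({i \<in> {1..j}. 0 < h i \<and> T (h i - 1, i - 1) = N}, \<lambda>x. if T x = N then 0 else T x)"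
    for T :: "nat \<times> nat \<Rightarrow> nat"
  have bot_iff: "(r, c) \<in> bot S \<longleftrightarrow> Suc c \<in> S \<and> r = h (Suc c) - 1" if "S \<subseteq> {1..j}" for r c S
  proof
    assume "(r, c) \<in> bot S"
    then obtain i where i: "i \<in> S" "r = h i - 1" "c = i - 1" by (auto simp: bot_def)
    have "i \<noteq> 0" using i(1) that by auto
    then have "i = Suc c" using i(3) by linarith
    then show "Suc c \<in> S \<and> r = h (Suc c) - 1" using i(1,2) by blast
  next
    assume "Suc c \<in> S \<and> r = h (Suc c) - 1"
    then show "(r, c) \<in> bot S" unfolding bot_def by (intro image_eqI[of _ _ "Suc c"]) auto
  qed
  have D_iff: "(r, c) \<in> ?D \<longleftrightarrow> c < j \<and> r < h (Suc c)" for r c by (simp add: columns_def)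
  have D'_iff: "x \<in> ?D' S \<longleftrightarrow> x \<in> ?D \<and> x \<notin> bot S" if "S \<subseteq> {1..j}" for x S
    using bot_iff[OF that, of "fst x" "snd x"] by (cases x) (auto simp: columns_def)
  have bot_D: "bot S \<subseteq> ?D" if "S \<in> ?P" for S
  proof
    fix x assume "x \<in> bot S"
    then obtain i where "i \<in> S" "x = (h i - 1, i - 1)" by (auto simp: bot_def)
    moreover from this have "0 < h i" "1 \<le> i" "i \<le> j" using that unfolding strip_ok_def by auto
    ultimately show "x \<in> ?D" by (auto simp: columns_def)
  qed
  have card_bot: "card (bot S) = card S" if "S \<subseteq> {1..j}" for S
    unfolding bot_def
  proof (intro card_image inj_onI)
    fix i i' assume "i \<in> S" "i' \<in> S" and eq: "(h i - 1, i - 1) = (h i' - 1, i' - 1)"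
    then have "1 \<le> i" "1 \<le> i'" using that by auto
    then show "i = i'" using eq by (simp only: prod.inject) linarith
  qed
  have A: "T x = 0 \<longleftrightarrow> x \<notin> ?D" "T x \<le> N"
    "x \<in> ?D \<Longrightarrow> T x = N \<Longrightarrow> fst x = h (Suc (snd x)) - 1" if "T \<in> ?A" for T x
  proof -
    have *: "\<forall>x. x \<notin> ?D \<longrightarrow> T x = 0" "\<forall>x\<in>?D. 1 \<le> T x \<and> T x \<le> N"
      "\<forall>r c. (r, c) \<in> ?D \<and> (Suc r, c) \<in> ?D \<longrightarrow> T (r, c) < T (Suc r, c)"
      using that unfolding ssyt_on_def N_def by auto
    show "T x = 0 \<longleftrightarrow> x \<notin> ?D" using * by (metis not_one_le_zero)
    show "T x \<le> N" using *(1,2) le0 by metis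
    assume x: "x \<in> ?D" "T x = N"
    obtain r c where rc: "x = (r, c)" by (cases x)
    show "fst x = h (Suc (snd x)) - 1"
    proof (rule ccontr)
      assume "\<not> ?thesis"
      then have "(Suc r, c) \<in> ?D" using x(1) rc by (auto simp: D_iff)
      then show False using *(2,3) x rc by fastforce
    qed
  qed
  have gA: "fst (g T) \<in> ?P" "bot (fst (g T)) = {x. T x = N}" if T: "T \<in> ?A" for T
  proof -
    let ?S = "fst (g T)"
    have S: "?S \<subseteq> {1..j}" "i \<in> ?S \<longleftrightarrow> 1 \<le> i \<and> i \<le> j \<and> 0 < h i \<and> T (h i - 1, i - 1) = N" for i
      by (auto simp: g_def)
    show bot: "bot ?S = {x. T x = N}"
    proof (intro set_eqI)
      fix x :: "nat \<times> nat" obtain r c where rc: "x = (r, c)" by (cases x)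
      have "x \<in> bot ?S \<longleftrightarrow> c < j \<and> 0 < h (Suc c) \<and> T (h (Suc c) - 1, c) = N \<and> r = h (Suc c) - 1"
        unfolding rc bot_iff[OF S(1)] S(2) by auto
      also have "\<dots> \<longleftrightarrow> T x = N"
      proof
        assume "T x = N"
        then have "x \<in> ?D" using A(1)[OF T, of x] by (auto simp: N_def)
        then show "c < j \<and> 0 < h (Suc c) \<and> T (h (Suc c) - 1, c) = N \<and> r = h (Suc c) - 1"
          using A(3)[OF T \<open>x \<in> ?D\<close> \<open>T x = N\<close>] \<open>T x = N\<close> rc by (auto simp: D_iff)
      qed (use rc in auto)
      finally show "x \<in> bot ?S \<longleftrightarrow> x \<in> {x. T x = N}" by simp
    qed
    have "v = card {x \<in> ?D. T x = N}" using T unfolding ssyt_on_def N_def by auto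
    also have "{x \<in> ?D. T x = N} = bot ?S" unfolding bot using A(1)[OF T] by (metis N_def nat.distinct(1))
    finally have "card ?S = v" using card_bot[OF S(1)] by simp
    moreover have "strip_ok j h ?S"
      unfolding strip_ok_def
    proof (intro conjI ballI impI allI)
      fix i assume "i \<in> ?S"
      then show "0 < h i" using S(2) by simp
    next
      fix i assume i: "1 \<le> i \<and> i < j"
      show "h (Suc i) - of_bool (Suc i \<in> ?S) \<le> h i - of_bool (i \<in> ?S)"
      \<comment> \<open>The inequality is at risk only if column \<open>i\<close> loses a cell and
        the next column is equally tall. Then the entry to the right of that \<open>N\<close> is
        also \<open>N\<close>, so the next column loses a cell too.\<close>
      proof (cases "i \<in> ?S \<and> h (Suc i) = h i")
        case True
        then have e: "T (h i - 1, i - 1) = N" "0 < h i" using S(2) by auto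
        have "(h i - 1, i - 1) \<in> ?D" "(h i - 1, Suc (i - 1)) \<in> ?D" using i True e(2) by (auto simp: D_iff)
        then have "T (h i - 1, i - 1) \<le> T (h i - 1, Suc (i - 1))" using T unfolding ssyt_on_def by blast
        then have "T (h i - 1, i) = N" using e A(2)[OF T, of "(h i - 1, i)"] i by simp
        then have "Suc i \<in> ?S" unfolding S(2) using i True e by simp
        then show ?thesis using True by simp
      next
        case False
        then show ?thesis using h[of i] i by auto
      qed
    qed
    ultimately show "?S \<in> ?P" using S(1) by simp
  qed
  have "bij_betw f (SIGMA S:?P. ?B S) ?A"
  proof (rule bij_betw_byWitness[where f' = g])
    show "\<forall>y\<in>SIGMA S:?P. ?B S. g (f y) = y"
    proof
      fix y assume "y \<in> (SIGMA S:?P. ?B S)"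
      then obtain S T where y: "y = (S, T)" "S \<in> ?P" "ssyt_on (?D' S) \<nu> T" by auto
      have S: "S \<subseteq> {1..j}" "\<And>i. i \<in> S \<Longrightarrow> 0 < h i" using y(2) unfolding strip_ok_def by auto
      have TN: "T x \<noteq> N" for x using ssyt_on_less[OF y(3), of x] by (simp add: N_def)
      have Tb: "T x = 0" if "x \<in> bot S" for x using ssyt_on_outside[OF y(3), of x] D'_iff[OF S(1), of x] that by blast
      have fN: "f y x = N \<longleftrightarrow> x \<in> bot S" for x using TN by (simp add: f_def y(1))
      have "(\<lambda>x. if f y x = N then 0 else f y x) = T" unfolding fN using Tb by (auto simp: f_def y(1))
      moreover have "i \<in> {1..j} \<and> 0 < h i \<and> f y (h i - 1, i - 1) = N \<longleftrightarrow> i \<in> S" for i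
        unfolding fN bot_iff[OF S(1)] using S by auto
      ultimately show "g (f y) = y" unfolding g_def y(1)[symmetric] by (simp add: y(1))
    qed
    show "\<forall>T\<in>?A. f (g T) = T"
    proof
      fix T assume T: "T \<in> ?A"
      have "f (g T) x = (if x \<in> bot (fst (g T)) then N else if T x = N then 0 else T x)" for x
        by (simp add: f_def g_def)
      then show "f (g T) = T" unfolding gA(2)[OF T] by auto
    qed
    show "f ` (SIGMA S:?P. ?B S) \<subseteq> ?A"
    proof
      fix U assume "U \<in> f ` (SIGMA S:?P. ?B S)"
      then obtain S T where U: "U = f (S, T)" "S \<in> ?P" "ssyt_on (?D' S) \<nu> T" by auto
      have S: "S \<subseteq> {1..j}" "card S = v" "strip_ok j h S" using U(2) by auto
      have Ux: "U x = (if x \<in> bot S then N else T x)" for x by (simp add: U(1) f_def)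
      have Tlt: "T x < N" for x using ssyt_on_less[OF U(3), of x] by (simp add: N_def)
      have T1: "1 \<le> T x" if "x \<in> ?D" "x \<notin> bot S" for x
        using ssyt_on_ge_1[OF U(3), of x] D'_iff[OF S(1), of x] that by blast
      have row: "U (r, c) \<le> U (r, Suc c)" if rc: "(r, c) \<in> ?D" "(r, Suc c) \<in> ?D" for r c
      proof (cases "(r, c) \<in> bot S")
        case True
        then have b: "Suc c \<in> S" "r = h (Suc c) - 1" using bot_iff[OF S(1)] by auto
        have "Suc c < j" "r < h (Suc (Suc c))" using rc by (auto simp: D_iff)
        then have eq: "h (Suc (Suc c)) = h (Suc c)" using h[of "Suc c"] b by simp
        have "h (Suc (Suc c)) - of_bool (Suc (Suc c) \<in> S) \<le> h (Suc c) - of_bool (Suc c \<in> S)"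
          using S(3) \<open>Suc c < j\<close> unfolding strip_ok_def by simp
        then have "Suc (Suc c) \<in> S" using eq b \<open>r < h (Suc (Suc c))\<close> by (cases "Suc (Suc c) \<in> S") auto
        then have "(r, Suc c) \<in> bot S" using bot_iff[OF S(1)] b eq by simp
        then show ?thesis by (simp add: Ux True)
      next
        case False
        show ?thesis
        proof (cases "(r, Suc c) \<in> bot S")
          case True
          then show ?thesis using Tlt[of "(r, c)"] False by (simp add: Ux)
        next
          case F2: False
          then have "(r, c) \<in> ?D' S" "(r, Suc c) \<in> ?D' S" using False rc D'_iff[OF S(1)] by blast+
          then show ?thesis using U(3) False F2 unfolding ssyt_on_def Ux by simp
        qed
      qed
      have col: "U (r, c) < U (Suc r, c)" if rc: "(r, c) \<in> ?D" "(Suc r, c) \<in> ?D" for r c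
      proof -
        have nb: "(r, c) \<notin> bot S" using rc bot_iff[OF S(1)] by (auto simp: D_iff)
        show ?thesis
        proof (cases "(Suc r, c) \<in> bot S")
          case True
          then show ?thesis using Tlt[of "(r, c)"] nb by (simp add: Ux)
        next
          case F2: False
          then have "(r, c) \<in> ?D' S" "(Suc r, c) \<in> ?D' S" using nb rc D'_iff[OF S(1)] by blast+
          then show ?thesis using U(3) nb F2 unfolding ssyt_on_def Ux by simp
        qed
      qed
      have cont: "card {x \<in> ?D. U x = Suc i} = (\<nu> @ [v]) ! i" if "i < length (\<nu> @ [v])" for i
      proof (cases "i < length \<nu>")
        case True
        then have "{x \<in> ?D. U x = Suc i} = {x \<in> ?D' S. T x = Suc i}"
          using D'_iff[OF S(1)] by (auto simp: Ux N_def split: if_splits)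
        then show ?thesis using U(3) True unfolding ssyt_on_def by (simp add: nth_append)
      next
        case False
        then have i: "i = length \<nu>" using that by simp
        have "U x = Suc i \<longleftrightarrow> x \<in> bot S" for x using Tlt[of x] by (auto simp: Ux N_def i)
        then have "{x \<in> ?D. U x = Suc i} = bot S" using bot_D[OF U(2)] by blast
        then show ?thesis using card_bot[OF S(1)] S(2) i by simp
      qed
      have out: "U x = 0" if "x \<notin> ?D" for x
      proof -
        have "x \<notin> bot S" "x \<notin> ?D' S" using that bot_D[OF U(2)] D'_iff[OF S(1), of x] by auto
        then show ?thesis using ssyt_on_outside[OF U(3)] by (simp add: Ux)
      qed
      have rng: "1 \<le> U x \<and> U x \<le> length (\<nu> @ [v])" if "x \<in> ?D" for x
        using T1[OF that] Tlt[of x] by (auto simp: Ux N_def)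
      show "U \<in> ?A" unfolding mem_Collect_eq ssyt_on_def using out rng row col cont by blast
    qed
    show "g ` ?A \<subseteq> (SIGMA S:?P. ?B S)"
    proof
      fix y assume "y \<in> g ` ?A"
      then obtain T where y: "y = g T" and T: "T \<in> ?A" by auto
      define S where "S = fst (g T)"
      let ?T' = "\<lambda>x. if T x = N then 0 else T x"
      have S: "S \<in> ?P" "bot S = {x. T x = N}" using gA[OF T] by (auto simp: S_def)
      have D': "x \<in> ?D' S \<longleftrightarrow> x \<in> ?D \<and> T x \<noteq> N" for x using D'_iff[of S x] S by auto
      have tt: "\<forall>r c. (r, c) \<in> ?D \<and> (r, Suc c) \<in> ?D \<longrightarrow> T (r, c) \<le> T (r, Suc c)"
        "\<forall>r c. (r, c) \<in> ?D \<and> (Suc r, c) \<in> ?D \<longrightarrow> T (r, c) < T (Suc r, c)"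
        "\<forall>i<length (\<nu> @ [v]). card {x \<in> ?D. T x = Suc i} = (\<nu> @ [v]) ! i"
        using T unfolding mem_Collect_eq ssyt_on_def by blast+
      have "ssyt_on (?D' S) \<nu> ?T'"
        unfolding ssyt_on_def
      proof (intro conjI allI impI ballI)
        fix x assume "x \<notin> ?D' S"
        then show "?T' x = 0" using A(1)[OF T, of x] D' by auto
      next
        fix x assume x: "x \<in> ?D' S"
        then have "T x \<noteq> 0" "T x < N" using A(1,2)[OF T, of x] D'[of x] by auto
        then show "1 \<le> ?T' x" "?T' x \<le> length \<nu>"
          by (auto simp: N_def)
      next
        fix r c assume "(r, c) \<in> ?D' S \<and> (r, Suc c) \<in> ?D' S"
        then show "?T' (r, c) \<le> ?T' (r, Suc c)"
          using tt(1) unfolding D' by auto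
      next
        fix r c assume "(r, c) \<in> ?D' S \<and> (Suc r, c) \<in> ?D' S"
        then show "?T' (r, c) < ?T' (Suc r, c)"
          using tt(2) unfolding D' by auto
      next
        fix i assume i: "i < length \<nu>"
        then have "{x \<in> ?D' S. ?T' x = Suc i} = {x \<in> ?D. T x = Suc i}"
          unfolding D' by (auto simp: N_def)
        then show "card {x \<in> ?D' S. ?T' x = Suc i} = \<nu> ! i"
          using tt(3) i by (simp add: nth_append)
      qed
      moreover have "y = (S, ?T')" by (simp add: y S_def g_def)
      ultimately show "y \<in> (SIGMA S:?P. ?B S)" using S(1) by simp
    qed
  qed
  then have "card (SIGMA S:?P. ?B S) = card ?A" by (rule bij_betw_same_card)
  moreover have "finite ?P" by (rule finite_subset[of _ "Pow {1..j}"]) auto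
  then have "card (SIGMA S:?P. ?B S) = (\<Sum>S\<in>?P. card (?B S))"
    by (intro card_SigmaI) (auto intro: finite_ssyt_on finite_columns)
  ultimately show ?thesis by simp
qed

lemma desc_blocks_Nil: "desc_blocks \<beta> [] \<longleftrightarrow> (\<forall>b\<in>set \<beta>. b = 0)"
  by (induction \<beta>) auto

lemma block_count_content_Nil: "block_count (content_words []) \<beta> = of_bool (\<forall>b\<in>set \<beta>. b = 0)"
proof -
  have "w = []" if "w \<in> content_words []" for w using content_words_less[OF that] by (cases w) auto
  then have "content_words [] = {[]}" by (auto simp: content_words_def)
  then have "{w \<in> content_words []. desc_blocks \<beta> w} = (if \<forall>b\<in>set \<beta>. b = 0 then {[]} else {})"
    using desc_blocks_Nil by auto
  then show ?thesis unfolding block_count_def by simp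
qed

text \<open>Only the empty word has empty content. If \<open>h 1\<close> is positive, the first row
  has only positive indices and both sides are \<open>0\<close>; otherwise all heights vanish, and
  only the identity permutation has all its indices zero.\<close>

lemma jt_det_content_Nil:
  assumes h: "\<And>i. 1 \<le> i \<Longrightarrow> i < j \<Longrightarrow> h (Suc i) \<le> h i"
  shows "jt_det (block_count (content_words [])) j (\<lambda>i. int (h i)) = int (card {T. ssyt_on (columns j h) [] T})"
proof -
  let ?\<phi> = "block_count (content_words [])" and ?L = "\<lambda>\<pi>. map (\<lambda>i. int (h i) + int (\<pi> i) - int i) [1..<Suc j]"
  show ?thesis
  proof (cases "0 < j \<and> 0 < h 1")
    case True
    have "(0, 0) \<in> columns j h" using True by (simp add: columns_def)
    then have "{T. ssyt_on (columns j h) [] T} = {}" unfolding ssyt_on_def by fastforce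
    moreover have "jt_det ?\<phi> j (\<lambda>i. int (h i)) = 0"
      unfolding jt_det_def
    proof (intro sum.neutral ballI)
      fix \<pi> assume "\<pi> \<in> {\<pi>. \<pi> permutes {1..j}}"
      then have "1 \<le> \<pi> 1" using True permutes_in_image[of \<pi> "{1..j}" 1] by auto
      then have "int (h 1) + int (\<pi> 1) - int 1 \<noteq> 0" using True by simp
      moreover have "1 \<in> set [1..<Suc j]" unfolding set_upt using True by simp
      ultimately have "\<not> (\<forall>b\<in>set (?L \<pi>). b = 0)"
        by (metis (mono_tags, lifting) image_eqI list.set_map)
      then show "sign \<pi> * ?\<phi> (?L \<pi>) = 0"
        unfolding block_count_content_Nil by (simp only: of_bool_eq mult_zero_right simp_thms)
    qed
    ultimately show ?thesis by simp
  next
    case False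
    have "h i = 0" if "1 \<le> i" "i \<le> j" for i
      using that(1,2)
    proof (induction i rule: dec_induct)
      case base
      then show ?case using False by simp
    next
      case (step i)
      then show ?case using h[of i] by simp
    qed
    then have h0: "h i = 0" if "i \<in> {1..j}" for i using that by simp
    have "columns j h = {}" using h0 by (fastforce simp: columns_def)
    then have "{T. ssyt_on (columns j h) [] T} = {\<lambda>x. 0}" unfolding ssyt_on_def by auto
    moreover have "jt_det ?\<phi> j (\<lambda>i. int (h i)) =
        (\<Sum>\<pi> | \<pi> permutes {1..j}. if \<pi> = id then 1 else 0)"
      unfolding jt_det_def
    proof (intro sum.cong HOL.refl)
      fix \<pi> assume p: "\<pi> \<in> {\<pi>. \<pi> permutes {1..j}}"
      have s: "set [1..<Suc j] = {1..j}" by (simp add: atLeastLessThanSuc_atLeastAtMost del: upt_Suc)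
      have "(\<forall>b\<in>set (?L \<pi>). b = 0) \<longleftrightarrow> (\<forall>i\<in>{1..j}. \<pi> i = i)"
        unfolding set_map s using h0 by simp
      also have "\<dots> \<longleftrightarrow> \<pi> = id" using p permutes_not_in[of \<pi> "{1..j}"] by fastforce
      finally show "sign \<pi> * ?\<phi> (?L \<pi>) =
          (if \<pi> = id then 1 else 0)"
        unfolding block_count_content_Nil by (simp add: sign_id)
    qed
    moreover have "(\<Sum>\<pi> | \<pi> permutes {1..j}. if \<pi> = id then 1 else 0 :: int) = 1"
      using finite_permutations[of "{1..j}"] by (subst sum.delta) (auto simp: permutes_id)
    ultimately show ?thesis by simp
  qed
qed

text \<open>The terms that have no tableaux must cancel. If the new heights rise somewhere, they
  rise by exactly one, which makes two rows equal; if they decrease, some height is negative and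
  hence the last one is.\<close>

lemma jt_det_not_strip_ok:
  assumes \<phi>: "admissible \<phi>" and h: "\<And>i. 1 \<le> i \<Longrightarrow> i < j \<Longrightarrow> h (Suc i) \<le> h i"
    and S: "S \<subseteq> {1..j}" "\<not> strip_ok j h S"
  shows "jt_det \<phi> j (\<lambda>i. int (h i) - of_bool (i \<in> S)) = 0"
proof (cases "\<exists>i. 1 \<le> i \<and> i < j \<and> int (h i) - of_bool (i \<in> S) < int (h (Suc i)) - of_bool (Suc i \<in> S)")
  case True
  then obtain i where i: "1 \<le> i" "i < j" "int (h i) - of_bool (i \<in> S) < int (h (Suc i)) - of_bool (Suc i \<in> S)"
    by blast
  have "int (h (Suc i)) - of_bool (Suc i \<in> S) = int (h i) - of_bool (i \<in> S) + 1"
    using h[OF i(1,2)] i(3) by (auto simp: of_bool_def split: if_splits)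
  then show ?thesis using i by (intro jt_det_repeated[OF \<phi>, of i]) auto
next
  case False
  then have anti: "int (h (Suc i)) - of_bool (Suc i \<in> S) \<le> int (h i) - of_bool (i \<in> S)" if "1 \<le> i" "i < j" for i
    using that by force
  have "\<exists>i\<in>{1..j}. i \<in> S \<and> h i = 0"
  proof (rule ccontr)
    assume "\<not> ?thesis"
    then have pos: "0 < h i" if "i \<in> S" for i using S(1) that by auto
    have "h (Suc i) - of_bool (Suc i \<in> S) \<le> h i - of_bool (i \<in> S)" if "1 \<le> i \<and> i < j" for i
      using anti[of i] that pos[of i] pos[of "Suc i"] by (auto simp: of_bool_def split: if_splits)
    then show False using S(2) pos unfolding strip_ok_def by blast
  qed
  then obtain i where i: "1 \<le> i" "i \<le> j" "int (h i) - of_bool (i \<in> S) < 0" by auto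
  have "int (h j) - of_bool (j \<in> S) < 0"
    using i(2) i(1,3)
  proof (induction j rule: dec_induct)
    case base
    then show ?case by simp
  next
    case (step m)
    show ?case
    proof (cases "m < j")
      case True
      then show ?thesis using step anti[of m] by force
    next
      case False
      then show ?thesis using step by simp
    qed
  qed
  then show ?thesis using i by (intro jt_det_negative[OF \<phi>]) auto
qed

text \<open>The dual Jacobi-Trudi identity, one coefficient at a time: both sides satisfy the same
  recursion when the last part of the content is removed.\<close>

lemma jt_det_eq_card_ssyt:
  assumes "\<And>i. 1 \<le> i \<Longrightarrow> i < j \<Longrightarrow> h (Suc i) \<le> h i"
  shows "jt_det (block_count (content_words \<nu>)) j (\<lambda>i. int (h i)) = int (card {T. ssyt_on (columns j h) \<nu> T})"
  using assms
proof (induction \<nu> arbitrary: h rule: rev_induct)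
  case Nil
  then show ?case by (rule jt_det_content_Nil)
next
  case (snoc v \<nu>)
  let ?\<phi> = "block_count (content_words \<nu>)"
  let ?P = "{S. S \<subseteq> {1..j} \<and> card S = v}"
  let ?d = "\<lambda>S. jt_det ?\<phi> j (\<lambda>i. int (h i) - of_bool (i \<in> S))"
  let ?c = "\<lambda>S. int (card {T. ssyt_on (columns j (\<lambda>i. h i - of_bool (i \<in> S))) \<nu> T})"
  let ?Q = "{S. (S \<subseteq> {1..j} \<and> card S = v) \<and> strip_ok j h S}"
  have "jt_det (block_count (content_words (\<nu> @ [v]))) j (\<lambda>i. int (h i)) =
(\<Sum>S\<in>?P. ?d S)"
    by (rule jt_det_content_snoc)
  also have "\<dots> = (\<Sum>S\<in>?Q. ?c S)"
  proof (rule sum.mono_neutral_cong_right)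
    show "finite ?P" by (rule finite_subset[of _ "Pow {1..j}"]) auto
    show "\<forall>S\<in>?P - ?Q. ?d S = 0"
    proof
      fix S assume "S \<in> ?P - ?Q"
      then have "S \<subseteq> {1..j}" "\<not> strip_ok j h S" by auto
      then show "?d S = 0"
        by (intro jt_det_not_strip_ok admissible_content snoc.prems)
    qed
    fix S assume "S \<in> ?Q"
    then have S: "S \<subseteq> {1..j}" "strip_ok j h S" by auto
    have "int (h i) - of_bool (i \<in> S) = int (h i - of_bool (i \<in> S))" for i
      using S unfolding strip_ok_def by (cases "i \<in> S") (auto simp: of_nat_diff Suc_le_eq)
    then have "?d S = jt_det ?\<phi> j (\<lambda>i. int (h i - of_bool (i \<in> S)))"
      by presburger
    also have "\<dots> = ?c S"
      using S(2) unfolding strip_ok_def by (intro snoc.IH) blast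
    finally show "?d S = ?c S" .
  qed auto
  also have "\<dots> = int (card {T. ssyt_on (columns j h) (\<nu> @ [v]) T})"
    using card_ssyt_snoc[of j h \<nu> v] snoc.prems by simp
  finally show ?case .
qed

lemma diagram_eq_columns:
  assumes "sorted_wrt (\<ge>) \<mu>"
  shows "diagram \<mu> = columns (first_part \<mu>) (conj_part \<mu>)"
proof -
  have le: "\<mu> ! r \<le> first_part \<mu>" if "r < length \<mu>" for r
    using assms that by (cases \<mu>; cases r) (auto simp: first_part_def)
  have "r < conj_part \<mu> (Suc c) \<longleftrightarrow> r < length \<mu> \<and> c < \<mu> ! r" for r c
    using less_card_iff[OF assms, of r c] unfolding conj_part_def by (simp add: Suc_le_eq)
  then show ?thesis using le by (fastforce simp: diagram_def columns_def)
qed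

lemma kostka_eq_jacobi_trudi:
  assumes "\<mu> \<in> partitions n"
  shows "kostka \<mu> \<nu> = jacobi_trudi (block_count (content_words \<nu>)) \<mu>"
proof -
  have "conj_part \<mu> (Suc i) \<le> conj_part \<mu> i" for i
    unfolding conj_part_def by (intro card_mono) auto
  then have "jacobi_trudi (block_count (content_words \<nu>)) \<mu> =
      int (card {T. ssyt_on (columns (first_part \<mu>) (conj_part \<mu>)) \<nu> T})"
    unfolding jacobi_trudi_def by (subst jt_det_eq_card_ssyt[unfolded jt_det_def]) auto
  also have "columns (first_part \<mu>) (conj_part \<mu>) = diagram \<mu>"
    using diagram_eq_columns[of \<mu>] assms by (simp add: partitions_def)
  finally show ?thesis unfolding kostka_def is_ssyt_iff by simp
qed

section \<open>The inverse Kostka matrix\<close>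

text \<open>The sum of the entries of any tableau with content \<mu>. It serves as a numerical
  substitute for the dominance order.\<close>

definition row_weight :: "nat list \<Rightarrow> nat" where
  "row_weight \<mu> = (\<Sum>i<length \<mu>. Suc i * \<mu> ! i)"

lemma finite_diagram: "finite (diagram \<mu>)"
proof -
  have "diagram \<mu> = (\<Union>r\<in>{..<length \<mu>}. (\<lambda>c. (r, c)) ` {..<\<mu> ! r})" by (auto simp: diagram_def)
  then show ?thesis by simp
qed

lemma sum_diagram_rows: "(\<Sum>x\<in>diagram \<mu>. f (fst x)) = (\<Sum>r<length \<mu>. \<mu> ! r * f r)" for f :: "nat \<Rightarrow> nat"
proof -
  have "diagram \<mu> = (SIGMA r:{..<length \<mu>}. {..<\<mu> ! r})" by (auto simp: diagram_def)
  moreover have "(\<Sum>r<length \<mu>. \<Sum>c<\<mu> ! r. f r) = (\<Sum>x\<in>(SIGMA r:{..<length \<mu>}. {..<\<mu> ! r}). f (fst x))"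
    by (subst sum.Sigma) (auto simp: split_def)
  ultimately show ?thesis by simp
qed

lemma is_ssyt_weight:
  assumes "is_ssyt \<mu> \<nu> T"
  shows "(\<Sum>x\<in>diagram \<mu>. T x) = row_weight \<nu>"
proof -
  have T: "\<forall>x\<in>diagram \<mu>. 1 \<le> T x \<and> T x \<le> length \<nu>" "\<forall>i<length \<nu>. card {x \<in> diagram \<mu>. T x = Suc i} = \<nu> ! i"
    using assms unfolding is_ssyt_def by blast+
  have "T ` diagram \<mu> \<subseteq> Suc ` {..<length \<nu>}"
  proof
    fix y assume "y \<in> T ` diagram \<mu>"
    then have "1 \<le> y" "y \<le> length \<nu>" using T(1) by auto
    then show "y \<in> Suc ` {..<length \<nu>}" by (intro image_eqI[of _ _ "y - 1"]) auto
  qed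
  then have "(\<Sum>x\<in>diagram \<mu>. T x) = (\<Sum>y\<in>Suc ` {..<length \<nu>}. \<Sum>x | x \<in> diagram \<mu> \<and> T x = y. T x)"
    by (intro sum.group[symmetric] finite_diagram) auto
  also have "\<dots> = (\<Sum>i<length \<nu>. \<Sum>x | x \<in> diagram \<mu> \<and> T x = Suc i. T x)"
    by (subst sum.reindex) auto
  also have "\<dots> = (\<Sum>i<length \<nu>. Suc i * \<nu> ! i)"
  proof (intro sum.cong HOL.refl)
    fix i assume "i \<in> {..<length \<nu>}"
    have "(\<Sum>x | x \<in> diagram \<mu> \<and> T x = Suc i. T x) = (\<Sum>x | x \<in> diagram \<mu> \<and> T x = Suc i. Suc i)"
      by (intro sum.cong) auto
    also have "\<dots> = card {x \<in> diagram \<mu>. T x = Suc i} * Suc i" by simp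
    finally show "(\<Sum>x | x \<in> diagram \<mu> \<and> T x = Suc i. T x) = Suc i * \<nu> ! i"
      using T(2) \<open>i \<in> {..<length \<nu>}\<close> by (simp only: lessThan_iff mult.commute)
  qed
  finally show ?thesis by (simp add: row_weight_def)
qed

lemma is_ssyt_ge_row:
  assumes "is_ssyt \<mu> \<nu> T" "sorted_wrt (\<ge>) \<mu>"
  shows "(r, c) \<in> diagram \<mu> \<Longrightarrow> Suc r \<le> T (r, c)"
proof (induction r)
  case 0
  then show ?case using assms(1) unfolding is_ssyt_def by fastforce
next
  case (Suc r)
  have "\<mu> ! Suc r \<le> \<mu> ! r" using assms(2) Suc.prems by (simp add: diagram_def sorted_wrt_iff_nth_less)
  then have r: "(r, c) \<in> diagram \<mu>" using Suc.prems by (auto simp: diagram_def)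
  have "T (r, c) < T (Suc r, c)" using assms(1) r Suc.prems unfolding is_ssyt_def by blast
  then show ?case using Suc.IH[OF r] by simp
qed

lemma row_weight_diagram: "row_weight \<mu> = (\<Sum>x\<in>diagram \<mu>. Suc (fst x))"
  using sum_diagram_rows[of Suc \<mu>] by (simp add: row_weight_def mult.commute)

text \<open>Columns increase strictly, so an entry is at least its row number counted from 1;
  summing gives the inequality, and equality of the sums forces equality in each cell.\<close>

lemma is_ssyt_row_weight:
  assumes T: "is_ssyt \<mu> \<nu> T" and \<mu>: "sorted_wrt (\<ge>) \<mu>"
  shows "row_weight \<mu> \<le> row_weight \<nu>"
    "row_weight \<mu> = row_weight \<nu> \<Longrightarrow> x \<in> diagram \<mu> \<Longrightarrow> T x = Suc (fst x)"
proof -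
  have le: "Suc (fst x) \<le> T x" if "x \<in> diagram \<mu>" for x
    using is_ssyt_ge_row[OF T \<mu>, of "fst x" "snd x"] that by simp
  then show "row_weight \<mu> \<le> row_weight \<nu>"
    unfolding row_weight_diagram[of \<mu>] is_ssyt_weight[OF T, symmetric] by (rule sum_mono)
  assume "row_weight \<mu> = row_weight \<nu>" "x \<in> diagram \<mu>"
  then show "T x = Suc (fst x)"
    using sum_mono_inv[of "\<lambda>x. Suc (fst x)" "diagram \<mu>" T x] le finite_diagram
    unfolding row_weight_diagram[of \<mu>] is_ssyt_weight[OF T, symmetric] by simp
qed

text \<open>If the weights agree, a tableau has its row numbers as entries, and then its content is
  its shape.\<close>

lemma kostka_unitriangular:
  assumes \<mu>: "\<mu> \<in> partitions n" and \<nu>: "\<nu> \<in> partitions n" and ne: "kostka \<mu> \<nu> \<noteq> 0"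
  shows "\<mu> = \<nu> \<or> row_weight \<mu> < row_weight \<nu>"
proof (cases "row_weight \<mu> = row_weight \<nu>")
  case False
  have "{T. is_ssyt \<mu> \<nu> T} \<noteq> {}" using ne unfolding kostka_def by (metis card.empty of_nat_0)
  then obtain T where "is_ssyt \<mu> \<nu> T" by blast
  then show ?thesis using is_ssyt_row_weight(1) False \<mu> unfolding partitions_def by fastforce
next
  case eq: True
  have s: "sorted_wrt (\<ge>) \<mu>" "0 \<notin> set \<mu>" "0 \<notin> set \<nu>" using \<mu> \<nu> by (auto simp: partitions_def)
  have pos: "0 < \<mu> ! i" if "i < length \<mu>" for i using s(2) that by (metis gr0I nth_mem)
  have pos': "0 < \<nu> ! i" if "i < length \<nu>" for i using s(3) that by (metis gr0I nth_mem)
  have "{T. is_ssyt \<mu> \<nu> T} \<noteq> {}" using ne unfolding kostka_def by (metis card.empty of_nat_0)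
  then obtain T where T: "is_ssyt \<mu> \<nu> T" by blast
  have Tx: "T x = Suc (fst x)" if "x \<in> diagram \<mu>" for x using is_ssyt_row_weight(2)[OF T s(1) eq that] .
  have row: "\<nu> ! i = card {x \<in> diagram \<mu>. fst x = i}" if "i < length \<nu>" for i
  proof -
    have "\<nu> ! i = card {x \<in> diagram \<mu>. T x = Suc i}" using T that unfolding is_ssyt_def by auto
    also have "{x \<in> diagram \<mu>. T x = Suc i} = {x \<in> diagram \<mu>. fst x = i}" using Tx by auto
    finally show ?thesis .
  qed
  have cardrow: "card {x \<in> diagram \<mu>. fst x = i} = (if i < length \<mu> then \<mu> ! i else 0)" for i
  proof -
    have "{x \<in> diagram \<mu>. fst x = i} = (if i < length \<mu> then Pair i ` {..<\<mu> ! i} else {})"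
      by (auto simp: diagram_def)
    then show ?thesis by (simp add: card_image inj_on_def)
  qed
  have "i < length \<nu>" if "i < length \<mu>" for i
  proof -
    have "(i, 0) \<in> diagram \<mu>" using that pos by (simp add: diagram_def)
    then have "T (i, 0) \<le> length \<nu>" "T (i, 0) = Suc i" using T Tx unfolding is_ssyt_def by auto
    then show ?thesis by simp
  qed
  moreover have "i < length \<mu>" if "i < length \<nu>" for i
    using row[OF that] cardrow[of i] pos'[OF that] by (auto split: if_splits)
  ultimately have "length \<mu> = length \<nu>" by (meson linorder_neqE_nat less_irrefl)
  then have "\<mu> = \<nu>" using row cardrow by (intro nth_equalityI) auto
  then show ?thesis ..
qed

lemma kostka_self:
  assumes \<mu>: "\<mu> \<in> partitions n"
  shows "kostka \<mu> \<mu> = 1"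
proof -
  define T where "T x = (if x \<in> diagram \<mu> then Suc (fst x) else 0)" for x
  have s: "sorted_wrt (\<ge>) \<mu>" using \<mu> by (auto simp: partitions_def)
  have "is_ssyt \<mu> \<mu> T"
    unfolding is_ssyt_def
  proof (intro conjI allI impI ballI)
    fix i assume "i < length \<mu>"
    then have "{x \<in> diagram \<mu>. T x = Suc i} = Pair i ` {..<\<mu> ! i}" by (auto simp: T_def diagram_def)
    then show "card {x \<in> diagram \<mu>. T x = Suc i} = \<mu> ! i" by (simp add: card_image inj_on_def)
  qed (auto simp: T_def diagram_def)
  moreover have "U = T" if "is_ssyt \<mu> \<mu> U" for U
  proof
    fix x show "U x = T x"
      using is_ssyt_row_weight(2)[OF that s HOL.refl, of x] ssyt_on_outside[OF that[unfolded is_ssyt_iff], of x]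
      by (simp add: T_def)
  qed
  ultimately have "{T. is_ssyt \<mu> \<mu> T} = {T}" by blast
  then show ?thesis unfolding kostka_def by simp
qed

text \<open>In the equation for \<open>i\<close> every other nonzero entry of \<open>K\<close>
  belongs to an index of smaller \<open>m\<close>, where \<open>y\<close> vanishes by
  induction.\<close>

lemma unitriangular_kernel:
  fixes K :: "'i \<Rightarrow> 'i \<Rightarrow> int" and m :: "'i \<Rightarrow> nat"
  assumes fin: "finite I" and diag: "\<And>i. i \<in> I \<Longrightarrow> K i i = 1"
    and tri: "\<And>i j. i \<in> I \<Longrightarrow> j \<in> I \<Longrightarrow> K i j \<noteq> 0 \<Longrightarrow> i = j \<or> m i < m j"
    and y: "\<And>j. j \<in> I \<Longrightarrow> (\<Sum>i\<in>I. y i * K i j) = 0"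
  shows "i \<in> I \<Longrightarrow> y i = 0"
proof (induction "m i" arbitrary: i rule: less_induct)
  case less
  have "y i' * K i' i = 0" if "i' \<in> I - {i}" for i'
    using less.hyps[of i'] tri[of i' i] that less.prems by auto
  then have "(\<Sum>i'\<in>I - {i}. y i' * K i' i) = 0" by (rule sum.neutral[OF ballI])
  then have "(\<Sum>i'\<in>I. y i' * K i' i) = y i * K i i"
    using sum.remove[OF fin less.prems, of "\<lambda>i'. y i' * K i' i"] by simp
  then show ?case using y[OF less.prems] diag[OF less.prems] by simp
qed

text \<open>The equations are solved by increasing \<open>m\<close>. A correction at indices of
  level \<open>k\<close> leaves the lower equations intact and changes each equation of level
  \<open>k\<close> only through its diagonal entry.\<close>

lemma unitriangular_solvable:
  fixes K :: "'i \<Rightarrow> 'i \<Rightarrow> int" and m :: "'i \<Rightarrow> nat"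
  assumes fin: "finite I" and diag: "\<And>i. i \<in> I \<Longrightarrow> K i i = 1"
    and tri: "\<And>i j. i \<in> I \<Longrightarrow> j \<in> I \<Longrightarrow> K i j \<noteq> 0 \<Longrightarrow> i = j \<or> m i < m j"
  shows "\<exists>x. \<forall>j\<in>I. (\<Sum>i\<in>I. x i * K i j) = t j"
proof -
  have "\<exists>x. \<forall>j\<in>I. m j < k \<longrightarrow> (\<Sum>i\<in>I. x i * K i j) = t j" for k
  proof (induction k)
    case (Suc k)
    then obtain x where x: "\<And>j. j \<in> I \<Longrightarrow> m j < k \<Longrightarrow> (\<Sum>i\<in>I. x i * K i j) = t j" by blast
    define d where "d i = (if m i = k then t i - (\<Sum>i'\<in>I. x i' * K i' i) else 0)" for i
    have "(\<Sum>i\<in>I. (x i + d i) * K i j) = t j" if j: "j \<in> I" "m j < Suc k" for j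
    proof -
      have "d i * K i j = 0" if "i \<in> I - {j}" for i
        using that j tri[of i j] by (auto simp: d_def)
      then have "(\<Sum>i\<in>I - {j}. d i * K i j) = 0" by (rule sum.neutral[OF ballI])
      then have "(\<Sum>i\<in>I. d i * K i j) = d j"
        using sum.remove[OF fin j(1), of "\<lambda>i. d i * K i j"] diag[OF j(1)] by simp
      then have "(\<Sum>i\<in>I. (x i + d i) * K i j) = (\<Sum>i\<in>I. x i * K i j) + d j"
        by (simp add: distrib_right sum.distrib)
      then show ?thesis using x[OF j(1)] j(2) by (auto simp: d_def)
    qed
    then show ?case by (intro exI[of _ "\<lambda>i. x i + d i"]) auto
  qed simp
  from this[of "Suc (Max (m ` I))"] obtain x where x: "\<forall>j\<in>I. m j < Suc (Max (m ` I)) \<longrightarrow> (\<Sum>i\<in>I. x i * K i j) = t j"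
    by blast
  moreover have "m j < Suc (Max (m ` I))" if "j \<in> I" for j using fin that by (simp add: less_Suc_eq_le)
  ultimately show ?thesis by blast
qed

lemma kostka_row_unique:
  assumes "\<And>\<nu>. \<nu> \<in> partitions n \<Longrightarrow>
      (\<Sum>\<mu>\<in>partitions n. x \<mu> * kostka \<mu> \<nu>) = (\<Sum>\<mu>\<in>partitions n. y \<mu> * kostka \<mu> \<nu>)"
    and "\<mu> \<in> partitions n"
  shows "x \<mu> = y \<mu>"
proof -
  have "x \<mu> - y \<mu> = 0"
  proof (rule unitriangular_kernel[where I = "partitions n" and K = kostka and m = row_weight and y = "\<lambda>\<mu>. x \<mu> - y \<mu>"])
    fix \<nu> assume "\<nu> \<in> partitions n"
    then show "(\<Sum>\<mu>\<in>partitions n. (x \<mu> - y \<mu>) * kostka \<mu> \<nu>) = 0"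
      using assms(1) by (simp add: left_diff_distrib sum_subtractf)
  qed (use assms(2) kostka_self kostka_unitriangular in auto)
  then show ?thesis by simp
qed

text \<open>\<open>kostka_inv\<close> is a definite description of a whole matrix, so that matrix
  must first be shown to exist uniquely; then any solution of the linear system for one row is that
  row.\<close>

lemma kostka_inv_row:
  assumes lam: "lam \<in> partitions n"
    and a: "\<And>\<nu>. \<nu> \<in> partitions n \<Longrightarrow> (\<Sum>\<mu>\<in>partitions n. a \<mu> * kostka \<mu> \<nu>) = (if lam = \<nu> then 1 else 0)"
    and \<mu>: "\<mu> \<in> partitions n"
  shows "kostka_inv n lam \<mu> = a \<mu>"
proof -
  let ?Q = "\<lambda>M. (\<forall>lam \<mu>. M lam \<mu> \<noteq> 0 \<longrightarrow> lam \<in> partitions n \<and> \<mu> \<in> partitions n) \<and>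
      (\<forall>lam \<in> partitions n. \<forall>\<nu> \<in> partitions n.
          (\<Sum>\<mu> \<in> partitions n. M lam \<mu> * kostka \<mu> \<nu>) = (if lam = \<nu> then 1 else 0))"
  have "\<exists>x. \<forall>\<nu>\<in>partitions n. (\<Sum>\<mu>\<in>partitions n. x \<mu> * kostka \<mu> \<nu>) = (if lam = \<nu> then 1 else 0)" for lam
    by (rule unitriangular_solvable[where m = row_weight]) (use kostka_self kostka_unitriangular in auto)
  then obtain x where x: "\<And>lam \<nu>. \<nu> \<in> partitions n \<Longrightarrow>
      (\<Sum>\<mu>\<in>partitions n. x lam \<mu> * kostka \<mu> \<nu>) = (if lam = \<nu> then 1 else 0)" by metis
  define M where "M lam \<mu> = (if lam \<in> partitions n \<and> \<mu> \<in> partitions n then x lam \<mu> else 0)" for lam \<mu>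
  have "?Q M"
  proof (intro conjI allI impI ballI)
    fix lam \<nu> assume "lam \<in> partitions n" "\<nu> \<in> partitions n"
    then show "(\<Sum>\<mu> \<in> partitions n. M lam \<mu> * kostka \<mu> \<nu>) = (if lam = \<nu> then 1 else 0)"
      using x[of \<nu> lam] by (simp add: M_def)
  qed (auto simp: M_def split: if_splits)
  moreover have "M' = M''" if M': "?Q M'" and M'': "?Q M''" for M' M''
  proof (intro ext)
    fix lam \<mu>
    show "M' lam \<mu> = M'' lam \<mu>"
    proof (cases "lam \<in> partitions n \<and> \<mu> \<in> partitions n")
      case True
      show ?thesis
        by (rule kostka_row_unique[of n "M' lam" "M'' lam"]) (use M' M'' True in auto)
    next
      case False
      then show ?thesis using M' M'' by metis
    qed
  qed
  ultimately have "\<exists>!M. ?Q M" by blast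
  then have "?Q (kostka_inv n)" unfolding kostka_inv_def by (rule theI')
  then have "(\<Sum>\<mu>\<in>partitions n. kostka_inv n lam \<mu> * kostka \<mu> \<nu>) = (if lam = \<nu> then 1 else 0)"
    if "\<nu> \<in> partitions n" for \<nu> using lam that by blast
  then show ?thesis using a \<mu> by (intro kostka_row_unique[of n "kostka_inv n lam" a]) auto
qed

section \<open>Class sums and the ideal\<close>

lemma nc_mono_mult: "nc_mult (nc_mono u) (nc_mono v) = nc_mono (u @ v)"
proof
  fix w
  have "nc_mult (nc_mono u) (nc_mono v) w = (\<Sum>i\<le>length w. if i = length u \<and> w = u @ v then 1 else 0)"
    unfolding nc_mult_def nc_mono_def
    by (intro sum.cong) (auto simp: min_def dest: arg_cong[of _ _ length] split: if_splits)
  also have "\<dots> = nc_mono (u @ v) w"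
    by (cases "w = u @ v") (simp_all add: nc_mono_def)
  finally show "nc_mult (nc_mono u) (nc_mono v) w = nc_mono (u @ v) w" .
qed

lemma nc_mult_diff: "nc_mult f (nc_diff g h) = nc_diff (nc_mult f g) (nc_mult f h)"
  "nc_mult (nc_diff g h) f = nc_diff (nc_mult g f) (nc_mult h f)"
  by (auto simp: nc_mult_def nc_diff_def algebra_simps sum_subtractf)

lemma nc_poly_mono: "nc_poly (nc_mono u)"
  unfolding nc_poly_def nc_mono_def by simp

definition nc_scale :: "int \<Rightarrow> ('a list \<Rightarrow> int) \<Rightarrow> 'a list \<Rightarrow> int" where
  "nc_scale c f = (\<lambda>w. c * f w)"

text \<open>The inductive definition has no scalar rule; a scalar acts as multiplication by a
  constant polynomial.\<close>

lemma IH_ideal_scale: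
  assumes "x \<in> IH_ideal"
  shows "nc_scale c x \<in> IH_ideal"
proof -
  have "nc_poly (nc_scale c nc_one)" unfolding nc_poly_def nc_scale_def nc_one_def
    by (rule finite_subset[of _ "{[]}"]) auto
  moreover have "nc_mult (nc_scale c nc_one) x = nc_scale c x"
  proof
    fix w
    have "nc_mult (nc_scale c nc_one) x w = (\<Sum>i\<le>length w. if i = 0 then c * x w else 0)"
      unfolding nc_mult_def nc_scale_def nc_one_def by (intro sum.cong) auto
    then show "nc_mult (nc_scale c nc_one) x w = nc_scale c x w" by (simp add: nc_scale_def)
  qed
  ultimately show ?thesis using IH_ideal.mult_left[OF assms] by metis
qed

lemma IH_ideal_context:
  assumes "nc_diff (nc_mono u) (nc_mono v) \<in> IH_ideal"
  shows "nc_diff (nc_mono (p @ u @ s)) (nc_mono (p @ v @ s)) \<in> IH_ideal"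
  using IH_ideal.mult_left[OF IH_ideal.mult_right[OF assms nc_poly_mono[of s]] nc_poly_mono[of p]]
  by (simp add: nc_mult_diff nc_mono_mult)

lemma hcong_IH_ideal: "hcong u v \<Longrightarrow> nc_diff (nc_mono u) (nc_mono v) \<in> IH_ideal"
proof (induction rule: hcong.induct)
  case (refl u)
  have "nc_diff (nc_mono u) (nc_mono u) = nc_zero" by (auto simp: nc_diff_def nc_zero_def)
  then show ?case using IH_ideal.zero by metis
next
  case (sym u v)
  have "nc_diff (nc_mono v) (nc_mono u) = nc_scale (- 1) (nc_diff (nc_mono u) (nc_mono v))"
    by (auto simp: nc_diff_def nc_scale_def)
  then show ?case using IH_ideal_scale[OF sym.IH] by metis
next
  case (trans u v w)
  have "nc_diff (nc_mono u) (nc_mono w) =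
      nc_add (nc_diff (nc_mono u) (nc_mono v)) (nc_diff (nc_mono v) (nc_mono w))"
    by (auto simp: nc_diff_def nc_add_def)
  then show ?case using IH_ideal.add[OF trans.IH] by metis
next
  case (comm a c u v)
  then have "nc_diff (nc_mono [c, a]) (nc_mono [a, c]) \<in> IH_gens" unfolding IH_gens_def by blast
  then show ?case by (intro IH_ideal_context IH_ideal.gen)
next
  case (rotate a b c u v)
  then have "nc_diff (nc_mono [c, a, b]) (nc_mono [b, c, a]) \<in> IH_gens" unfolding IH_gens_def by blast
  then show ?case by (intro IH_ideal_context IH_ideal.gen)
qed

definition hclass :: "'a::order list \<Rightarrow> 'a list set" where
  "hclass u = {v. hcong u v}"

lemma finite_hclass: "finite (hclass u)"
  by (rule finite_subset[OF _ mset_eq_finite[of u]]) (auto simp: hclass_def dest: hcong_mset)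

lemma hclosed_hclass: "hclosed (hclass u)"
  unfolding hclosed_def hclass_def using hcong.trans by blast

text \<open>A class with zero sum and a nonzero coefficient at \<open>u\<close> has a second such
  word \<open>v\<close>. Moving the coefficient of \<open>u\<close> onto \<open>v\<close> subtracts
  a multiple of a difference of congruent monomials, keeps all class sums and shrinks the
  support.\<close>

lemma IH_ideal_class_sums:
  fixes f :: "'a::order list \<Rightarrow> int"
  assumes "nc_poly f" "\<And>u. (\<Sum>w\<in>hclass u. f w) = 0"
  shows "f \<in> IH_ideal"
  using assms
proof (induction "card {w. f w \<noteq> 0}" arbitrary: f rule: less_induct)
  case less
  show ?case
  proof (cases "f = nc_zero")
    case True
    then show ?thesis using IH_ideal.zero by simp
  next
    case False
    then obtain u where u: "f u \<noteq> 0" by (auto simp: nc_zero_def)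
    have uu: "u \<in> hclass u" by (simp add: hclass_def hcong.refl)
    have "\<exists>v\<in>hclass u. v \<noteq> u \<and> f v \<noteq> 0"
    proof (rule ccontr)
      assume "\<not> ?thesis"
      then have "(\<Sum>w\<in>hclass u - {u}. f w) = 0" by (intro sum.neutral) blast
      then have "(\<Sum>w\<in>hclass u. f w) = f u"
        using sum.remove[OF finite_hclass uu, of f] by simp
      then show False using less.prems(2) u by simp
    qed
    then obtain v where v: "hcong u v" "v \<noteq> u" "f v \<noteq> 0" by (auto simp: hclass_def)
    define d where "d = nc_scale (f u) (nc_diff (nc_mono u) (nc_mono v))"
    define f' where "f' = nc_diff f d"
    have d: "d \<in> IH_ideal" unfolding d_def by (intro IH_ideal_scale hcong_IH_ideal v)
    have f'w: "f' w = (if w = u then 0 else if w = v then f v + f u else f w)" for w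
      using v(2) by (auto simp: f'_def d_def nc_diff_def nc_scale_def nc_mono_def)
    have sub: "{w. f' w \<noteq> 0} \<subset> {w. f w \<noteq> 0}" using u v by (auto simp: f'w split: if_splits)
    have fin: "finite {w. f w \<noteq> 0}" using less.prems(1) by (simp add: nc_poly_def)
    have "f' \<in> IH_ideal"
    proof (rule less.hyps)
      show "card {w. f' w \<noteq> 0} < card {w. f w \<noteq> 0}" by (rule psubset_card_mono[OF fin sub])
      show "nc_poly f'" unfolding nc_poly_def using fin sub finite_subset by blast
      fix x :: "'a list"
      have mono: "(\<Sum>w\<in>hclass x. nc_mono y w) = of_bool (hcong x y)" for y
        using finite_hclass[of x] by (simp add: nc_mono_def hclass_def)
      have "hcong x u \<longleftrightarrow> hcong x v" using v(1) hcong.trans hcong.sym by blast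
      then have "(\<Sum>w\<in>hclass x. d w) = 0"
        unfolding d_def nc_scale_def nc_diff_def sum_distrib_left[symmetric] sum_subtractf mono by simp
      then show "(\<Sum>w\<in>hclass x. f' w) = 0"
        using less.prems(2) by (simp add: f'_def nc_diff_def sum_subtractf)
    qed
    moreover have "f = nc_add f' d" by (auto simp: f'_def nc_add_def nc_diff_def)
    ultimately show ?thesis using IH_ideal.add d by metis
  qed
qed

section \<open>Key tableaux and key words\<close>

text \<open>The degrees prescribe where a word has to be cut, so one summand at most survives in
  each convolution.\<close>

lemma nc_prod_list_eP: "nc_prod_list (map eP \<beta>) w = of_bool (desc_blocks \<beta> w)"
proof (induction \<beta> arbitrary: w)
  case Nil
  then show ?case by (simp add: nc_prod_list_def nc_one_def)
next
  case (Cons b \<beta>)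
  have "nc_prod_list (map eP (b # \<beta>)) w = (\<Sum>i\<le>length w. eP b (take i w) * of_bool (desc_blocks \<beta> (drop i w)))"
    using Cons by (simp add: nc_prod_list_def nc_mult_def)
  also have "\<dots> = (\<Sum>i\<le>length w. if i = nat b then of_bool (desc_blocks (b # \<beta>) w) else 0)"
    by (intro sum.cong) (auto simp: eP_def min_def)
  also have "\<dots> = of_bool (desc_blocks (b # \<beta>) w)" by simp
  finally show ?case .
qed

lemma JP_eq: "JP \<mu> w = jacobi_trudi (\<lambda>\<beta>. of_bool (desc_blocks \<beta> w)) \<mu>"
proof -
  have eq: "nc_prod_list (map (\<lambda>i. eP (\<gamma> i)) xs) w = of_bool (desc_blocks (map \<gamma> xs) w)"
    for \<gamma> and xs :: "nat list" using nc_prod_list_eP[of "map \<gamma> xs" w] by (simp add: o_def)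
  show ?thesis
    unfolding JP_def jacobi_trudi_def first_part_def[symmetric] Let_def eq ..
qed

lemma sum_JP:
  assumes "finite X"
  shows "(\<Sum>w\<in>X. JP \<mu> w) = jacobi_trudi (block_count X) \<mu>"
proof -
  have "(\<Sum>w\<in>X. of_bool (desc_blocks \<beta> w)) = block_count X \<beta>" for \<beta>
    using assms unfolding block_count_def by (simp add: of_bool_def sum.If_cases Int_def)
  then show ?thesis
    unfolding JP_eq jacobi_trudi_def by (subst sum.swap) (simp add: sum_distrib_left[symmetric])
qed

lemma sum_conj_part:
  "(\<Sum>i=1..first_part \<mu>. conj_part \<mu> i) = sum_list \<mu>" if "\<mu> \<in> partitions n" for \<mu>
proof -
  have "diagram \<mu> = columns (first_part \<mu>) (conj_part \<mu>)"
    using diagram_eq_columns that by (simp add: partitions_def)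
  also have "\<dots> = prod.swap ` (SIGMA c:{..<first_part \<mu>}. {..<conj_part \<mu> (Suc c)})"
    by (auto simp: columns_def)
  finally have "card (diagram \<mu>) = card (SIGMA c:{..<first_part \<mu>}. {..<conj_part \<mu> (Suc c)})"
    by (simp add: card_image)
  also have "\<dots> = (\<Sum>c<first_part \<mu>. conj_part \<mu> (Suc c))" by simp
  also have "\<dots> = (\<Sum>i=1..first_part \<mu>. conj_part \<mu> i)"
    by (rule sum.reindex_bij_witness[of _ "\<lambda>i. i - 1" Suc]) auto
  finally have "card (diagram \<mu>) = (\<Sum>i=1..first_part \<mu>. conj_part \<mu> i)" .
  moreover have "card (diagram \<mu>) = sum_list \<mu>"
    using sum_diagram_rows[of "\<lambda>_. 1" \<mu>] by (simp add: sum_list_sum_nth atLeast0LessThan)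
  ultimately show ?thesis by simp
qed

text \<open>The shifts \<open>\<pi> i - i\<close> sum to zero, so every term of the determinant is
  homogeneous of degree \<open>n\<close>. Over a finite alphabet this yields the finite support
  required by \<open>nc_poly\<close>.\<close>

lemma JP_length:
  assumes "\<mu> \<in> partitions n" "JP \<mu> w \<noteq> 0"
  shows "length w = n"
proof -
  let ?j = "first_part \<mu>"
  obtain \<pi> where \<pi>: "\<pi> permutes {1..?j}"
    "desc_blocks (map (\<lambda>i. int (conj_part \<mu> i) + int (\<pi> i) - int i) [1..<Suc ?j]) w"
  proof (rule ccontr)
    assume "\<not> thesis"
    then have "JP \<mu> w = 0"
      unfolding JP_eq jacobi_trudi_def using that by (intro sum.neutral) auto
    then show False using assms(2) by simp
  qed
  have p: "(\<Sum>i=1..?j. int (\<pi> i)) = (\<Sum>i=1..?j. int i)"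
    by (rule sum.permute[OF \<pi>(1), symmetric, unfolded comp_def])
  have "int (length w) = (\<Sum>i=1..?j. int (conj_part \<mu> i) + int (\<pi> i) - int i)"
    unfolding desc_blocks_length[OF \<pi>(2)] by (rule sum_list_map_upt_Suc)
  also have "\<dots> = int (\<Sum>i=1..?j. conj_part \<mu> i)"
    unfolding sum_subtractf sum.distrib p by simp
  also have "\<dots> = int n" unfolding sum_conj_part[OF assms(1)] using assms(1) by (simp add: partitions_def)
  finally show ?thesis by simp
qed

section \<open>Column words of hook tableaux\<close>

lemma colword_hook:
  "colword (hook (Suc m) k) T = rev (map (\<lambda>r. T (r, 0)) [0..<Suc k]) @ map (\<lambda>c. T (0, c)) [1..<Suc m]"
proof -
  have hk: "hook (Suc m) k ! r = (if r = 0 then Suc m else 1)" if "r < Suc k" for r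
    using that by (auto simp: hook_def nth_Cons split: nat.splits)
  have "{r. r < length (hook (Suc m) k) \<and> c < hook (Suc m) k ! r} =
      (if c = 0 then {..<Suc k} else if c \<le> m then {0} else {})" for c
    using hk by (auto simp: hook_def split: if_splits)
  then have ch: "col_height (hook (Suc m) k) c = (if c = 0 then Suc k else if c \<le> m then 1 else 0)" for c
    unfolding col_height_def by simp
  have hd: "hook (Suc m) k \<noteq> []" "hd (hook (Suc m) k) = Suc m" by (simp_all add: hook_def)
  have "[0..<Suc m] = 0 # [1..<Suc m]" by (simp add: upt_rec)
  then have "colword (hook (Suc m) k) T = rev (map (\<lambda>r. T (r, 0)) [0..<Suc k]) @
      concat (map (\<lambda>c. rev (map (\<lambda>r. T (r, c)) [0..<col_height (hook (Suc m) k) c])) [1..<Suc m])"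
    unfolding colword_def by (simp add: hd ch del: upt_Suc)
  moreover have "map (\<lambda>c. rev (map (\<lambda>r. T (r, c)) [0..<col_height (hook (Suc m) k) c])) [1..<Suc m] =
      map (\<lambda>c. [T (0, c)]) [1..<Suc m]"
    by (intro map_cong) (auto simp: ch)
  ultimately show ?thesis by (simp only: concat_map_singleton)
qed

lemma diagram_hook: "diagram (hook (Suc m) k) = {(r, c). (c = 0 \<and> r \<le> k) \<or> (r = 0 \<and> c \<le> m)}"
  by (auto simp: diagram_def hook_def nth_Cons split: nat.splits)

lemma power_word_weak: "power_word w \<Longrightarrow> Suc i < length w \<Longrightarrow> \<not> w ! Suc i < w ! i"
  unfolding power_word_def P_weakly_increasing_def by blast

lemma colword_key_ptabs:
  "bij_betw (colword (hook (Suc m) k)) (key_ptabs (Suc m) k) {w :: 'a::order list. key_word m k w}"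
proof -
  \<comment> \<open>The inverse of reading: the corner sits at position \<open>k\<close> of the
    word, the column runs to its left and the row to its right.\<close>
  define tab where "tab w = (\<lambda>(r, c). if c = 0 \<and> r \<le> k then w ! (k - r) else if r = 0 \<and> c \<le> m then w ! (k + c) else undefined)"
    for w :: "'a list"
  let ?cw = "colword (hook (Suc m) k) :: (nat \<times> nat \<Rightarrow> 'a) \<Rightarrow> 'a list"
  have tk: "take (k + 1) (?cw T) = rev (map (\<lambda>r. T (r, 0)) [0..<Suc k])"
    "drop (k + 1) (?cw T) = map (\<lambda>c. T (0, c)) [1..<Suc m]" for T :: "nat \<times> nat \<Rightarrow> 'a"
    unfolding colword_hook by (simp_all del: upt_Suc)
  have nth1: "?cw T ! (k - r) = T (r, 0)" if "r \<le> k" for T :: "nat \<times> nat \<Rightarrow> 'a" and r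
    using that unfolding colword_hook by (simp add: nth_append rev_nth less_Suc_eq_le del: upt_Suc)
  have nth2: "?cw T ! (k + c) = T (0, c)" if "1 \<le> c" "c \<le> m" for T :: "nat \<times> nat \<Rightarrow> 'a" and c
    using that unfolding colword_hook by (cases c) (simp_all add: nth_append del: upt_Suc)
  have "\<forall>T\<in>key_ptabs (Suc m) k. tab (?cw T) = T"
  proof (intro ballI ext)
    fix T :: "nat \<times> nat \<Rightarrow> 'a" and x :: "nat \<times> nat" assume T: "T \<in> key_ptabs (Suc m) k"
    obtain r c where x: "x = (r, c)" by (cases x)
    have "T x = undefined" if "x \<notin> diagram (hook (Suc m) k)"
      using T that unfolding key_ptabs_def is_ptab_def by blast
    then show "tab (?cw T) x = T x" using nth1[of r T] nth2[of c T] unfolding x diagram_hook tab_def by auto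
  qed
  moreover have colw: "?cw (tab w) = w" if "length w = m + 1 + k" for w
  proof (rule nth_equalityI)
    show "length (?cw (tab w)) = length w" using that unfolding colword_hook by simp
    fix i assume "i < length (?cw (tab w))"
    then have i: "i < m + 1 + k" unfolding colword_hook by (simp del: upt_Suc)
    show "?cw (tab w) ! i = w ! i"
    proof (cases "i \<le> k")
      case True
      then show ?thesis using nth1[of "k - i" "tab w"] by (simp add: tab_def)
    next
      case False
      then show ?thesis using nth2[of "i - k" "tab w"] i by (simp add: tab_def)
    qed
  qed
  then have "\<forall>w\<in>{w. key_word m k w}. ?cw (tab w) = w" by (auto simp: key_word_def)
  moreover have "?cw ` key_ptabs (Suc m) k \<subseteq> {w. key_word m k w}"
  proof (intro image_subsetI CollectI)
    fix T :: "nat \<times> nat \<Rightarrow> 'a" assume T: "T \<in> key_ptabs (Suc m) k"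
    have col: "T (r, 0) < T (Suc r, 0)" if "Suc r \<le> k" for r
      using T that unfolding key_ptabs_def is_ptab_def diagram_hook by auto
    have lt: "T (r, 0) < T (r', 0)" if "r < r'" "r' \<le> k" for r r'
      using that
    proof (induction r')
      case (Suc r')
      show ?case
      proof (cases "r = r'")
        case True
        then show ?thesis using col Suc.prems by simp
      next
        case False
        then have "T (r, 0) < T (r', 0)" using Suc by simp
        also have "\<dots> < T (Suc r', 0)" using col Suc.prems by simp
        finally show ?thesis .
      qed
    qed simp
    obtain r where r: "r \<le> k" "power_word (T (r, 0) # map (\<lambda>c. T (0, c)) [1..<Suc m])"
      using T unfolding key_ptabs_def by blast
    show "key_word m k (?cw T)"
      unfolding key_word_def
    proof (intro conjI)
      show "length (?cw T) = m + 1 + k" unfolding colword_hook by simp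
      show "is_desc (take (k + 1) (?cw T))"
        unfolding tk sorted_wrt_rev sorted_wrt_map using lt
        by (auto simp: sorted_wrt_iff_nth_less simp del: upt_Suc)
      have "T (r, 0) \<in> set (take (k + 1) (?cw T))" unfolding tk using r(1) by (auto simp del: upt_Suc)
      then show "\<exists>v\<in>set (take (k + 1) (?cw T)). power_word (v # drop (k + 1) (?cw T))"
        using r(2) unfolding tk(2) by blast
    qed
  qed
  moreover have "tab ` {w. key_word m k w} \<subseteq> key_ptabs (Suc m) k"
  proof (intro image_subsetI)
    fix w :: "'a list" assume "w \<in> {w. key_word m k w}"
    then have len: "length w = m + 1 + k" and desc: "is_desc (take (k + 1) w)"
      and ex: "\<exists>v\<in>set (take (k + 1) w). power_word (v # drop (k + 1) w)"
      unfolding key_word_def by auto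
    obtain v where v: "v \<in> set (take (k + 1) w)" "power_word (v # drop (k + 1) w)" using ex by blast
    obtain i where i: "i \<le> k" "v = w ! i"
      using v(1) len by (auto simp: in_set_conv_nth less_Suc_eq_le)
    have dw: "w ! q < w ! p" if "p < q" "q \<le> k" for p q
      using sorted_wrt_nth_less[OF desc that(1)] that len by simp
    have drop: "map (\<lambda>c. tab w (0, c)) [1..<Suc m] = drop (k + 1) w"
      using tk(2)[of "tab w"] colw[OF len] by simp
    have row: "\<not> tab w (0, Suc c) < tab w (0, c)" if c: "Suc c \<le> m" for c
    proof (cases c)
      case 0
      have ne: "drop (k + 1) w \<noteq> []" using c len by simp
      have "\<not> hd (drop (k + 1) w) < v" using v(2) power_word_Cons[OF ne] by blast
      then have "\<not> w ! (k + 1) < v" using ne by (simp add: hd_drop_conv_nth)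
      \<comment> \<open>The corner is the least letter of the column, so it inherits from
        \<open>v\<close> that the next letter of the row is not below it.\<close>
      moreover have "w ! k \<le> v" using dw[of i k] i by (cases "i = k") auto
      ultimately have "\<not> w ! (k + 1) < w ! k" by (auto dest: order.strict_trans2)
      then show ?thesis using 0 c by (simp add: tab_def)
    next
      case (Suc c')
      have "Suc (Suc c') < length (v # drop (k + 1) w)" using Suc c len by simp
      from power_word_weak[OF v(2) this] show ?thesis using Suc c len by (simp add: tab_def)
    qed
    let ?D = "{(r, c). (c = 0 \<and> r \<le> k) \<or> (r = 0 \<and> c \<le> m)}"
    have "is_ptab (hook (Suc m) k) (tab w)"
      unfolding is_ptab_def diagram_hook
    proof (intro conjI allI impI)
      fix x assume "x \<notin> ?D"
      then show "tab w x = undefined" by (cases x) (auto simp: tab_def)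
    next
      fix r c assume "(r, c) \<in> ?D \<and> (Suc r, c) \<in> ?D"
      then have "c = 0" "Suc r \<le> k" by auto
      then show "tab w (r, c) < tab w (Suc r, c)" using dw[of "k - Suc r" "k - r"] by (simp add: tab_def)
    next
      fix r c assume "(r, c) \<in> ?D \<and> (r, Suc c) \<in> ?D"
      then have "r = 0" "Suc c \<le> m" by auto
      then show "\<not> tab w (r, Suc c) < tab w (r, c)" using row by simp
    qed
    moreover have "tab w (k - i, 0) = v" using i by (simp add: tab_def)
    then have "\<exists>r\<le>k. power_word (tab w (r, 0) # map (\<lambda>c. tab w (0, c)) [1..<Suc m])"
      unfolding drop using v(2) by (intro exI[of _ "k - i"]) simp
    ultimately show "tab w \<in> key_ptabs (Suc m) k" unfolding key_ptabs_def by blast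
  qed
  ultimately show ?thesis by (intro bij_betw_byWitness[where f' = tab])
qed

section \<open>Key words over a total order\<close>

text \<open>By induction the tail is constant. Its letter is not below \<open>v\<close>, and some
  letter of the tail is not above \<open>v\<close>, so over a total order it equals
  \<open>v\<close>: the word is a power of one letter.\<close>

lemma power_word_linorder:
  "power_word (v # s) \<Longrightarrow> x \<in> set s \<Longrightarrow> x = (v :: 'a::linorder)"
proof (induction s arbitrary: v x)
  case (Cons y s)
  have p: "power_word (y # s)" "\<not> y < v" "\<exists>z\<in>set (y # s). \<not> v < z"
    using Cons.prems(1) power_word_Cons[of "y # s" v] by auto
  have "z = y" if "z \<in> set (y # s)" for z using Cons.IH[OF p(1)] that by auto
  then show ?case using p(2,3) Cons.prems(2) by (metis linorder_less_linear)
qed simp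

lemma power_word_replicate: "power_word (v # replicate m v)"
proof (induction m)
  case (Suc m)
  then show ?case using power_word_Cons[of "replicate (Suc m) v" v] by auto
qed (simp add: power_word_single)

lemma count_desc: "is_desc C \<Longrightarrow> count (mset C) x = of_bool (x \<in> set C)"
  using is_desc_distinct[of C] by (simp add: distinct_count_atmost_1)

lemma hook_nth: "i \<le> k \<Longrightarrow> hook (Suc m) k ! i = 1 + m * of_bool (i = 0)"
  by (cases i) (auto simp: hook_def)

text \<open>A key word here is a chain followed by \<open>m\<close> copies of one of its letters
  \<open>v\<close>. Partition content leaves no gaps in the alphabet and decreases weakly, which
  determines the chain and forces \<open>v = 0\<close> when \<open>m > 0\<close>.\<close>

lemma key_word_content:
  assumes \<nu>: "\<nu> \<in> partitions n" and u: "u \<in> content_words \<nu>" "key_word m k u"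
  shows "\<nu> = hook (Suc m) k" "u = rev [0..<Suc k] @ replicate m 0"
proof -
  obtain C s v where C: "u = C @ s" "length C = k + 1" "length s = m" "is_desc C" "v \<in> set C" "power_word (v # s)"
    using u(2) unfolding key_word_split by blast
  have s: "s = replicate m v" using power_word_linorder[OF C(6)] C(3) by (metis replicate_length_same)
  have pos: "0 < \<nu> ! i" if "i < length \<nu>" for i
  proof -
    have "\<nu> ! i \<noteq> 0" using \<nu> nth_mem[OF that] unfolding partitions_def by (metis (mono_tags) mem_Collect_eq)
    then show ?thesis by simp
  qed
  have cnt: "(if i < length \<nu> then \<nu> ! i else 0) = of_bool (i \<in> set C) + m * of_bool (i = v)" for i
  proof -
    have "count (mset u) i = (if i < length \<nu> then \<nu> ! i else 0)" using u(1) unfolding content_words_def by simp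
    moreover have "count (mset u) i = of_bool (i \<in> set C) + m * of_bool (i = v)"
      unfolding C(1) s by (simp add: count_desc[OF C(4)])
    ultimately show ?thesis by simp
  qed
  have "i \<in> set C \<longleftrightarrow> i < length \<nu>" for i
    using cnt[of i] pos[of i] C(5) by (auto split: if_splits)
  then have setC: "set C = {..<length \<nu>}" by auto
  then have len: "length \<nu> = Suc k" using distinct_card[OF is_desc_distinct[OF C(4)]] C(2) by simp
  have "is_desc (rev [0..<Suc k])" unfolding sorted_wrt_rev by (simp del: upt_Suc)
  then have Ceq: "C = rev [0..<Suc k]"
    by (rule is_desc_unique[OF C(4)]) (auto simp: setC len simp del: upt_Suc)
  have nui: "\<nu> ! i = 1 + m * of_bool (i = v)" if "i < Suc k" for i
    using cnt[of i] that len setC by auto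
  have v: "v = 0" if "0 < m"
  proof (rule ccontr)
    assume "v \<noteq> 0"
    moreover have "v < Suc k" using C(5) setC len by simp
    ultimately have "\<nu> ! v \<le> \<nu> ! 0"
      using \<nu> len unfolding partitions_def by (auto simp: sorted_wrt_iff_nth_less)
    then show False using nui[of v] nui[of 0] \<open>v < Suc k\<close> \<open>v \<noteq> 0\<close> that by simp
  qed
  show "u = rev [0..<Suc k] @ replicate m 0"
    using v unfolding C(1) s Ceq by (cases "m = 0") auto
  show "\<nu> = hook (Suc m) k"
  proof (rule nth_equalityI)
    show "length \<nu> = length (hook (Suc m) k)" by (simp add: len hook_def)
    fix i assume "i < length \<nu>"
    then have "i < Suc k" "i \<le> k" using len by auto
    then show "\<nu> ! i = hook (Suc m) k ! i" unfolding nui[OF \<open>i < Suc k\<close>] hook_nth[OF \<open>i \<le> k\<close>] using v by (cases "m = 0") auto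
  qed
qed

text \<open>These are the coefficients of the monomial symmetric function of the hook at partition
  contents, so \<open>hook_comb m k\<close> does represent that function.\<close>

lemma key_count_content:
  assumes \<nu>: "\<nu> \<in> partitions n"
  shows "key_count (content_words \<nu>) m k = of_bool (hook (Suc m) k = \<nu>)"
proof (cases "hook (Suc m) k = \<nu>")
  case True
  let ?u = "rev [0..<Suc k] @ replicate m 0"
  have d: "is_desc (rev [0..<Suc k])" unfolding sorted_wrt_rev by (simp del: upt_Suc)
  have "?u \<in> content_words \<nu>"
    unfolding content_words_def mem_Collect_eq
  proof
    fix i
    have "count (mset ?u) i = of_bool (i \<le> k) + m * of_bool (i = 0)"
      unfolding mset_append count_union count_desc[OF d] by (auto simp del: upt_Suc)
    then show "count (mset ?u) i = (if i < length \<nu> then \<nu> ! i else 0)"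
      unfolding True[symmetric] using hook_nth[of i k m] by (auto simp: hook_def)
  qed
  moreover have "key_word m k ?u"
    unfolding key_word_split
  proof (intro exI conjI)
    show "\<exists>v\<in>set (rev [0..<Suc k]). power_word (v # replicate m 0)"
      by (intro bexI[of _ 0] power_word_replicate) (simp del: upt_Suc)
  qed (use d in simp_all)
  ultimately have "{w \<in> content_words \<nu>. key_word m k w} = {?u}"
    using key_word_content(2)[OF \<nu>] by blast
  then show ?thesis using True by (simp add: key_count_def)
next
  case False
  then have "{w \<in> content_words \<nu>. key_word m k w} = {}" using key_word_content(1)[OF \<nu>] by blast
  then show ?thesis using False unfolding key_count_def by (simp only:) simp
qed

lemma hook_partition: "hook (Suc m) k \<in> partitions (m + 1 + k)" "sum_list (hook (Suc m) k) = m + 1 + k"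
proof -
  have "sorted_wrt (\<ge>) (replicate k (1 :: nat))" by (induction k) auto
  then show "hook (Suc m) k \<in> partitions (m + 1 + k)"
    by (auto simp: partitions_def hook_def sum_list_replicate)
qed (simp add: hook_def sum_list_replicate)

theorem mainTheorem9:
  fixes l k :: nat
  assumes "three_plus_one_free TYPE('a::{finite, order})"
    and "1 \<le> l"
  shows "nc_cong_IH (mP (hook l k) :: 'a list \<Rightarrow> int)
           (\<lambda>w. \<Sum>T \<in> (key_ptabs l k :: (nat \<times> nat \<Rightarrow> 'a) set).
                 nc_mono (colword (hook l k) T) w)"
proof -
  obtain m where l: "l = Suc m" using assms(2) by (cases l) auto
  define n where "n = m + 1 + k"
  obtain a where a: "\<And>\<phi>. admissible \<phi> \<Longrightarrow>
      comb_eval (hook_comb m k) \<phi> = (\<Sum>\<mu>\<in>partitions n. a \<mu> * jacobi_trudi \<phi> \<mu>)"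
    using comb_eval_jacobi_trudi[of "hook_comb m k" n] hook_comb_sum[of _ _ m k] unfolding n_def by blast
  \<comment> \<open>Evaluated on words of content \<nu>, the determinants become Kostka numbers and
    the left side a Kronecker delta: the system that characterises a row of the inverse.\<close>
  have kinv: "kostka_inv n (hook l k) \<mu> = a \<mu>" if "\<mu> \<in> partitions n" for \<mu>
  proof (rule kostka_inv_row)
    fix \<nu> assume \<nu>: "\<nu> \<in> partitions n"
    have "(\<Sum>\<mu>\<in>partitions n. a \<mu> * kostka \<mu> \<nu>) = comb_eval (hook_comb m k) (block_count (content_words \<nu>))"
      unfolding a[OF admissible_content] by (intro sum.cong) (auto simp: kostka_eq_jacobi_trudi)
    also have "\<dots> = key_count (content_words \<nu>) m k"
      by (intro comb_eval_hook_block_count finite_content_words hclosed_content_words)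
    finally show "(\<Sum>\<mu>\<in>partitions n. a \<mu> * kostka \<mu> \<nu>) = (if hook l k = \<nu> then 1 else 0)"
      unfolding key_count_content[OF \<nu>] l by simp
  qed (use that hook_partition(1)[of m k] in \<open>auto simp: l n_def\<close>)
  have mP: "mP (hook l k) w = (\<Sum>\<mu>\<in>partitions n. a \<mu> * JP \<mu> w)" for w :: "'a list"
    unfolding mP_def l hook_partition(2) n_def[symmetric] using kinv by (intro sum.cong) (auto simp: l)
  have fin: "finite {w :: 'a list. length w = n}"
    using finite_lists_length_eq[of "UNIV :: 'a set" n] by simp
  have kw_fin: "finite {w :: 'a list. key_word m k w}"
    by (rule finite_subset[OF _ fin]) (auto simp: key_word_def n_def)
  have KT: "(\<Sum>T\<in>key_ptabs l k. nc_mono (colword (hook l k) T) w) = of_bool (key_word m k w)" for w :: "'a list"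
  proof -
    have "(\<Sum>T\<in>key_ptabs l k. nc_mono (colword (hook l k) T) w) = (\<Sum>u | key_word m k u. nc_mono u w)"
      unfolding l by (rule sum.reindex_bij_betw[OF colword_key_ptabs])
    also have "\<dots> = of_bool (key_word m k w)" using kw_fin by (simp add: nc_mono_def)
    finally show ?thesis .
  qed
  let ?f = "nc_diff (mP (hook l k)) (\<lambda>w. of_bool (key_word m k w)) :: 'a list \<Rightarrow> int"
  have "?f \<in> IH_ideal"
  proof (rule IH_ideal_class_sums)
    have "length w = n" if nz: "?f w \<noteq> 0" for w :: "'a list"
    proof (rule ccontr)
      assume len: "length w \<noteq> n"
      then have "JP \<mu> w = 0" if "\<mu> \<in> partitions n" for \<mu> using JP_length[OF that] by blast
      then have "mP (hook l k) w = 0" unfolding mP by simp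
      moreover have "\<not> key_word m k w" using len by (auto simp: key_word_def n_def)
      ultimately show False using nz by (simp add: nc_diff_def)
    qed
    then show "nc_poly ?f"
      unfolding nc_poly_def by (intro finite_subset[OF _ fin]) blast
    fix u :: "'a list"
    have "(\<Sum>w\<in>hclass u. mP (hook l k) w) = (\<Sum>\<mu>\<in>partitions n. a \<mu> * (\<Sum>w\<in>hclass u. JP \<mu> w))"
      unfolding mP sum_distrib_left by (rule sum.swap)
    \<comment> \<open>The same coefficients \<open>a\<close> are now used for the given poset, where
      (3+1)-freeness makes the count on a class admissible.\<close>
    also have "\<dots> = comb_eval (hook_comb m k) (block_count (hclass u))"
      unfolding sum_JP[OF finite_hclass]
      by (rule a[OF admissible_block_count[OF assms(1) finite_hclass hclosed_hclass], symmetric])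
    also have "\<dots> = key_count (hclass u) m k"
      by (intro comb_eval_hook_block_count finite_hclass hclosed_hclass)
    also have "\<dots> = (\<Sum>w\<in>hclass u. of_bool (key_word m k w))"
      unfolding key_count_def using finite_hclass[of u] by (simp add: of_bool_def sum.If_cases Int_def)
    finally show "(\<Sum>w\<in>hclass u. ?f w) = 0"
      by (simp add: nc_diff_def sum_subtractf)
  qed
  then show ?thesis unfolding nc_cong_IH_def KT .
qed

end
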